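(* Let $p$ be a positive polynomial in the indeterminates $X_1,\dots,X_m,X_1^{-1},\dots,X_m^{-1}$ with coefficients in $\mathcal{L}(\mathcal{C})$. Then there exist an auxiliary Hilbert space $\mathcal{E}$ and operators $B_s:\mathcal{C}\to\mathcal{E}$, defined for words $s\in\mathbb{F}$ of length $\le\deg(p)$, such that, if $q(X)=\sum_{s}B_sX(s)$, then $$p(X)=q(X)^*q(X).$$
   Context: $\mathbb{F}$ is the free group with generators $a_1,\dots,a_m$; the length of $s\in\mathbb{F}$ is that of its reduced word. For $s\in\mathbb{F}$, the monomial $X(s)$ is obtained from $s$ by replacing $a_i$ by $X_i$ and $a_i^{-1}$ by $X_i^{-1}$; monomials multiply by $X(s)X(t)=X(st)$. $\mathcal{C}$ is a fixed Hilbert space. A polynomial is a formal finite sum $p(X)=\sum_sA_sX(s)$ with $A_s\in\mathcal{L}(\mathcal{C})$; $\deg(p)$ is the maximal length of the words appearing in the sum; $p(X)^*=\sum_sA_s^*X(s^{-1})$. The same notation is used for coefficients acting between different Hilbert spaces: for $q(X)=\sum_sB_sX(s)$ with $B_s:\mathcal{C}\to\mathcal{E}$, $q(X)^*=\sum_sB_s^*X(s^{-1})$ and $q(X)^*q(X)=\sum_{s,t}B_s^*B_tX(s^{-1}t)$. If $U_1,\dots,U_m$ are (not necessarily commuting) unitary operators on a separable Hilbert space $\mathcal{X}$, $U(s)$ is obtained from $X(s)$ by replacing $X_i$ with $U_i$ and $X_i^{-1}$ with $U_i^{-1}=U_i^*$, and $p(U)=\sum_sA_s\otimes U(s)\in\mathcal{L}(\mathcal{C}\otimes\mathcal{X})$.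 The polynomial $p$ is positive if $p(U)$ is a positive operator for every choice of such unitary operators $U_1,\dots,U_m$. *)

theory Defs
  imports "HOL-Analysis.Analysis" "HOL-Algebra.Group" "HOL-Library.Function_Algebras"
begin

section \<open>The free group\<close>

text \<open>
  The letter \<open>(i, False)\<close> is the \<open>i\<close>-th generator and \<open>(i, True)\<close> is its inverse; the
  generators are numbered \<open>0, \<dots>, m - 1\<close>.  Group elements are the reduced words, so that the
  length of a group element is its length as a list.
\<close>

type_synonym word = "(nat \<times> bool) list"

fun flip :: "nat \<times> bool \<Rightarrow> nat \<times> bool" where
  "flip (i, b) = (i, \<not> b)"

fun cons_cancel :: "nat \<times> bool \<Rightarrow> word \<Rightarrow> word" where
  "cons_cancel x [] = [x]"
| "cons_cancel x (y # w) = (if y = flip x then w else x # y # w)"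

abbreviation reduced_word :: "word \<Rightarrow> bool" where
  "reduced_word \<equiv> successively (\<lambda>x y. y \<noteq> flip x)"

definition free_group :: "nat \<Rightarrow> word monoid" where
  "free_group m =
     \<lparr>carrier = {w. fst ` set w \<subseteq> {..<m} \<and> reduced_word w}, mult = foldr cons_cancel, one = []\<rparr>"

abbreviation words :: "nat \<Rightarrow> word set" where
  "words m \<equiv> carrier (free_group m)"

lemma flip_flip [simp]: "flip (flip x) = x"
  by (cases x) simp

lemma fst_flip [simp]: "fst (flip x) = fst x"
  by (cases x) simp

lemma flip_eq_iff: "flip x = y \<longleftrightarrow> x = flip y"
  by (cases x; cases y) auto

lemma reduced_cons_cancel: "reduced_word w \<Longrightarrow> reduced_word (cons_cancel x w)"
  by (cases w) (auto simp: successively_Cons)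

lemma cons_cancel_flip: "reduced_word w \<Longrightarrow> cons_cancel x (cons_cancel (flip x) w) = w"
  by (cases w; cases "tl w") auto

lemma reduced_foldr: "reduced_word w \<Longrightarrow> reduced_word (foldr cons_cancel u w)"
  by (induction u) (auto intro: reduced_cons_cancel)

lemma set_cons_cancel: "fst ` set (cons_cancel x w) \<subseteq> insert (fst x) (fst ` set w)"
  by (cases w) auto

lemma set_foldr_cons_cancel: "fst ` set (foldr cons_cancel u w) \<subseteq> fst ` set u \<union> fst ` set w"
proof (induction u)
  case (Cons x u)
  have "fst ` set (foldr cons_cancel (x # u) w) \<subseteq> insert (fst x) (fst ` set (foldr cons_cancel u w))"
    using set_cons_cancel by simp
  also have "\<dots> \<subseteq> insert (fst x) (fst ` set u \<union> fst ` set w)"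
    by (intro insert_mono Cons.IH)
  finally show ?case by simp
qed simp

lemma foldr_cons_cancel_Nil: "reduced_word u \<Longrightarrow> foldr cons_cancel u [] = u"
proof (induction u)
  case (Cons x u)
  then show ?case by (cases u) auto
qed simp

lemma foldr_cons_cancel:
  "reduced_word w \<Longrightarrow> foldr cons_cancel (cons_cancel x v) w = cons_cancel x (foldr cons_cancel v w)"
  by (cases v) (auto simp: cons_cancel_flip reduced_foldr)

lemma foldr_cons_cancel_assoc:
  "reduced_word w \<Longrightarrow>
     foldr cons_cancel (foldr cons_cancel u v) w = foldr cons_cancel u (foldr cons_cancel v w)"
  by (induction u) (auto simp: foldr_cons_cancel)

lemma foldr_cons_cancel_inv:
  "reduced_word w \<Longrightarrow> foldr cons_cancel (rev (map flip u)) (foldr cons_cancel u w) = w"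
proof (induction u arbitrary: w)
  case (Cons x u)
  then show ?case
    using cons_cancel_flip[of "foldr cons_cancel u w" "flip x"] by (simp add: reduced_foldr)
qed simp

lemma inv_word_closed:
  assumes "u \<in> words m" shows "rev (map flip u) \<in> words m"
proof -
  have "(\<lambda>x y. x \<noteq> flip y) = (\<lambda>x y. y \<noteq> flip x)"
    by (intro ext) (metis flip_flip)
  then have "successively (\<lambda>x y. x \<noteq> flip y) u = reduced_word u"
    by (rule arg_cong)
  then show ?thesis
    using assms by (simp add: free_group_def successively_map flip_eq_iff image_subset_iff)
qed

lemma free_group_left_inv:
  assumes "u \<in> words m" shows "rev (map flip u) \<otimes>\<^bsub>free_group m\<^esub> u = \<one>\<^bsub>free_group m\<^esub>"
  using assms foldr_cons_cancel_inv[of "[]" u]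
  by (auto simp: free_group_def foldr_cons_cancel_Nil)

lemma group_free_group: "group (free_group m)"
proof (rule groupI)
  show "x \<otimes>\<^bsub>free_group m\<^esub> y \<in> words m" if "x \<in> words m" "y \<in> words m" for x y
  proof -
    have "fst ` set (foldr cons_cancel x y) \<subseteq> {..<m}"
      using that set_foldr_cons_cancel[of x y] by (fastforce simp: free_group_def)
    then show ?thesis
      using that by (simp add: free_group_def reduced_foldr)
  qed
  show "\<exists>y\<in>words m. y \<otimes>\<^bsub>free_group m\<^esub> x = \<one>\<^bsub>free_group m\<^esub>" if "x \<in> words m" for x
    using inv_word_closed[OF that] free_group_left_inv[OF that] by blast
qed (auto simp: free_group_def foldr_cons_cancel_assoc)

lemma free_group_inv: "u \<in> words m \<Longrightarrow> inv\<^bsub>free_group m\<^esub> u = rev (map flip u)"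
  by (rule group.inv_equality[OF group_free_group free_group_left_inv _ inv_word_closed])


section \<open>Hilbert spaces\<close>

text \<open>
  Complex Hilbert spaces are treated as objects, with a carrier set in some additive type, because
  the auxiliary space and the spaces on which the unitary operators act are quantified over.
  Inner products are linear in the first argument.
\<close>

record 'a hspace = "'a partial_object" +
  hscale :: "complex \<Rightarrow> 'a \<Rightarrow> 'a"
  hinner :: "'a \<Rightarrow> 'a \<Rightarrow> complex"

definition hnorm :: "'a hspace \<Rightarrow> 'a \<Rightarrow> real" where
  "hnorm H x = sqrt (Re (hinner H x x))"

text \<open>The value \<open>0\<close> off the carrier serves the locale \<^locale>\<open>Metric_space\<close>, some of whose
  axioms range over the whole type.\<close>

definition hdist :: "'a::ab_group_add hspace \<Rightarrow> 'a \<Rightarrow> 'a \<Rightarrow> real" where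
  "hdist H x y = (if x \<in> carrier H \<and> y \<in> carrier H then hnorm H (x - y) else 0)"

locale inner_product_space =
  fixes H :: "'a::ab_group_add hspace"
  assumes zero_closed: "0 \<in> carrier H"
    and add_closed: "\<lbrakk>x \<in> carrier H; y \<in> carrier H\<rbrakk> \<Longrightarrow> x + y \<in> carrier H"
    and scale_closed: "x \<in> carrier H \<Longrightarrow> hscale H c x \<in> carrier H"
    and scale_add_right:
      "\<lbrakk>x \<in> carrier H; y \<in> carrier H\<rbrakk> \<Longrightarrow> hscale H c (x + y) = hscale H c x + hscale H c y"
    and scale_add_left: "x \<in> carrier H \<Longrightarrow> hscale H (c + d) x = hscale H c x + hscale H d x"
    and scale_scale: "x \<in> carrier H \<Longrightarrow> hscale H c (hscale H d x) = hscale H (c * d) x"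
    and scale_one: "x \<in> carrier H \<Longrightarrow> hscale H 1 x = x"
    and inner_add_left:
      "\<lbrakk>x \<in> carrier H; y \<in> carrier H; z \<in> carrier H\<rbrakk>
        \<Longrightarrow> hinner H (x + y) z = hinner H x z + hinner H y z"
    and inner_scale_left:
      "\<lbrakk>x \<in> carrier H; y \<in> carrier H\<rbrakk> \<Longrightarrow> hinner H (hscale H c x) y = c * hinner H x y"
    and inner_commute:
      "\<lbrakk>x \<in> carrier H; y \<in> carrier H\<rbrakk> \<Longrightarrow> hinner H y x = cnj (hinner H x y)"
    and inner_nonneg: "x \<in> carrier H \<Longrightarrow> hinner H x x \<in> \<real>\<^sub>\<ge>\<^sub>0"
    and inner_definite: "\<lbrakk>x \<in> carrier H; hinner H x x = 0\<rbrakk> \<Longrightarrow> x = 0"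
begin

lemma scale_zero: "x \<in> carrier H \<Longrightarrow> hscale H 0 x = 0"
  using scale_add_left[of x 0 0] by simp

lemma scale_minus_one: "x \<in> carrier H \<Longrightarrow> hscale H (-1) x = - x"
  using scale_add_left[of x 1 "-1"] scale_zero[of x] scale_one[of x]
  by (simp add: eq_neg_iff_add_eq_0 add.commute)

lemma minus_closed: "x \<in> carrier H \<Longrightarrow> - x \<in> carrier H"
  using scale_closed[of x "-1"] by (simp add: scale_minus_one)

lemma diff_closed: "\<lbrakk>x \<in> carrier H; y \<in> carrier H\<rbrakk> \<Longrightarrow> x - y \<in> carrier H"
  using add_closed[of x "- y"] by (simp add: minus_closed)

lemma inner_add_right:
  assumes "x \<in> carrier H" "y \<in> carrier H" "z \<in> carrier H"
  shows "hinner H z (x + y) = hinner H z x + hinner H z y"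
proof -
  have "hinner H z (x + y) = cnj (hinner H (x + y) z)"
    using assms by (intro inner_commute add_closed)
  also have "\<dots> = cnj (hinner H x z) + cnj (hinner H y z)"
    using assms by (simp add: inner_add_left)
  finally show ?thesis
    using assms by (simp add: inner_commute[of x z] inner_commute[of y z])
qed

lemma inner_scale_right:
  assumes "x \<in> carrier H" "z \<in> carrier H"
  shows "hinner H z (hscale H c x) = cnj c * hinner H z x"
proof -
  have "hinner H z (hscale H c x) = cnj (hinner H (hscale H c x) z)"
    using assms by (intro inner_commute scale_closed)
  also have "\<dots> = cnj c * cnj (hinner H x z)"
    using assms by (simp add: inner_scale_left)
  finally show ?thesis
    using assms by (simp add: inner_commute[of x z])
qed

lemma inner_self: "x \<in> carrier H \<Longrightarrow> hinner H x x = complex_of_real ((hnorm H x)\<^sup>2)"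
  using inner_nonneg[of x]
  by (auto simp: hnorm_def simp flip: of_real_power elim!: nonneg_Reals_cases)

lemma hnorm_nonneg: "x \<in> carrier H \<Longrightarrow> 0 \<le> hnorm H x"
  using inner_nonneg[of x] by (auto simp: hnorm_def elim!: nonneg_Reals_cases)

lemma hnorm_eq_0_iff: "x \<in> carrier H \<Longrightarrow> hnorm H x = 0 \<longleftrightarrow> x = 0"
  using inner_self[of x] inner_definite[of x] inner_scale_left[of 0 0 0]
  by (auto simp: hnorm_def zero_closed scale_zero)

lemma hnorm_scale:
  assumes "x \<in> carrier H" shows "hnorm H (hscale H c x) = cmod c * hnorm H x"
proof -
  have "hinner H (hscale H c x) (hscale H c x) = c * (cnj c * hinner H x x)"
    using assms by (simp add: inner_scale_left inner_scale_right scale_closed)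
  also have "\<dots> = complex_of_real ((cmod c * hnorm H x)\<^sup>2)"
    using assms complex_norm_square[of c] by (simp add: inner_self power_mult_distrib mult.assoc)
  finally show ?thesis
    using assms by (simp add: hnorm_def[of H "hscale H c x"] hnorm_nonneg)
qed

lemma hnorm_add_square:
  assumes "x \<in> carrier H" "y \<in> carrier H"
  shows "(hnorm H (x + y))\<^sup>2 = (hnorm H x)\<^sup>2 + 2 * Re (hinner H x y) + (hnorm H y)\<^sup>2"
proof -
  have "complex_of_real ((hnorm H (x + y))\<^sup>2) = hinner H (x + y) (x + y)"
    using assms by (simp only: inner_self add_closed)
  also have "\<dots> = hinner H x x + (hinner H x y + hinner H y x) + hinner H y y"
    using assms by (simp add: inner_add_left inner_add_right add_closed)
  also have "hinner H x y + hinner H y x = complex_of_real (2 * Re (hinner H x y))"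
    using assms by (simp add: inner_commute[of x y] complex_add_cnj)
  finally show ?thesis
    using assms by (simp only: inner_self flip: of_real_add) (simp only: of_real_eq_iff)
qed

lemma Cauchy_Schwarz_Re:
  assumes x: "x \<in> carrier H" and y: "y \<in> carrier H"
  shows "Re (hinner H x y) \<le> hnorm H x * hnorm H y"
proof (cases "hnorm H x = 0 \<or> hnorm H y = 0")
  case True
  moreover have "hinner H 0 y = 0" "hinner H x 0 = 0"
    using inner_scale_left[of 0 y 0] inner_scale_right[of 0 x 0] x y
    by (simp_all add: zero_closed scale_zero)
  ultimately show ?thesis
    using x y hnorm_eq_0_iff[OF x] hnorm_eq_0_iff[OF y] by (metis complex.sel(1) mult_eq_0_iff order_refl zero_complex.code)
next
  case False
  define a b where "a = hnorm H x" and "b = hnorm H y"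
  have ab: "a > 0" "b > 0"
    using False hnorm_nonneg[OF x] hnorm_nonneg[OF y] by (auto simp: a_def b_def)
  define u v where "u = hscale H (of_real b) x" and "v = hscale H (- of_real a) y"
  have uv: "u \<in> carrier H" "v \<in> carrier H"
    using x y by (auto simp: u_def v_def scale_closed)
  have "hnorm H u = b * a" "hnorm H v = a * b"
    using x y ab by (auto simp: u_def v_def hnorm_scale a_def b_def)
  moreover have "hinner H u v = - of_real (a * b) * hinner H x y"
    using x y by (simp add: u_def v_def inner_scale_left inner_scale_right scale_closed)
  ultimately have "0 \<le> (b * a)\<^sup>2 + 2 * (- (a * b) * Re (hinner H x y)) + (a * b)\<^sup>2"
    using hnorm_add_square[OF uv] zero_le_power2[of "hnorm H (u + v)"] by simp
  then have "(a * b) * Re (hinner H x y) \<le> (a * b) * (a * b)"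
    by (simp add: power2_eq_square mult_ac)
  then show ?thesis
    using ab by (simp add: a_def b_def)
qed

lemma hnorm_triangle:
  assumes "x \<in> carrier H" "y \<in> carrier H"
  shows "hnorm H (x + y) \<le> hnorm H x + hnorm H y"
proof (rule power2_le_imp_le)
  show "(hnorm H (x + y))\<^sup>2 \<le> (hnorm H x + hnorm H y)\<^sup>2"
    using hnorm_add_square[OF assms] Cauchy_Schwarz_Re[OF assms] by (simp add: power2_sum)
qed (use assms in \<open>simp add: hnorm_nonneg\<close>)

sublocale Metric_space "carrier H" "hdist H"
proof
  fix x y z
  show "0 \<le> hdist H x y"
    by (simp add: hdist_def hnorm_nonneg diff_closed)
  show "hdist H x y = hdist H y x"
    using hnorm_scale[of "x - y" "-1"] by (simp add: hdist_def scale_minus_one diff_closed)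
  show "hdist H x y = 0 \<longleftrightarrow> x = y" if "x \<in> carrier H" "y \<in> carrier H"
    using that by (simp add: hdist_def hnorm_eq_0_iff diff_closed)
  show "hdist H x z \<le> hdist H x y + hdist H y z"
    if "x \<in> carrier H" "y \<in> carrier H" "z \<in> carrier H"
    using that hnorm_triangle[of "x - y" "y - z"] by (simp add: hdist_def diff_closed)
qed

end

locale hilbert_space = inner_product_space +
  assumes complete: mcomplete

abbreviation htopology :: "'a::ab_group_add hspace \<Rightarrow> 'a topology" where
  "htopology H \<equiv> Metric_space.mtopology (carrier H) (hdist H)"


section \<open>Bounded operators\<close>

text \<open>Operators are extensional functions, so that equality of operators is equality of
  functions.\<close>

definition bounded_ops ::
    "'a::ab_group_add hspace \<Rightarrow> 'b::ab_group_add hspace \<Rightarrow> ('a \<Rightarrow> 'b) set" where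
  "bounded_ops H K =
     {A \<in> carrier H \<rightarrow>\<^sub>E carrier K.
        (\<forall>x\<in>carrier H. \<forall>y\<in>carrier H. A (x + y) = A x + A y) \<and>
        (\<forall>c. \<forall>x\<in>carrier H. A (hscale H c x) = hscale K c (A x)) \<and>
        (\<exists>M. \<forall>x\<in>carrier H. hnorm K (A x) \<le> M * hnorm H x)}"

definition zero_op :: "'a hspace \<Rightarrow> 'a \<Rightarrow> 'b::ab_group_add" where
  "zero_op H = (\<lambda>x\<in>carrier H. 0)"

definition id_op :: "'a hspace \<Rightarrow> 'a \<Rightarrow> 'a" where
  "id_op H = (\<lambda>x\<in>carrier H. x)"

definition adj_op ::
    "'a::ab_group_add hspace \<Rightarrow> 'b::ab_group_add hspace \<Rightarrow> ('a \<Rightarrow> 'b) \<Rightarrow> 'b \<Rightarrow> 'a" where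
  "adj_op H K A =
     (THE B. B \<in> bounded_ops K H \<and>
        (\<forall>x\<in>carrier H. \<forall>y\<in>carrier K. hinner K (A x) y = hinner H x (B y)))"

definition unitary_op :: "'a::ab_group_add hspace \<Rightarrow> ('a \<Rightarrow> 'a) \<Rightarrow> bool" where
  "unitary_op H U \<longleftrightarrow>
     U \<in> bounded_ops H H \<and>
     compose (carrier H) (adj_op H H U) U = id_op H \<and>
     compose (carrier H) U (adj_op H H U) = id_op H"

definition positive_op :: "'a::ab_group_add hspace \<Rightarrow> ('a \<Rightarrow> 'a) \<Rightarrow> bool" where
  "positive_op H A \<longleftrightarrow> A \<in> bounded_ops H H \<and> (\<forall>x\<in>carrier H. hinner H (A x) x \<in> \<real>\<^sub>\<ge>\<^sub>0)"


section \<open>Tensor products\<close>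

text \<open>
  \<open>T\<close> together with \<open>\<tau>\<close>, the map \<open>(x, y) \<mapsto> x \<otimes> y\<close>, is a Hilbert space tensor product of \<open>H\<close> and
  \<open>K\<close>.  This determines \<open>(T, \<tau>)\<close> up to a unique unitary equivalence.
\<close>

definition hilbert_tensor ::
    "'a::ab_group_add hspace \<Rightarrow> 'b::ab_group_add hspace \<Rightarrow> 't::ab_group_add hspace
      \<Rightarrow> ('a \<Rightarrow> 'b \<Rightarrow> 't) \<Rightarrow> bool" where
  "hilbert_tensor H K T \<tau> \<longleftrightarrow>
     hilbert_space T \<and>
     (\<forall>x\<in>carrier H. \<forall>y\<in>carrier K. \<tau> x y \<in> carrier T) \<and>
     (\<forall>x\<in>carrier H. \<forall>x'\<in>carrier H. \<forall>y\<in>carrier K. \<tau> (x + x') y = \<tau> x y + \<tau> x' y) \<and>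
     (\<forall>x\<in>carrier H. \<forall>y\<in>carrier K. \<forall>y'\<in>carrier K. \<tau> x (y + y') = \<tau> x y + \<tau> x y') \<and>
     (\<forall>c. \<forall>x\<in>carrier H. \<forall>y\<in>carrier K.
        \<tau> (hscale H c x) y = hscale T c (\<tau> x y) \<and> \<tau> x (hscale K c y) = hscale T c (\<tau> x y)) \<and>
     (\<forall>x\<in>carrier H. \<forall>x'\<in>carrier H. \<forall>y\<in>carrier K. \<forall>y'\<in>carrier K.
        hinner T (\<tau> x y) (\<tau> x' y') = hinner H x x' * hinner K y y') \<and>
     htopology T closure_of
       {\<Sum>i<n. \<tau> (x i) (y i) |(n::nat) x y. (\<forall>i<n. x i \<in> carrier H \<and> y i \<in> carrier K)} = carrier T"

definition tensor_op ::
    "'a::ab_group_add hspace \<Rightarrow> 'b::ab_group_add hspace \<Rightarrow> 't::ab_group_add hspace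
      \<Rightarrow> ('a \<Rightarrow> 'b \<Rightarrow> 't) \<Rightarrow> ('a \<Rightarrow> 'a) \<Rightarrow> ('b \<Rightarrow> 'b) \<Rightarrow> 't \<Rightarrow> 't" where
  "tensor_op H K T \<tau> A B =
     (THE R. R \<in> bounded_ops T T \<and>
        (\<forall>x\<in>carrier H. \<forall>y\<in>carrier K. R (\<tau> x y) = \<tau> (A x) (B y)))"


section \<open>Polynomials with operator coefficients\<close>

text \<open>
  The formal sum \<open>\<Sum>\<^sub>s A\<^sub>s X(s)\<close> with \<open>A\<^sub>s : H \<rightarrow> K\<close> is represented by its coefficient
  function \<open>s \<mapsto> A\<^sub>s\<close> on the free group on \<open>m\<close> generators.
\<close>

definition poly_supp ::
    "nat \<Rightarrow> 'a hspace \<Rightarrow> (word \<Rightarrow> 'a \<Rightarrow> 'b::ab_group_add) \<Rightarrow> word set" where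
  "poly_supp m H p = {s \<in> words m. p s \<noteq> zero_op H}"

definition polynomials ::
    "nat \<Rightarrow> 'a::ab_group_add hspace \<Rightarrow> 'b::ab_group_add hspace \<Rightarrow> (word \<Rightarrow> 'a \<Rightarrow> 'b) set" where
  "polynomials m H K = {p \<in> words m \<rightarrow>\<^sub>E bounded_ops H K. finite (poly_supp m H p)}"

text \<open>The zero polynomial has degree \<open>0\<close>.\<close>

definition poly_deg :: "nat \<Rightarrow> 'a hspace \<Rightarrow> (word \<Rightarrow> 'a \<Rightarrow> 'b::ab_group_add) \<Rightarrow> nat" where
  "poly_deg m H p = Max (insert 0 (length ` poly_supp m H p))"

definition poly_adj ::
    "nat \<Rightarrow> 'a::ab_group_add hspace \<Rightarrow> 'b::ab_group_add hspace
      \<Rightarrow> (word \<Rightarrow> 'a \<Rightarrow> 'b) \<Rightarrow> word \<Rightarrow> 'b \<Rightarrow> 'a" where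
  "poly_adj m H K p = (\<lambda>s\<in>words m. adj_op H K (p (inv\<^bsub>free_group m\<^esub> s)))"

text \<open>The product of \<open>p\<close>, with coefficients from \<open>K\<close> to a third space, and \<open>q\<close>, with coefficients
  from \<open>H\<close> to \<open>K\<close>.\<close>

definition poly_mult ::
    "nat \<Rightarrow> 'a hspace \<Rightarrow> 'b hspace \<Rightarrow> (word \<Rightarrow> 'b \<Rightarrow> 'c::ab_group_add)
      \<Rightarrow> (word \<Rightarrow> 'a \<Rightarrow> 'b::ab_group_add) \<Rightarrow> word \<Rightarrow> 'a \<Rightarrow> 'c" where
  "poly_mult m H K p q =
     (\<lambda>w\<in>words m. \<lambda>x\<in>carrier H.
        \<Sum>(s, t)\<in>{(s, t). s \<in> poly_supp m K p \<and> t \<in> poly_supp m H q \<and> s \<otimes>\<^bsub>free_group m\<^esub> t = w}.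
          p s (q t x))"

fun letter_op ::
    "'x::ab_group_add hspace \<Rightarrow> (nat \<Rightarrow> 'x \<Rightarrow> 'x) \<Rightarrow> nat \<times> bool \<Rightarrow> 'x \<Rightarrow> 'x" where
  "letter_op X U (i, b) = (if b then adj_op X X (U i) else U i)"

definition word_op ::
    "'x::ab_group_add hspace \<Rightarrow> (nat \<Rightarrow> 'x \<Rightarrow> 'x) \<Rightarrow> word \<Rightarrow> 'x \<Rightarrow> 'x" where
  "word_op X U s = foldr (\<lambda>a. compose (carrier X) (letter_op X U a)) s (id_op X)"

text \<open>The operator \<open>p(U) = \<Sum>\<^sub>s A\<^sub>s \<otimes> U(s)\<close> on the tensor product \<open>(T, \<tau>)\<close> of \<open>C\<close> and \<open>X\<close>.\<close>

definition poly_eval ::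
    "nat \<Rightarrow> 'c::ab_group_add hspace \<Rightarrow> 'x::ab_group_add hspace \<Rightarrow> 't::ab_group_add hspace
      \<Rightarrow> ('c \<Rightarrow> 'x \<Rightarrow> 't) \<Rightarrow> (nat \<Rightarrow> 'x \<Rightarrow> 'x) \<Rightarrow> (word \<Rightarrow> 'c \<Rightarrow> 'c) \<Rightarrow> 't \<Rightarrow> 't" where
  "poly_eval m C X T \<tau> U p =
     (\<lambda>\<xi>\<in>carrier T. \<Sum>s\<in>poly_supp m C p. tensor_op C X T \<tau> (p s) (word_op X U s) \<xi>)"

text \<open>
  HOL cannot quantify over the types of \<open>X\<close> and \<open>T\<close>, so types are fixed in which all isomorphism
  classes occur.  A separable Hilbert space with orthonormal basis \<open>e\<close> embeds into
  \<^typ>\<open>nat \<Rightarrow> complex\<close> by \<open>x \<mapsto> (\<lambda>n. \<langle>x, e n\<rangle>)\<close>; every tensor product of \<open>C\<close> and \<open>X\<close> embeds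
  into the type of \<open>T\<close> by \<open>\<xi> \<mapsto> (\<lambda>(x, y). \<langle>\<xi>, x \<otimes> y\<rangle>)\<close>, extended by \<open>0\<close>.
\<close>

definition positive_poly :: "nat \<Rightarrow> 'c::ab_group_add hspace \<Rightarrow> (word \<Rightarrow> 'c \<Rightarrow> 'c) \<Rightarrow> bool" where
  "positive_poly m C p \<longleftrightarrow>
     (\<forall>(X :: (nat \<Rightarrow> complex) hspace) U
       (T :: ('c \<times> (nat \<Rightarrow> complex) \<Rightarrow> complex) hspace) \<tau>.
        hilbert_space X \<longrightarrow> separable_space (htopology X) \<longrightarrow> (\<forall>i<m. unitary_op X (U i)) \<longrightarrow>
        hilbert_tensor C X T \<tau> \<longrightarrow>
        positive_op T (poly_eval m C X T \<tau> U p))"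

text \<open>
  The type in which an auxiliary space \<open>E\<close> for coefficients \<open>B s : C \<rightarrow> E\<close> is sought.  If the vectors
  \<open>B s x\<close> span a dense subspace of \<open>E\<close>, as one may assume, then \<open>E\<close> embeds into this type by
  \<open>e \<mapsto> (\<lambda>(s, x). \<langle>e, B s x\<rangle>)\<close>, extended by \<open>0\<close>.
\<close>

type_synonym 'c aux = "word \<times> 'c \<Rightarrow> complex"

end

theory Submission
  imports Defs
begin

text \<open>
  Let \<open>n\<close> be the degree of \<open>p\<close> and \<open>S\<close> the ball of words of length at most \<open>n\<close>.  The coefficient of
  \<open>q\<^sup>* q\<close> at \<open>w\<close> is the sum of \<open>B\<^sub>s\<^sup>* B\<^sub>t\<close> over the pairs in \<open>S\<close> with \<open>s\<^sup>-\<^sup>1 t = w\<close>.  So the theorem asks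
  for a positive operator \<open>G\<close> on \<open>C\<^sup>S\<close> whose blocks \<open>G s t\<close> have the sum \<open>p w\<close> over these pairs, for each
  \<open>w\<close>; then \<open>B\<^sub>s\<close> can be taken as the restriction of the square root of \<open>G\<close> to the summand of \<open>C\<^sup>S\<close> with
  index \<open>s\<close>.

  By duality, \<open>G\<close> is a functional on the finite rank hermitian operators on \<open>C\<^sup>S\<close>.  It has to be
  nonnegative on sums of squares \<open>v \<otimes> v\<^sup>*\<close>, and the condition on \<open>p\<close> prescribes it on the block Toeplitz
  matrices \<open>(z (s\<^sup>-\<^sup>1 t))\<close>.  Every finite rank hermitian operator is dominated by a Toeplitz matrix with equal
  diagonal blocks (\<open>square_dominated\<close>), so the theorem on extension of positive functionals
  (\<open>positive_functional_extension\<close>) reduces the existence of \<open>G\<close> to one inequality: the prescribed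
  value is nonnegative on every Toeplitz matrix that is a sum of squares.

  This inequality is where unitaries enter (\<open>positive_at_toeplitz_family\<close>).  A sum of \<open>N\<close> squares is a
  Gram matrix of vectors \<open>V s x\<close> in \<open>\<complex>\<^sup>N\<close>, for \<open>s\<close> in \<open>S\<close> and \<open>x\<close> in \<open>C\<close>.  If it is Toeplitz, then
  \<open>V s x \<mapsto> V (a s) x\<close> is isometric for each generator \<open>a\<close>, wherever \<open>s\<close> and \<open>a s\<close> both lie in \<open>S\<close>, and
  extends to a unitary operator on \<open>\<complex>\<^sup>N\<close> (\<open>unitary_extension\<close>).  A ball contains the suffixes of its words, so
  the operators \<open>U(w)\<close> formed from these unitaries map \<open>V [] x\<close> to \<open>V w x\<close> for all \<open>w\<close> in \<open>S\<close>, in particular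
  on the support of \<open>p\<close>.  Hence the prescribed value is \<open>\<langle>p(U) \<xi>, \<xi>\<rangle>\<close> for some vector \<open>\<xi>\<close>, and \<open>p\<close> is
  positive.
\<close>

section \<open>Hilbert spaces and bounded operators\<close>

context inner_product_space
begin

lemmas closed = zero_closed add_closed scale_closed minus_closed diff_closed

lemma sum_closed: "(\<And>i. i \<in> I \<Longrightarrow> f i \<in> carrier H) \<Longrightarrow> sum f I \<in> carrier H"
  by (induction I rule: infinite_finite_induct) (auto simp: closed)

lemma scale_zero_right: "hscale H c 0 = 0"
  using scale_add_right[of 0 0 c] by (simp add: zero_closed)

lemma scale_sum:
  "(\<And>i. i \<in> I \<Longrightarrow> f i \<in> carrier H) \<Longrightarrow> hscale H c (sum f I) = (\<Sum>i\<in>I. hscale H c (f i))"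
  by (induction I rule: infinite_finite_induct)
    (auto simp: scale_zero_right scale_add_right sum_closed)

lemma scale_diff_right:
  "\<lbrakk>x \<in> carrier H; y \<in> carrier H\<rbrakk> \<Longrightarrow> hscale H c (x - y) = hscale H c x - hscale H c y"
  using scale_add_right[of "x - y" y c] by (simp add: closed)

lemma inner_zero_left [simp]: "y \<in> carrier H \<Longrightarrow> hinner H 0 y = 0"
  using inner_add_left[of 0 0 y] by (simp add: zero_closed)

lemma inner_zero_right [simp]: "y \<in> carrier H \<Longrightarrow> hinner H y 0 = 0"
  using inner_add_right[of 0 0 y] by (simp add: zero_closed)

lemma inner_diff_left:
  "\<lbrakk>x \<in> carrier H; y \<in> carrier H; z \<in> carrier H\<rbrakk>
    \<Longrightarrow> hinner H (x - y) z = hinner H x z - hinner H y z"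
  using inner_add_left[of "x - y" y z] by (simp add: closed)

lemma inner_diff_right:
  "\<lbrakk>x \<in> carrier H; y \<in> carrier H; z \<in> carrier H\<rbrakk>
    \<Longrightarrow> hinner H z (x - y) = hinner H z x - hinner H z y"
  using inner_add_right[of "x - y" y z] by (simp add: closed)

lemma inner_sum_left:
  "\<lbrakk>\<And>i. i \<in> I \<Longrightarrow> f i \<in> carrier H; z \<in> carrier H\<rbrakk>
    \<Longrightarrow> hinner H (sum f I) z = (\<Sum>i\<in>I. hinner H (f i) z)"
  by (induction I rule: infinite_finite_induct) (auto simp: inner_add_left sum_closed)

lemma inner_sum_right:
  "\<lbrakk>\<And>i. i \<in> I \<Longrightarrow> f i \<in> carrier H; z \<in> carrier H\<rbrakk>
    \<Longrightarrow> hinner H z (sum f I) = (\<Sum>i\<in>I. hinner H z (f i))"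
  by (induction I rule: infinite_finite_induct) (auto simp: inner_add_right sum_closed)

lemmas inner_simps = inner_add_left inner_add_right inner_diff_left inner_diff_right
  inner_scale_left inner_scale_right

lemma Re_inner_commute:
  "\<lbrakk>x \<in> carrier H; y \<in> carrier H\<rbrakk> \<Longrightarrow> Re (hinner H y x) = Re (hinner H x y)"
  using inner_commute[of x y] by simp

lemma Re_inner_self: "x \<in> carrier H \<Longrightarrow> Re (hinner H x x) = (hnorm H x)\<^sup>2"
  by (simp add: inner_self)

text \<open>
  Real parts suffice: the difference of the two vectors may be taken for \<open>y\<close>.  The forms from which operators
  are constructed below are therefore real.
\<close>

lemma eqI_Re_inner:
  assumes "a \<in> carrier H" "b \<in> carrier H"
    and "\<And>y. y \<in> carrier H \<Longrightarrow> Re (hinner H a y) = Re (hinner H b y)"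
  shows "a = b"
proof -
  have "(hnorm H (a - b))\<^sup>2 = Re (hinner H a (a - b)) - Re (hinner H b (a - b))"
    using assms(1,2) by (simp flip: Re_inner_self add: closed inner_diff_left)
  then have "hnorm H (a - b) = 0"
    using assms by (simp add: closed)
  then show ?thesis
    using assms hnorm_eq_0_iff[of "a - b"] by (simp add: closed)
qed

lemma abs_Re_inner_le:
  assumes "x \<in> carrier H" "y \<in> carrier H"
  shows "\<bar>Re (hinner H x y)\<bar> \<le> hnorm H x * hnorm H y"
  using Cauchy_Schwarz_Re[OF assms] Cauchy_Schwarz_Re[of "hscale H (-1) x" y] assms
  by (auto simp: closed hnorm_scale inner_scale_left abs_le_iff)

lemma hnorm_zero [simp]: "hnorm H 0 = 0"
  using hnorm_eq_0_iff[of 0] by (simp add: zero_closed)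

lemma hnorm_minus: "x \<in> carrier H \<Longrightarrow> hnorm H (- x) = hnorm H x"
  using hnorm_scale[of x "-1"] by (simp add: scale_minus_one)

lemma hnorm_minus_commute:
  "\<lbrakk>x \<in> carrier H; y \<in> carrier H\<rbrakk> \<Longrightarrow> hnorm H (x - y) = hnorm H (y - x)"
  using hnorm_minus[of "x - y"] by (simp add: closed)

lemma hnorm_diff_square:
  assumes "x \<in> carrier H" "y \<in> carrier H"
  shows "(hnorm H (x - y))\<^sup>2 = (hnorm H x)\<^sup>2 - 2 * Re (hinner H x y) + (hnorm H y)\<^sup>2"
  using hnorm_add_square[of x "- y"] inner_scale_right[of y x "-1"] assms
  by (simp add: closed hnorm_minus scale_minus_one)

lemma hnorm_triangle_diff:
  assumes "x \<in> carrier H" "y \<in> carrier H" "z \<in> carrier H"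
  shows "hnorm H (x - z) \<le> hnorm H (x - y) + hnorm H (y - z)"
  using hnorm_triangle[of "x - y" "y - z"] assms by (simp add: closed)

lemma hnorm_sum_le:
  "(\<And>i. i \<in> I \<Longrightarrow> f i \<in> carrier H) \<Longrightarrow> hnorm H (sum f I) \<le> (\<Sum>i\<in>I. hnorm H (f i))"
proof (induction I rule: infinite_finite_induct)
  case (insert i I)
  then show ?case
    using hnorm_triangle[of "f i" "sum f I"] by (fastforce simp: sum_closed)
qed auto

lemma hilbert_spaceI:
  assumes "\<And>x :: nat \<Rightarrow> 'a. \<lbrakk>\<And>n. x n \<in> carrier H;
      \<And>e. 0 < e \<Longrightarrow> \<exists>N. \<forall>m\<ge>N. \<forall>n\<ge>N. hnorm H (x m - x n) < e\<rbrakk>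
      \<Longrightarrow> \<exists>l\<in>carrier H. (\<lambda>n. hnorm H (x n - l)) \<longlonglongrightarrow> 0"
  shows "hilbert_space H"
proof
  show mcomplete
    unfolding mcomplete_def
  proof (intro allI impI)
    fix \<sigma> assume \<sigma>: "MCauchy \<sigma>"
    then have mem: "\<sigma> n \<in> carrier H" for n
      by (auto simp: MCauchy_def)
    have "\<exists>l\<in>carrier H. (\<lambda>n. hnorm H (\<sigma> n - l)) \<longlonglongrightarrow> 0"
    proof (rule assms)
      fix e :: real assume "0 < e"
      then show "\<exists>N. \<forall>m\<ge>N. \<forall>n\<ge>N. hnorm H (\<sigma> m - \<sigma> n) < e"
        using \<sigma> mem by (simp add: MCauchy_def hdist_def)
    qed (rule mem)
    then obtain l where "l \<in> carrier H" "(\<lambda>n. hnorm H (\<sigma> n - l)) \<longlonglongrightarrow> 0"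
      by blast
    then show "\<exists>l. limitin mtopology \<sigma> l sequentially"
      using mem by (intro exI[of _ l]) (simp add: limitin_metric_dist_null hdist_def)
  qed
qed

end

lemma (in hilbert_space) Cauchy_has_limit:
  assumes mem: "\<And>n::nat. x n \<in> carrier H"
    and Cau: "\<And>e. 0 < e \<Longrightarrow> \<exists>N. \<forall>m\<ge>N. \<forall>n\<ge>N. hnorm H (x m - x n) < e"
  obtains l where "l \<in> carrier H" "(\<lambda>n. hnorm H (x n - l)) \<longlonglongrightarrow> 0"
proof -
  have "MCauchy x"
    unfolding MCauchy_def
  proof (intro conjI allI impI)
    fix e :: real assume "0 < e"
    then show "\<exists>N. \<forall>n n'. N \<le> n \<longrightarrow> N \<le> n' \<longrightarrow> hdist H (x n) (x n') < e"
      using Cau[of e] mem by (simp add: hdist_def)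
  qed (use mem in auto)
  then obtain l where l: "limitin mtopology x l sequentially"
    using complete by (auto simp: mcomplete_def)
  then have "l \<in> carrier H" "(\<lambda>n. hnorm H (x n - l)) \<longlonglongrightarrow> 0"
    using mem by (auto simp: limitin_metric_dist_null hdist_def)
  then show ?thesis
    by (rule that)
qed

subsection \<open>Bounded operators\<close>

lemma bounded_opsI:
  assumes "\<And>x. x \<in> carrier H \<Longrightarrow> A x \<in> carrier K"
    and "\<And>x y. \<lbrakk>x \<in> carrier H; y \<in> carrier H\<rbrakk> \<Longrightarrow> A (x + y) = A x + A y"
    and "\<And>c x. x \<in> carrier H \<Longrightarrow> A (hscale H c x) = hscale K c (A x)"
    and "\<And>x. x \<in> carrier H \<Longrightarrow> hnorm K (A x) \<le> M * hnorm H x"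
    and "inner_product_space H"
  shows "restrict A (carrier H) \<in> bounded_ops H K"
  using assms(1-3) assms(4) inner_product_space.add_closed[OF assms(5)]
    inner_product_space.scale_closed[OF assms(5)]
  by (auto simp: bounded_ops_def intro!: exI[of _ M])

locale bounded_op = dom: inner_product_space H + cod: inner_product_space K
  for H :: "'a::ab_group_add hspace" and K :: "'b::ab_group_add hspace" +
  fixes A :: "'a \<Rightarrow> 'b"
  assumes mem: "A \<in> bounded_ops H K"
begin

lemma closed: "x \<in> carrier H \<Longrightarrow> A x \<in> carrier K"
  and add: "\<lbrakk>x \<in> carrier H; y \<in> carrier H\<rbrakk> \<Longrightarrow> A (x + y) = A x + A y"
  and scale: "x \<in> carrier H \<Longrightarrow> A (hscale H c x) = hscale K c (A x)"
  using mem by (auto simp: bounded_ops_def)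

lemma zero [simp]: "A 0 = 0"
  using add[of 0 0] by (simp add: dom.zero_closed)

lemma diff: "\<lbrakk>x \<in> carrier H; y \<in> carrier H\<rbrakk> \<Longrightarrow> A (x - y) = A x - A y"
  using add[of "x - y" y] by (simp add: dom.diff_closed)

lemma sum: "(\<And>i. i \<in> I \<Longrightarrow> f i \<in> carrier H) \<Longrightarrow> A (sum f I) = (\<Sum>i\<in>I. A (f i))"
  by (induction I rule: infinite_finite_induct) (auto simp: add dom.sum_closed)

lemma bound:
  obtains M where "0 \<le> M" "\<And>x. x \<in> carrier H \<Longrightarrow> hnorm K (A x) \<le> M * hnorm H x"
proof -
  obtain M where M: "\<And>x. x \<in> carrier H \<Longrightarrow> hnorm K (A x) \<le> M * hnorm H x"
    using mem unfolding bounded_ops_def by blast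
  have "hnorm K (A x) \<le> \<bar>M\<bar> * hnorm H x" if "x \<in> carrier H" for x
    using M[OF that] mult_right_mono[OF abs_ge_self[of M] dom.hnorm_nonneg[OF that]] by linarith
  then show ?thesis
    using that[of "\<bar>M\<bar>"] by simp
qed

end

lemma bounded_opI:
  "\<lbrakk>inner_product_space H; inner_product_space K; A \<in> bounded_ops H K\<rbrakk> \<Longrightarrow> bounded_op H K A"
  by (simp add: bounded_op_def bounded_op_axioms_def)

lemma bounded_ops_eqI:
  assumes "A \<in> bounded_ops H K" "B \<in> bounded_ops H K" "\<And>x. x \<in> carrier H \<Longrightarrow> A x = B x"
  shows "A = B"
  using assms by (intro extensionalityI[of A "carrier H"]) (auto simp: bounded_ops_def PiE_def)

lemma bounded_ops_compose:
  assumes H: "inner_product_space H" and K: "inner_product_space K" and L: "inner_product_space L"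
    and A: "A \<in> bounded_ops H K" and B: "B \<in> bounded_ops K L"
  shows "compose (carrier H) B A \<in> bounded_ops H L"
proof -
  interpret A: bounded_op H K A by (intro bounded_opI assms)
  interpret B: bounded_op K L B by (intro bounded_opI assms)
  obtain M where M: "\<And>x. x \<in> carrier H \<Longrightarrow> hnorm K (A x) \<le> M * hnorm H x"
    using A.bound by blast
  obtain M' where M': "0 \<le> M'" "\<And>x. x \<in> carrier K \<Longrightarrow> hnorm L (B x) \<le> M' * hnorm K x"
    using B.bound by blast
  have "hnorm L (B (A x)) \<le> (M' * M) * hnorm H x" if "x \<in> carrier H" for x
    using M'(2)[OF A.closed[OF that]] mult_left_mono[OF M[OF that] M'(1)] by (simp add: mult.assoc)
  then show ?thesis
    unfolding compose_def
    by (intro bounded_opsI H) (auto simp: A.closed B.closed A.add B.add A.scale B.scale)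
qed

lemma id_op_bounded: "inner_product_space H \<Longrightarrow> id_op H \<in> bounded_ops H H"
  unfolding id_op_def by (rule bounded_opsI[where M = 1]) auto

lemma zero_op_bounded:
  assumes "inner_product_space H" "inner_product_space K"
  shows "zero_op H \<in> bounded_ops H K"
proof -
  interpret K: inner_product_space K by fact
  show ?thesis
    unfolding zero_op_def using assms
    by (intro bounded_opsI[where M = 0]) (auto simp: K.zero_closed K.scale_zero_right)
qed

subsection \<open>Adjoints and unitaries\<close>

text \<open>
  Each adjoint that occurs can be exhibited, which evaluates the definite description in \<^const>\<open>adj_op\<close>.
\<close>

definition adjoint_pair ::
    "'a::ab_group_add hspace \<Rightarrow> 'b::ab_group_add hspace \<Rightarrow> ('a \<Rightarrow> 'b) \<Rightarrow> ('b \<Rightarrow> 'a) \<Rightarrow> bool" where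
  "adjoint_pair H K A B \<longleftrightarrow> A \<in> bounded_ops H K \<and> B \<in> bounded_ops K H \<and>
     (\<forall>x\<in>carrier H. \<forall>y\<in>carrier K. hinner K (A x) y = hinner H x (B y))"

lemma adj_op_eq:
  assumes "inner_product_space H" "inner_product_space K" and AB: "adjoint_pair H K A B"
  shows "adj_op H K A = B"
  unfolding adj_op_def
proof (rule the_equality)
  interpret H: inner_product_space H by fact
  interpret K: inner_product_space K by fact
  show "B \<in> bounded_ops K H \<and> (\<forall>x\<in>carrier H. \<forall>y\<in>carrier K. hinner K (A x) y = hinner H x (B y))"
    using AB by (simp add: adjoint_pair_def)
  fix B' assume B': "B' \<in> bounded_ops K H \<and>
    (\<forall>x\<in>carrier H. \<forall>y\<in>carrier K. hinner K (A x) y = hinner H x (B' y))"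
  interpret B: bounded_op K H B
    using AB by unfold_locales (simp add: adjoint_pair_def)
  interpret B': bounded_op K H B'
    using B' by unfold_locales simp
  show "B' = B"
  proof (rule bounded_ops_eqI[OF B'.mem B.mem], rule H.eqI_Re_inner)
    fix y x assume "y \<in> carrier K" "x \<in> carrier H"
    then have "hinner H x (B' y) = hinner H x (B y)"
      using AB B' by (simp add: adjoint_pair_def)
    then show "Re (hinner H (B' y) x) = Re (hinner H (B y) x)"
      using \<open>y \<in> carrier K\<close> \<open>x \<in> carrier H\<close>
      by (simp add: H.Re_inner_commute[of x] B.closed B'.closed)
  qed (auto simp: B.closed B'.closed)
qed

text \<open>The imaginary part of \<open>\<langle>A x, y\<rangle>\<close> is minus the real part of \<open>\<langle>A (\<i> x), y\<rangle>\<close>.\<close>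

lemma adjoint_pairI_Re:
  assumes "inner_product_space H" "inner_product_space K"
    and "A \<in> bounded_ops H K" "B \<in> bounded_ops K H"
    and Re: "\<And>x y. \<lbrakk>x \<in> carrier H; y \<in> carrier K\<rbrakk>
      \<Longrightarrow> Re (hinner K (A x) y) = Re (hinner H x (B y))"
  shows "adjoint_pair H K A B"
  unfolding adjoint_pair_def
proof (intro conjI ballI)
  interpret A: bounded_op H K A by (intro bounded_opI assms)
  interpret B: bounded_op K H B by (intro bounded_opI assms)
  fix x y assume xy: "x \<in> carrier H" "y \<in> carrier K"
  show "hinner K (A x) y = hinner H x (B y)"
  proof (rule complex_eqI)
    show "Im (hinner K (A x) y) = Im (hinner H x (B y))"
      using Re[of "hscale H \<i> x" y] xy
      by (simp add: A.dom.closed A.scale A.closed B.closed A.cod.inner_scale_left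
          A.dom.inner_scale_left)
  qed (use Re xy in auto)
qed (use assms in auto)

lemma adjoint_pair_compose:
  assumes "inner_product_space H" "inner_product_space K" "inner_product_space L"
    and "adjoint_pair H K A A'" "adjoint_pair K L B B'"
  shows "adjoint_pair H L (compose (carrier H) B A) (compose (carrier L) A' B')"
  unfolding adjoint_pair_def
proof (intro conjI ballI)
  interpret A: bounded_op H K A
    using assms by (intro bounded_opI) (auto simp: adjoint_pair_def)
  interpret B': bounded_op L K B'
    using assms by (intro bounded_opI) (auto simp: adjoint_pair_def)
  fix x y assume "x \<in> carrier H" "y \<in> carrier L"
  then show "hinner L (compose (carrier H) B A x) y = hinner H x (compose (carrier L) A' B' y)"
    using assms(4,5) A.closed B'.closed by (simp add: adjoint_pair_def compose_eq)
qed (use assms in \<open>auto simp: adjoint_pair_def intro: bounded_ops_compose\<close>)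

lemma unitary_opI:
  assumes "inner_product_space H" "adjoint_pair H H U V"
    and "\<And>x. x \<in> carrier H \<Longrightarrow> V (U x) = x" "\<And>x. x \<in> carrier H \<Longrightarrow> U (V x) = x"
  shows "unitary_op H U"
  using assms adj_op_eq[of H H U V]
  by (auto simp: unitary_op_def adjoint_pair_def compose_def id_op_def fun_eq_iff)

section \<open>Riesz representation and square roots of positive operators\<close>

context inner_product_space
begin

lemma hlim_unique:
  assumes "\<And>n::nat. x n \<in> carrier H" "a \<in> carrier H" "b \<in> carrier H"
    and a: "(\<lambda>n. hnorm H (x n - a)) \<longlonglongrightarrow> 0" and b: "(\<lambda>n. hnorm H (x n - b)) \<longlonglongrightarrow> 0"
  shows "a = b"
proof -
  have "hnorm H (a - b) \<le> 0"
  proof (rule LIMSEQ_le_const)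
    show "(\<lambda>n. hnorm H (x n - a) + hnorm H (x n - b)) \<longlonglongrightarrow> 0"
      using tendsto_add[OF a b] by simp
    show "\<exists>N. \<forall>n\<ge>N. hnorm H (a - b) \<le> hnorm H (x n - a) + hnorm H (x n - b)"
      using assms by (metis hnorm_triangle_diff hnorm_minus_commute)
  qed
  then show ?thesis
    using assms hnorm_eq_0_iff[of "a - b"] hnorm_nonneg[of "a - b"] by (simp add: closed)
qed

lemma hlim_cong_bound:
  assumes "(\<lambda>n::nat. r n) \<longlonglongrightarrow> 0" "\<And>n. y n \<in> carrier H" "\<And>n. hnorm H (y n) \<le> r n"
  shows "(\<lambda>n. hnorm H (y n)) \<longlonglongrightarrow> 0"
  by (rule tendsto_sandwich[OF _ _ tendsto_const assms(1)]) (auto simp: assms hnorm_nonneg)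

lemma hlim_add:
  assumes "\<And>n::nat. x n \<in> carrier H" "\<And>n. y n \<in> carrier H" "a \<in> carrier H" "b \<in> carrier H"
    and a: "(\<lambda>n. hnorm H (x n - a)) \<longlonglongrightarrow> 0" and b: "(\<lambda>n. hnorm H (y n - b)) \<longlonglongrightarrow> 0"
  shows "(\<lambda>n. hnorm H (x n + y n - (a + b))) \<longlonglongrightarrow> 0"
proof (rule hlim_cong_bound)
  show "(\<lambda>n. hnorm H (x n - a) + hnorm H (y n - b)) \<longlonglongrightarrow> 0"
    using tendsto_add[OF a b] by simp
  show "hnorm H (x n + y n - (a + b)) \<le> hnorm H (x n - a) + hnorm H (y n - b)" for n
    using hnorm_triangle[of "x n - a" "y n - b"] assms by (simp add: closed algebra_simps)
qed (use assms in \<open>simp add: closed\<close>)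

lemma hlim_scale:
  assumes "\<And>n::nat. x n \<in> carrier H" "a \<in> carrier H" and a: "(\<lambda>n. hnorm H (x n - a)) \<longlonglongrightarrow> 0"
  shows "(\<lambda>n. hnorm H (hscale H c (x n) - hscale H c a)) \<longlonglongrightarrow> 0"
  using tendsto_mult_left[OF a, of "cmod c"] assms
  by (simp add: hnorm_scale closed flip: scale_diff_right)

lemma hlim_inner:
  assumes "\<And>n::nat. x n \<in> carrier H" "a \<in> carrier H" "y \<in> carrier H"
    and a: "(\<lambda>n. hnorm H (x n - a)) \<longlonglongrightarrow> 0"
  shows "(\<lambda>n. Re (hinner H (x n) y)) \<longlonglongrightarrow> Re (hinner H a y)"
proof -
  have "(\<lambda>n. hnorm H (x n - a) * hnorm H y) \<longlonglongrightarrow> 0"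
    using tendsto_mult_right[OF a, of "hnorm H y"] by simp
  then have "(\<lambda>n. Re (hinner H (x n) y) - Re (hinner H a y)) \<longlonglongrightarrow> 0"
  proof (rule Lim_null_comparison[rotated])
    show "\<forall>\<^sub>F n in sequentially. norm (Re (hinner H (x n) y) - Re (hinner H a y))
        \<le> hnorm H (x n - a) * hnorm H y"
      using abs_Re_inner_le[of "x n - a" y for n] assms
      by (intro always_eventually allI) (simp add: closed inner_diff_left)
  qed
  then show ?thesis
    by (simp add: LIM_zero_iff)
qed

lemma hlim_norm:
  assumes "\<And>n::nat. x n \<in> carrier H" "a \<in> carrier H" and a: "(\<lambda>n. hnorm H (x n - a)) \<longlonglongrightarrow> 0"
  shows "(\<lambda>n. hnorm H (x n)) \<longlonglongrightarrow> hnorm H a"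
proof -
  have "(\<lambda>n. hnorm H (x n) - hnorm H a) \<longlonglongrightarrow> 0"
  proof (rule Lim_null_comparison[OF _ a], intro always_eventually allI)
    fix n
    show "norm (hnorm H (x n) - hnorm H a) \<le> hnorm H (x n - a)"
      using hnorm_triangle[of "x n - a" a] hnorm_triangle[of "a - x n" "x n"] assms
      by (simp add: closed hnorm_minus_commute[of "x n" a])
  qed
  then show ?thesis
    by (simp add: LIM_zero_iff)
qed

end

lemma nonneg_quadratic_linear_term:
  fixes a b :: real
  assumes "0 \<le> a" and *: "\<And>t. 0 \<le> t\<^sup>2 * a + 2 * t * b"
  shows "b = 0"
proof -
  define t where "t = - b / (a + 1)"
  have b: "b = - t * (a + 1)"
    using \<open>0 \<le> a\<close> by (simp add: t_def)
  have "0 \<le> - (t\<^sup>2 * (a + 2))"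
    using *[of t] unfolding b by (simp add: power2_eq_square algebra_simps)
  then have "t = 0"
    using \<open>0 \<le> a\<close> by (simp add: mult_le_0_iff)
  then show ?thesis
    by (simp add: b)
qed

text \<open>
  The representing vector minimises \<open>\<parallel>x\<parallel>\<^sup>2 - 2 f x\<close>; a minimising sequence is Cauchy by the
  parallelogram law.
\<close>

theorem (in hilbert_space) riesz_representation_Re:
  fixes f :: "'a \<Rightarrow> real"
  assumes f_add: "\<And>x y. \<lbrakk>x \<in> carrier H; y \<in> carrier H\<rbrakk> \<Longrightarrow> f (x + y) = f x + f y"
    and f_scale: "\<And>c x. x \<in> carrier H \<Longrightarrow> f (hscale H (complex_of_real c) x) = c * f x"
    and f_bound: "\<And>x. x \<in> carrier H \<Longrightarrow> \<bar>f x\<bar> \<le> M * hnorm H x"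
  obtains g where "g \<in> carrier H" "\<And>x. x \<in> carrier H \<Longrightarrow> Re (hinner H g x) = f x"
proof -
  define J where "J x = (hnorm H x)\<^sup>2 - 2 * f x" for x
  have J_ge: "- M\<^sup>2 \<le> J x" if "x \<in> carrier H" for x
    using f_bound[OF that] zero_le_power2[of "hnorm H x - M"]
    by (simp add: J_def power2_diff mult.commute)
  define \<mu> where "\<mu> = Inf (J ` carrier H)"
  have bdd: "bdd_below (J ` carrier H)"
    using J_ge by (intro bdd_belowI[of _ "- M\<^sup>2"]) auto
  have \<mu>_le: "\<mu> \<le> J x" if "x \<in> carrier H" for x
    unfolding \<mu>_def using bdd that by (intro cInf_lower) auto
  have "\<exists>x\<in>carrier H. J x < \<mu> + inverse (real (Suc n))" for n
    using cInf_lessD[of "J ` carrier H" "\<mu> + inverse (real (Suc n))"] zero_closed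
    by (auto simp: \<mu>_def)
  then obtain x where x: "\<And>n. x n \<in> carrier H" and Jx: "\<And>n. J (x n) < \<mu> + inverse (real (Suc n))"
    by metis
  have parallelogram: "(hnorm H (u - v))\<^sup>2 \<le> 2 * (J u - \<mu>) + 2 * (J v - \<mu>)"
    if uv: "u \<in> carrier H" "v \<in> carrier H" for u v
  proof -
    define w where "w = hscale H (complex_of_real (1/2)) (u + v)"
    have w: "w \<in> carrier H"
      using uv by (simp add: w_def closed)
    have "f w = (1/2) * (f u + f v)"
      using uv by (simp only: w_def f_scale f_add closed)
    moreover have "(hnorm H w)\<^sup>2 = (1/4) * (hnorm H (u + v))\<^sup>2"
      using uv by (simp add: w_def hnorm_scale closed power_mult_distrib power2_eq_square norm_divide)
    ultimately have "(hnorm H (u - v))\<^sup>2 + 4 * J w = 2 * J u + 2 * J v"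
      using uv by (simp add: J_def hnorm_diff_square hnorm_add_square)
    then show ?thesis
      using \<mu>_le[OF w] by simp
  qed
  have "\<exists>N. \<forall>m\<ge>N. \<forall>n\<ge>N. hnorm H (x m - x n) < e" if "0 < e" for e
  proof -
    obtain N where N: "inverse (real (Suc N)) < e\<^sup>2 / 4"
      using reals_Archimedean[of "e\<^sup>2 / 4"] \<open>0 < e\<close> by (auto simp del: of_nat_Suc)
    have small: "J (x n) - \<mu> < e\<^sup>2 / 4" if "N \<le> n" for n
    proof -
      have "inverse (real (Suc n)) \<le> inverse (real (Suc N))"
        using that by (intro le_imp_inverse_le) auto
      then show ?thesis
        using Jx[of n] N by linarith
    qed
    have "hnorm H (x m - x n) < e" if "N \<le> m" "N \<le> n" for m n
      using parallelogram[OF x x, of m n] small[OF that(1)] small[OF that(2)] \<open>0 < e\<close>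
      by (intro power2_less_imp_less[of _ e]) auto
    then show ?thesis
      by blast
  qed
  then obtain g where g: "g \<in> carrier H" "(\<lambda>n. hnorm H (x n - g)) \<longlonglongrightarrow> 0"
    using Cauchy_has_limit[of x] x by blast
  have f_diff: "f (u - v) = f u - f v" if "u \<in> carrier H" "v \<in> carrier H" for u v
    using f_add[of "u - v" v] that by (simp add: closed)
  have "(\<lambda>n. f (x n) - f g) \<longlonglongrightarrow> 0"
  proof (rule Lim_null_comparison)
    show "\<forall>\<^sub>F n in sequentially. norm (f (x n) - f g) \<le> M * hnorm H (x n - g)"
      using f_bound[of "x n - g" for n] x g(1)
      by (intro always_eventually allI) (simp add: closed f_diff)
    show "(\<lambda>n. M * hnorm H (x n - g)) \<longlonglongrightarrow> 0"
      using tendsto_mult_left[OF g(2), of M] by simp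
  qed
  then have "(\<lambda>n. f (x n)) \<longlonglongrightarrow> f g"
    by (simp add: LIM_zero_iff)
  then have "(\<lambda>n. J (x n)) \<longlonglongrightarrow> J g"
    unfolding J_def using hlim_norm[OF x g] by (intro tendsto_intros)
  then have "J g \<le> \<mu> + 0"
    by (rule LIMSEQ_le[OF _ tendsto_add[OF tendsto_const LIMSEQ_inverse_real_of_nat]])
      (use Jx less_imp_le in blast)
  have "Re (hinner H g y) - f y = 0" if y: "y \<in> carrier H" for y
  proof (rule nonneg_quadratic_linear_term[of "(hnorm H y)\<^sup>2"])
    fix t :: real
    have "J (g + hscale H (complex_of_real t) y)
        = J g + t\<^sup>2 * (hnorm H y)\<^sup>2 + 2 * t * (Re (hinner H g y) - f y)"
      using g(1) y by (simp add: J_def hnorm_add_square closed hnorm_scale f_add f_scale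
          inner_scale_right power_mult_distrib algebra_simps)
    then show "0 \<le> t\<^sup>2 * (hnorm H y)\<^sup>2 + 2 * t * (Re (hinner H g y) - f y)"
      using \<open>J g \<le> \<mu> + 0\<close> \<mu>_le[of "g + hscale H (complex_of_real t) y"] g(1) y
      by (simp add: closed)
  qed simp
  then show ?thesis
    using that[OF g(1)] by simp
qed

text \<open>
  After scaling, \<open>0 \<le> G \<le> 1\<close> and \<open>T = 1 - G\<close> is a contraction.  The iteration
  \<open>Y\<^sub>0 = 0\<close>, \<open>Y\<^sub>n\<^sub>+\<^sub>1 = (T + Y\<^sub>n\<^sup>2) / 2\<close> is dominated in norm, differences included, by the same
  iteration \<open>y\<^sub>n\<close> for the number \<open>1\<close> in place of \<open>T\<close>, which increases and is bounded.  The limit \<open>Z\<close>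
  satisfies \<open>2 Z = T + Z\<^sup>2\<close>, that is \<open>(1 - Z)\<^sup>2 = 1 - T = G\<close>.
\<close>

theorem (in hilbert_space) positive_op_square_root:
  assumes G: "G \<in> bounded_ops H H"
    and G_sym: "\<And>x y. \<lbrakk>x \<in> carrier H; y \<in> carrier H\<rbrakk> \<Longrightarrow> Re (hinner H (G x) y) = Re (hinner H x (G y))"
    and G_pos: "\<And>x. x \<in> carrier H \<Longrightarrow> 0 \<le> Re (hinner H (G x) x)"
  obtains R where "adjoint_pair H H R R" "\<And>x. x \<in> carrier H \<Longrightarrow> R (R x) = G x"
proof -
  interpret G: bounded_op H H G
    using G by unfold_locales
  obtain M where M: "0 \<le> M" "\<And>x. x \<in> carrier H \<Longrightarrow> hnorm H (G x) \<le> M * hnorm H x"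
    using G.bound by blast
  define c where "c = M + 1"
  have c: "0 < c"
    using M(1) by (simp add: c_def)
  have Gc: "hnorm H (G x) \<le> c * hnorm H x" if "x \<in> carrier H" for x
    using M(2)[OF that] hnorm_nonneg[OF that] by (simp add: c_def algebra_simps)
  \<comment> \<open>positivity of \<open>G\<close> at \<open>c x - G x\<close> gives \<open>G\<^sup>2 \<le> c G\<close>\<close>
  have G_square: "(hnorm H (G x))\<^sup>2 \<le> c * Re (hinner H (G x) x)" if x: "x \<in> carrier H" for x
  proof -
    have "Re (hinner H (G (G x)) (G x)) \<le> hnorm H (G (G x)) * hnorm H (G x)"
      using x by (intro Cauchy_Schwarz_Re G.closed)
    also have "\<dots> \<le> (c * hnorm H (G x)) * hnorm H (G x)"
      using x by (intro mult_right_mono Gc G.closed hnorm_nonneg)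
    finally have 1: "Re (hinner H (G (G x)) (G x)) \<le> c * (hnorm H (G x))\<^sup>2"
      by (simp add: power2_eq_square mult.assoc)
    have "Re (hinner H (G (G x)) x) = (hnorm H (G x))\<^sup>2"
      using x G_sym[of "G x" x] by (simp add: G.closed Re_inner_self)
    then have "Re (hinner H (G (hscale H c x - G x)) (hscale H c x - G x))
        = c\<^sup>2 * Re (hinner H (G x) x) - 2 * c * (hnorm H (G x))\<^sup>2 + Re (hinner H (G (G x)) (G x))"
      using x by (simp add: G.diff G.scale G.closed closed inner_simps Re_inner_self
          power2_eq_square algebra_simps)
    then have "0 \<le> c\<^sup>2 * Re (hinner H (G x) x) - 2 * c * (hnorm H (G x))\<^sup>2 + c * (hnorm H (G x))\<^sup>2"
      using G_pos[of "hscale H c x - G x"] 1 x by (simp add: closed G.closed)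
    then have "c * (hnorm H (G x))\<^sup>2 \<le> c * (c * Re (hinner H (G x) x))"
      by (simp add: power2_eq_square algebra_simps)
    then show ?thesis
      using c by simp
  qed
  define T where "T x = x - hscale H (complex_of_real (1 / c)) (G x)" for x
  have T_closed: "T x \<in> carrier H" if "x \<in> carrier H" for x
    using that by (simp add: T_def closed G.closed)
  have T_add: "T (x + y) = T x + T y" if "x \<in> carrier H" "y \<in> carrier H" for x y
    using that by (simp add: T_def G.add scale_add_right G.closed)
  have T_scale: "T (hscale H a x) = hscale H a (T x)" if "x \<in> carrier H" for a x
    using that by (simp add: T_def G.scale scale_scale scale_diff_right closed G.closed mult.commute)
  have T_sym: "Re (hinner H (T x) y) = Re (hinner H x (T y))"
    if "x \<in> carrier H" "y \<in> carrier H" for x y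
    using that G_sym[OF that] by (simp add: T_def inner_simps closed G.closed)
  have T_norm: "hnorm H (T x) \<le> hnorm H x" if x: "x \<in> carrier H" for x
  proof (rule power2_le_imp_le)
    have "(hnorm H (T x))\<^sup>2 = (hnorm H x)\<^sup>2 - 2 / c * Re (hinner H (G x) x) + (hnorm H (G x))\<^sup>2 / c\<^sup>2"
      using x c Re_inner_commute[of x "G x"] unfolding T_def
      by (simp add: hnorm_diff_square closed G.closed inner_scale_right hnorm_scale
          power_mult_distrib power_divide norm_divide)
    also have "\<dots> \<le> (hnorm H x)\<^sup>2 - 2 / c * Re (hinner H (G x) x) + Re (hinner H (G x) x) / c"
      using G_square[OF x] c by (simp add: field_simps power2_eq_square)
    also have "\<dots> \<le> (hnorm H x)\<^sup>2"
      using G_pos[OF x] c by simp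
    finally show "(hnorm H (T x))\<^sup>2 \<le> (hnorm H x)\<^sup>2" .
  qed (use x in \<open>simp add: hnorm_nonneg\<close>)
  define h where "h = complex_of_real (1 / 2)"
  define Y where "Y = rec_nat (\<lambda>x. 0) (\<lambda>n Z x. hscale H h (T x + Z (Z x)))"
  have Y_0: "Y 0 x = 0" and Y_Suc: "Y (Suc n) x = hscale H h (T x + Y n (Y n x))" for n x
    by (simp_all add: Y_def)
  define y where "y = rec_nat (0::real) (\<lambda>n z. (1 + z\<^sup>2) / 2)"
  have y_0: "y 0 = 0" and y_Suc: "y (Suc n) = (1 + (y n)\<^sup>2) / 2" for n
    by (simp_all add: y_def)
  have y_01: "0 \<le> y n \<and> y n \<le> 1" for n
    by (induction n) (auto simp: y_0 y_Suc power_le_one)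
  have y_mono: "y n \<le> y (Suc n)" for n
    using zero_le_power2[of "y n - 1"] by (simp add: y_Suc power2_eq_square algebra_simps)
  have Y_closed: "Y n x \<in> carrier H" if "x \<in> carrier H" for n x
    using that by (induction n arbitrary: x) (auto simp: Y_0 Y_Suc closed T_closed)
  have Y_add: "Y n (x + z) = Y n x + Y n z" if "x \<in> carrier H" "z \<in> carrier H" for n x z
    using that by (induction n arbitrary: x z)
      (auto simp: Y_0 Y_Suc closed T_closed Y_closed T_add scale_add_right algebra_simps)
  have Y_diff: "Y n (x - z) = Y n x - Y n z" if "x \<in> carrier H" "z \<in> carrier H" for n x z
    using Y_add[of "x - z" z n] that by (simp add: closed)
  have Y_scale: "Y n (hscale H a x) = hscale H a (Y n x)" if "x \<in> carrier H" for n a x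
    using that by (induction n arbitrary: x)
      (auto simp: Y_0 Y_Suc closed T_closed Y_closed T_scale scale_add_right scale_zero_right
        scale_scale mult.commute)
  have Y_sym: "Re (hinner H (Y n x) z) = Re (hinner H x (Y n z))"
    if "x \<in> carrier H" "z \<in> carrier H" for n x z
    using that by (induction n arbitrary: x z)
      (auto simp: Y_0 Y_Suc h_def closed T_closed Y_closed T_sym inner_simps)
  have Y_norm: "hnorm H (Y n x) \<le> y n * hnorm H x" if "x \<in> carrier H" for n x
    using that
  proof (induction n arbitrary: x)
    case (Suc n)
    have "hnorm H (T x + Y n (Y n x)) \<le> hnorm H (T x) + hnorm H (Y n (Y n x))"
      using Suc.prems by (intro hnorm_triangle T_closed Y_closed)
    also have "hnorm H (Y n (Y n x)) \<le> y n * hnorm H (Y n x)"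
      using Suc.prems by (intro Suc.IH Y_closed)
    also have "y n * hnorm H (Y n x) \<le> y n * (y n * hnorm H x)"
      using Suc y_01 by (intro mult_left_mono) auto
    also have "hnorm H (T x) \<le> hnorm H x"
      by (rule T_norm) fact
    finally show ?case
      using Suc.prems by (simp add: Y_Suc y_Suc h_def hnorm_scale closed T_closed Y_closed
          power2_eq_square norm_divide algebra_simps)
  qed (simp add: Y_0 y_0)
  have Y_step: "hnorm H (Y (Suc n) x - Y n x) \<le> (y (Suc n) - y n) * hnorm H x"
    if "x \<in> carrier H" for n x
    using that
  proof (induction n arbitrary: x)
    case 0
    then show ?case
      using T_norm[of x] by (simp add: Y_0 Y_Suc y_0 y_Suc h_def hnorm_scale T_closed norm_divide)
  next
    case (Suc n)
    define d where "d = Y (Suc n) x - Y n x"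
    have d: "d \<in> carrier H"
      using Suc.prems by (simp add: d_def closed Y_closed)
    have "Y (Suc (Suc n)) x - Y (Suc n) x
        = hscale H h (Y (Suc n) d + (Y (Suc n) (Y n x) - Y n (Y n x)))"
      using Suc.prems
      by (simp add: Y_Suc[of "Suc n" x] Y_Suc[of n x] closed T_closed Y_closed Y_diff d_def
          flip: scale_diff_right)
    then have "hnorm H (Y (Suc (Suc n)) x - Y (Suc n) x)
        = 1 / 2 * hnorm H (Y (Suc n) d + (Y (Suc n) (Y n x) - Y n (Y n x)))"
      using Suc.prems d by (simp add: hnorm_scale h_def closed Y_closed norm_divide)
    also have "\<dots> \<le> 1 / 2 * (hnorm H (Y (Suc n) d) + hnorm H (Y (Suc n) (Y n x) - Y n (Y n x)))"
      using Suc.prems d by (intro mult_left_mono hnorm_triangle closed Y_closed) auto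
    also have "\<dots> \<le> 1 / 2 * (y (Suc n) * ((y (Suc n) - y n) * hnorm H x)
        + (y (Suc n) - y n) * (y n * hnorm H x))"
    proof (intro mult_left_mono add_mono)
      show "hnorm H (Y (Suc n) d) \<le> y (Suc n) * ((y (Suc n) - y n) * hnorm H x)"
        using Y_norm[OF d, of "Suc n"] mult_left_mono[OF Suc.IH[OF Suc.prems], of "y (Suc n)"]
          y_01[of "Suc n"] by (simp add: d_def)
      show "hnorm H (Y (Suc n) (Y n x) - Y n (Y n x)) \<le> (y (Suc n) - y n) * (y n * hnorm H x)"
        using Suc.IH[OF Y_closed[OF Suc.prems, of n]]
          mult_left_mono[OF Y_norm[OF Suc.prems, of n], of "y (Suc n) - y n"] y_mono[of n] by simp
    qed auto
    also have "\<dots> = (y (Suc (Suc n)) - y (Suc n)) * hnorm H x"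
      by (simp add: y_Suc[of "Suc n"] y_Suc[of n] power2_eq_square field_simps)
    finally show ?case .
  qed
  have Y_dist: "hnorm H (Y (n + k) x - Y n x) \<le> (y (n + k) - y n) * hnorm H x"
    if x: "x \<in> carrier H" for n k x
  proof (induction k)
    case (Suc k)
    show ?case
      using hnorm_triangle_diff[of "Y (n + Suc k) x" "Y (n + k) x" "Y n x"] Suc.IH
        Y_step[OF x, of "n + k"] x by (simp add: Y_closed algebra_simps)
  qed (simp add: x)
  have "incseq y"
    using y_mono by (intro incseq_SucI)
  then have "convergent y"
    using y_01 by (intro Bseq_mono_convergent BseqI'[of y 1]) (auto simp: incseq_def)
  then have "Cauchy y"
    by (rule convergent_Cauchy)
  have "\<exists>N. \<forall>m\<ge>N. \<forall>n\<ge>N. hnorm H (Y m x - Y n x) < e" if x: "x \<in> carrier H" and "0 < e" for x e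
  proof -
    have pos: "0 < hnorm H x + 1"
      using hnorm_nonneg[OF x] by simp
    then obtain N where N: "\<And>m n. \<lbrakk>N \<le> m; N \<le> n\<rbrakk> \<Longrightarrow> \<bar>y m - y n\<bar> < e / (hnorm H x + 1)"
      using \<open>Cauchy y\<close> \<open>0 < e\<close> unfolding Cauchy_def dist_real_def
      by (metis divide_pos_pos)
    have le: "hnorm H (Y m x - Y n x) < e" if "N \<le> n" "n \<le> m" for m n
    proof -
      have "hnorm H (Y m x - Y n x) \<le> (y m - y n) * hnorm H x"
        using Y_dist[OF x, of n "m - n"] that by simp
      also have "\<dots> \<le> \<bar>y m - y n\<bar> * (hnorm H x + 1)"
        using hnorm_nonneg[OF x] by (intro mult_mono) auto
      also have "\<dots> < e"
        using N[of m n] that pos by (simp add: field_simps)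
      finally show ?thesis .
    qed
    have "hnorm H (Y m x - Y n x) < e" if "N \<le> n" "N \<le> m" for m n
      using le[of n m] le[of m n] that x hnorm_minus_commute[of "Y m x" "Y n x"]
      by (cases "n \<le> m") (auto simp: Y_closed)
    then show ?thesis
      by blast
  qed
  then have "\<exists>l\<in>carrier H. (\<lambda>n. hnorm H (Y n x - l)) \<longlonglongrightarrow> 0" if "x \<in> carrier H" for x
    using Cauchy_has_limit[of "\<lambda>n. Y n x"] that Y_closed by metis
  then obtain Z where Z_closed: "\<And>x. x \<in> carrier H \<Longrightarrow> Z x \<in> carrier H"
    and Z_lim: "\<And>x. x \<in> carrier H \<Longrightarrow> (\<lambda>n. hnorm H (Y n x - Z x)) \<longlonglongrightarrow> 0"
    by metis
  have Z_add: "Z (x + z) = Z x + Z z" if "x \<in> carrier H" "z \<in> carrier H" for x z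
    using that hlim_add[of "\<lambda>n. Y n x" "\<lambda>n. Y n z" "Z x" "Z z"] Z_lim[of "x + z"]
    by (intro hlim_unique[of "\<lambda>n. Y n (x + z)"])
      (auto simp: Y_closed Z_closed Z_lim closed Y_add)
  have Z_scale: "Z (hscale H a x) = hscale H a (Z x)" if "x \<in> carrier H" for a x
    using that hlim_scale[of "\<lambda>n. Y n x" "Z x" a] Z_lim[of "hscale H a x"]
    by (intro hlim_unique[of "\<lambda>n. Y n (hscale H a x)"])
      (auto simp: Y_closed Z_closed Z_lim closed Y_scale)
  have Z_diff: "Z (x - z) = Z x - Z z" if "x \<in> carrier H" "z \<in> carrier H" for x z
    using Z_add[of "x - z" z] that by (simp add: closed)
  have Z_norm: "hnorm H (Z x) \<le> 1 * hnorm H x" if x: "x \<in> carrier H" for x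
  proof (rule LIMSEQ_le_const2)
    show "(\<lambda>n. hnorm H (Y n x)) \<longlonglongrightarrow> hnorm H (Z x)"
      using x by (intro hlim_norm Y_closed Z_closed Z_lim)
    show "\<exists>N. \<forall>n\<ge>N. hnorm H (Y n x) \<le> 1 * hnorm H x"
      using Y_norm[OF x] mult_right_mono[of "y n" 1 "hnorm H x" for n] y_01 hnorm_nonneg[OF x]
        order_trans by blast
  qed
  have Z_sym: "Re (hinner H (Z x) z) = Re (hinner H x (Z z))"
    if xz: "x \<in> carrier H" "z \<in> carrier H" for x z
  proof (rule LIMSEQ_unique)
    show "(\<lambda>n. Re (hinner H (Y n x) z)) \<longlonglongrightarrow> Re (hinner H (Z x) z)"
      using xz by (intro hlim_inner Y_closed Z_closed Z_lim)
    have "(\<lambda>n. Re (hinner H (Y n z) x)) \<longlonglongrightarrow> Re (hinner H (Z z) x)"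
      using xz by (intro hlim_inner Y_closed Z_closed Z_lim)
    then show "(\<lambda>n. Re (hinner H (Y n x) z)) \<longlonglongrightarrow> Re (hinner H x (Z z))"
      using xz by (simp add: Re_inner_commute[of _ x] Y_closed Z_closed Y_sym)
  qed
  have Z_square: "(\<lambda>n. hnorm H (Y n (Y n x) - Z (Z x))) \<longlonglongrightarrow> 0" if x: "x \<in> carrier H" for x
  proof (rule hlim_cong_bound)
    show "(\<lambda>n. hnorm H (Y n x - Z x) + hnorm H (Y n (Z x) - Z (Z x))) \<longlonglongrightarrow> 0"
      using tendsto_add[OF Z_lim[OF x] Z_lim[OF Z_closed[OF x]]] by simp
    fix n
    have "hnorm H (Y n (Y n x) - Y n (Z x)) \<le> y n * hnorm H (Y n x - Z x)"
      using Y_norm[of "Y n x - Z x" n] x by (simp add: Y_diff closed Y_closed Z_closed)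
    also have "\<dots> \<le> 1 * hnorm H (Y n x - Z x)"
      using y_01 x by (intro mult_right_mono) (auto simp: hnorm_nonneg closed Y_closed Z_closed)
    finally show "hnorm H (Y n (Y n x) - Z (Z x))
        \<le> hnorm H (Y n x - Z x) + hnorm H (Y n (Z x) - Z (Z x))"
      using hnorm_triangle_diff[of "Y n (Y n x)" "Y n (Z x)" "Z (Z x)"] x
      by (simp add: Y_closed Z_closed)
  qed (use x in \<open>simp add: closed Y_closed Z_closed\<close>)
  have Z_eq: "Z x + Z x = T x + Z (Z x)" if x: "x \<in> carrier H" for x
  proof -
    have "Z x = hscale H h (T x + Z (Z x))"
    proof (rule hlim_unique[of "\<lambda>n. Y (Suc n) x"])
      show "(\<lambda>n. hnorm H (Y (Suc n) x - Z x)) \<longlonglongrightarrow> 0"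
        by (rule LIMSEQ_Suc[OF Z_lim[OF x]])
      have "(\<lambda>n. hnorm H (T x + Y n (Y n x) - (T x + Z (Z x)))) \<longlonglongrightarrow> 0"
        using Z_square[OF x] by simp
      then show "(\<lambda>n. hnorm H (Y (Suc n) x - hscale H h (T x + Z (Z x)))) \<longlonglongrightarrow> 0"
        unfolding Y_Suc using x by (intro hlim_scale) (auto simp: closed T_closed Y_closed Z_closed)
    qed (use x in \<open>auto simp: closed T_closed Y_closed Z_closed\<close>)
    then have "hscale H (h + h) (T x + Z (Z x)) = Z x + Z x"
      using x scale_add_left[of "T x + Z (Z x)" h h] by (simp add: closed T_closed Z_closed)
    moreover have "h + h = 1"
      by (simp add: h_def)
    ultimately show ?thesis
      using x by (simp add: scale_one closed T_closed Z_closed)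
  qed
  define r where "r = complex_of_real (sqrt c)"
  define R where "R = restrict (\<lambda>x. hscale H r (x - Z x)) (carrier H)"
  have R: "R \<in> bounded_ops H H"
    unfolding R_def
  proof (rule bounded_opsI)
    fix x assume x: "x \<in> carrier H"
    have "hnorm H (x - Z x) \<le> hnorm H x + hnorm H (Z x)"
      using hnorm_triangle[of x "- Z x"] x by (simp add: closed Z_closed hnorm_minus)
    then show "hnorm H (hscale H r (x - Z x)) \<le> (cmod r * 2) * hnorm H x"
      using x Z_norm[OF x] by (simp add: hnorm_scale closed Z_closed mult_left_mono mult.assoc)
  qed (auto simp: closed Z_closed Z_add Z_scale scale_add_right scale_diff_right scale_scale
      mult.commute algebra_simps inner_product_space_axioms)
  show ?thesis
  proof (rule that[of R])
    show "adjoint_pair H H R R"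
    proof (rule adjoint_pairI_Re)
      fix x z assume "x \<in> carrier H" "z \<in> carrier H"
      then show "Re (hinner H (R x) z) = Re (hinner H x (R z))"
        by (simp add: R_def r_def inner_simps closed Z_closed Z_sym)
    qed (use R inner_product_space_axioms in auto)
    fix x assume x: "x \<in> carrier H"
    have "R (R x) = hscale H (r * r) (x - Z x - Z (x - Z x))"
      using x by (simp add: R_def closed Z_closed Z_scale scale_scale flip: scale_diff_right)
    also have "x - Z x - Z (x - Z x) = x - (Z x + Z x) + Z (Z x)"
      using x by (simp add: Z_diff Z_closed algebra_simps)
    also have "\<dots> = hscale H (complex_of_real (1 / c)) (G x)"
      unfolding Z_eq[OF x] by (simp add: T_def)
    also have "r * r = complex_of_real c"
      using c by (simp add: r_def flip: of_real_mult)
    finally show "R (R x) = G x"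
      using x c by (simp add: scale_scale G.closed scale_one)
  qed
qed

section \<open>Extending isometries to unitaries\<close>

definition unitary_pair :: "'a::ab_group_add hspace \<Rightarrow> ('a \<Rightarrow> 'a) \<Rightarrow> ('a \<Rightarrow> 'a) \<Rightarrow> bool" where
  "unitary_pair H U V \<longleftrightarrow> adjoint_pair H H U V \<and> (\<forall>x\<in>carrier H. V (U x) = x \<and> U (V x) = x)"

context inner_product_space
begin

lemma unitary_pair_id: "unitary_pair H (id_op H) (id_op H)"
  using id_op_bounded[OF inner_product_space_axioms]
  by (simp add: unitary_pair_def adjoint_pair_def) (simp add: id_op_def)

lemma unitary_pair_closed:
  assumes "unitary_pair H U V" "x \<in> carrier H"
  shows "U x \<in> carrier H" "V x \<in> carrier H"
  using assms unfolding unitary_pair_def adjoint_pair_def bounded_ops_def by blast+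

lemma unitary_pair_compose:
  assumes "unitary_pair H U V" "unitary_pair H U' V'"
  shows "unitary_pair H (compose (carrier H) U' U) (compose (carrier H) V V')"
  using assms adjoint_pair_compose[OF inner_product_space_axioms inner_product_space_axioms
      inner_product_space_axioms, of U V U' V']
    unitary_pair_closed[OF assms(1)] unitary_pair_closed[OF assms(2)]
  by (simp add: unitary_pair_def compose_eq)

lemma unitary_pair_inner:
  assumes UV: "unitary_pair H U V" and "x \<in> carrier H" "y \<in> carrier H"
  shows "hinner H (U x) (U y) = hinner H x y"
proof -
  have "hinner H (U x) (U y) = hinner H x (V (U y))"
    using assms unitary_pair_closed[OF UV] by (simp add: unitary_pair_def adjoint_pair_def)
  then show ?thesis
    using assms by (simp add: unitary_pair_def)
qed

text \<open>
  With \<open>u = d - r\<close>, the operator \<open>x \<mapsto> x - \<langle>x, u\<rangle> / \<langle>d, u\<rangle> u\<close> sends \<open>d\<close> to \<open>r\<close>.  It is a complex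
  reflection, because \<open>\<parallel>d\<parallel> = \<parallel>r\<parallel>\<close> gives \<open>2 Re \<langle>d, u\<rangle> = \<parallel>u\<parallel>\<^sup>2\<close>.
\<close>

lemma unitary_reflection:
  assumes d: "d \<in> carrier H" and r: "r \<in> carrier H" and dr: "hinner H d d = hinner H r r"
  obtains U V where "unitary_pair H U V" "U d = r"
    "\<And>x. \<lbrakk>x \<in> carrier H; hinner H x d = hinner H x r\<rbrakk> \<Longrightarrow> U x = x"
proof -
  define u where "u = d - r"
  have u: "u \<in> carrier H"
    using d r by (simp add: u_def closed)
  define a where "a = hinner H d u"
  \<comment> \<open>if \<open>d = r\<close>, this is \<open>inverse 0 = 0\<close> and the reflection below is the identity\<close>
  define b where "b = inverse a"
  define W where "W b x = x - hscale H (b * hinner H x u) u" for b x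
  have uu: "hinner H u u = a + cnj a"
    using d r dr inner_commute[OF d r]
    by (simp add: a_def u_def inner_simps closed) (rule inner_commute[OF r r])
  have b: "b + cnj b = b * cnj b * hinner H u u"
    unfolding uu b_def by (cases "a = 0") (simp_all add: field_simps)
  have W_closed: "W b x \<in> carrier H" if "x \<in> carrier H" for b x
    using that u by (simp add: W_def closed)
  have W_add: "W b (x + y) = W b x + W b y" if "x \<in> carrier H" "y \<in> carrier H" for b x y
    using that u by (simp add: W_def inner_add_left scale_add_left distrib_left)
  have W_scale: "W b (hscale H c x) = hscale H c (W b x)" if "x \<in> carrier H" for b c x
    using that u by (simp add: W_def inner_scale_left scale_diff_right scale_scale closed mult.left_commute)
  have W_adj: "hinner H (W b x) y = hinner H x (W (cnj b) y)"
    if "x \<in> carrier H" "y \<in> carrier H" for b x y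
    using that u by (simp add: W_def inner_simps closed flip: inner_commute[of y u])
  have W_inv: "W b' (W b x) = x" if "b + b' = b * b' * hinner H u u" "x \<in> carrier H" for b b' x
  proof -
    have "W b' (W b x) = x - (hscale H (b * hinner H x u) u
        + hscale H (b' * hinner H x u - b' * b * hinner H x u * hinner H u u) u)"
      using that(2) u by (simp add: W_def inner_simps closed algebra_simps)
    also have "hscale H (b * hinner H x u) u
        + hscale H (b' * hinner H x u - b' * b * hinner H x u * hinner H u u) u
        = hscale H ((b + b' - b * b' * hinner H u u) * hinner H x u) u"
      using u by (simp flip: scale_add_left add: algebra_simps)
    finally show ?thesis
      using that u by (simp add: scale_zero)
  qed
  have W_bounded: "restrict (W b) (carrier H) \<in> bounded_ops H H" if "b + cnj b = b * cnj b * hinner H u u" for b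
  proof (rule bounded_opsI[where M = 1])
    fix x assume x: "x \<in> carrier H"
    have "hinner H (W b x) (W b x) = hinner H x x"
      using that x W_inv[of b "cnj b" x] by (simp add: W_adj W_closed)
    then show "hnorm H (W b x) \<le> 1 * hnorm H x"
      by (simp add: hnorm_def)
  qed (auto simp: W_closed W_add W_scale inner_product_space_axioms)
  have b': "cnj b + cnj (cnj b) = cnj b * cnj (cnj b) * hinner H u u"
    using b by (simp add: algebra_simps)
  have W_d: "W b d = r"
  proof (cases "a = 0")
    case True
    then have "u = 0"
      using uu u inner_definite by simp
    then show ?thesis
      by (simp add: W_def u_def scale_zero_right)
  next
    case False
    then show ?thesis
      using u by (simp add: W_def b_def flip: a_def) (simp add: scale_one u_def)
  qed
  show ?thesis
  proof (rule that)
    show "unitary_pair H (restrict (W b) (carrier H)) (restrict (W (cnj b)) (carrier H))"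
      unfolding unitary_pair_def adjoint_pair_def
      using W_bounded[OF b] W_bounded[OF b'] W_inv[OF b] W_inv[of "cnj b" b] b'
      by (simp add: W_adj W_closed)
    show "restrict (W b) (carrier H) d = r"
      using d W_d by simp
    show "restrict (W b) (carrier H) x = x" if "x \<in> carrier H" "hinner H x d = hinner H x r" for x
      using that d r by (simp add: W_def u_def inner_diff_right closed scale_zero)
  qed
qed

text \<open>
  Two families with the same Gram matrix are matched one vector at a time: if \<open>U\<close> already takes
  \<open>d i\<close> to \<open>r i\<close> for \<open>i \<in> I\<close>, then the reflection taking \<open>U (d j)\<close> to \<open>r j\<close> fixes every \<open>r i\<close>.
\<close>

theorem unitary_extension:
  assumes "finite I"
    and "\<And>i. i \<in> I \<Longrightarrow> d i \<in> carrier H" "\<And>i. i \<in> I \<Longrightarrow> r i \<in> carrier H"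
    and "\<And>i j. \<lbrakk>i \<in> I; j \<in> I\<rbrakk> \<Longrightarrow> hinner H (d i) (d j) = hinner H (r i) (r j)"
  obtains U V where "unitary_pair H U V" "\<And>i. i \<in> I \<Longrightarrow> U (d i) = r i"
proof -
  have "\<exists>U V. unitary_pair H U V \<and> (\<forall>i\<in>I. U (d i) = r i)"
    using assms
  proof (induction I rule: finite_induct)
    case empty
    then show ?case
      using unitary_pair_id by blast
  next
    case (insert j I)
    then obtain U V where UV: "unitary_pair H U V" and U: "\<And>i. i \<in> I \<Longrightarrow> U (d i) = r i"
      by auto
    have dj: "d j \<in> carrier H" "r j \<in> carrier H"
      using insert.prems by auto
    have "hinner H (U (d j)) (U (d j)) = hinner H (r j) (r j)"
      using insert.prems by (simp add: unitary_pair_inner[OF UV])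
    then obtain U' V' where UV': "unitary_pair H U' V'" and U'j: "U' (U (d j)) = r j"
      and U'_fix: "\<And>x. \<lbrakk>x \<in> carrier H; hinner H x (U (d j)) = hinner H x (r j)\<rbrakk> \<Longrightarrow> U' x = x"
      using unitary_reflection[OF unitary_pair_closed(1)[OF UV dj(1)] dj(2)] by blast
    have "U' (r i) = r i" if i: "i \<in> I" for i
    proof (rule U'_fix)
      have "hinner H (U (d i)) (U (d j)) = hinner H (r i) (r j)"
        using i insert.prems by (simp add: unitary_pair_inner[OF UV])
      then show "hinner H (r i) (U (d j)) = hinner H (r i) (r j)"
        by (simp add: U i)
    qed (use i insert.prems in auto)
    then have "\<forall>i\<in>insert j I. compose (carrier H) U' U (d i) = r i"
      using U U'j insert.prems(1) by (simp add: compose_eq)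
    then show ?case
      using unitary_pair_compose[OF UV UV'] by blast
  qed
  then show ?thesis
    using that by blast
qed

lemma unitary_op_pair: "unitary_pair H U V \<Longrightarrow> unitary_op H U"
  and adj_op_unitary_pair: "unitary_pair H U V \<Longrightarrow> adj_op H H U = V"
  using unitary_opI[OF inner_product_space_axioms, of U V]
    adj_op_eq[OF inner_product_space_axioms inner_product_space_axioms, of U V]
  by (simp_all add: unitary_pair_def)

end

section \<open>Finite direct sums, transport of structure and tensor products\<close>

text \<open>
  Tuples vanish off the index set, so that the sum in the type of functions is the sum in the carrier and a
  tuple is determined by its components.
\<close>

definition hpow :: "'i set \<Rightarrow> 'a::ab_group_add hspace \<Rightarrow> ('i \<Rightarrow> 'a) hspace" where
  "hpow I H =
     \<lparr>carrier = {\<xi>. (\<forall>i\<in>I. \<xi> i \<in> carrier H) \<and> (\<forall>i. i \<notin> I \<longrightarrow> \<xi> i = 0)},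
      hscale = (\<lambda>c \<xi> i. if i \<in> I then hscale H c (\<xi> i) else 0),
      hinner = (\<lambda>\<xi> \<eta>. \<Sum>i\<in>I. hinner H (\<xi> i) (\<eta> i))\<rparr>"

abbreviation (input) single :: "'i \<Rightarrow> 'a \<Rightarrow> 'i \<Rightarrow> 'a::zero" where
  "single i x \<equiv> (\<lambda>j. if j = i then x else 0)"

lemma in_carrier_hpow:
  "\<xi> \<in> carrier (hpow I H) \<longleftrightarrow> (\<forall>i\<in>I. \<xi> i \<in> carrier H) \<and> (\<forall>i. i \<notin> I \<longrightarrow> \<xi> i = 0)"
  by (simp add: hpow_def)

lemma hscale_hpow: "hscale (hpow I H) c \<xi> = (\<lambda>i. if i \<in> I then hscale H c (\<xi> i) else 0)"
  by (simp add: hpow_def)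

lemma hinner_hpow: "hinner (hpow I H) \<xi> \<eta> = (\<Sum>i\<in>I. hinner H (\<xi> i) (\<eta> i))"
  by (simp add: hpow_def)

lemma inner_product_space_hpow:
  assumes "inner_product_space H" and I: "finite I"
  shows "inner_product_space (hpow I H)"
proof -
  interpret H: inner_product_space H by fact
  have definite: "\<xi> = 0"
    if "\<xi> \<in> carrier (hpow I H)" "hinner (hpow I H) \<xi> \<xi> = 0" for \<xi>
  proof
    fix i
    have "(\<Sum>i\<in>I. (hnorm H (\<xi> i))\<^sup>2) = 0"
      using that unfolding hinner_hpow in_carrier_hpow
      by (simp add: H.inner_self flip: of_real_sum of_real_power)
    then have "\<forall>i\<in>I. (hnorm H (\<xi> i))\<^sup>2 = 0"
      using I by (simp add: sum_nonneg_eq_0_iff)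
    then show "\<xi> i = 0 i"
      using that(1) by (cases "i \<in> I") (auto simp: in_carrier_hpow H.hnorm_eq_0_iff)
  qed
  show ?thesis
  proof
    fix x y z c d assume x: "x \<in> carrier (hpow I H)"
    show "hscale (hpow I H) c x \<in> carrier (hpow I H)"
      using x by (simp add: in_carrier_hpow hscale_hpow H.closed)
    show "hscale (hpow I H) (c + d) x = hscale (hpow I H) c x + hscale (hpow I H) d x"
      using x by (auto simp: in_carrier_hpow hscale_hpow H.scale_add_left)
    show "hscale (hpow I H) c (hscale (hpow I H) d x) = hscale (hpow I H) (c * d) x"
      using x by (auto simp: in_carrier_hpow hscale_hpow H.scale_scale)
    show "hscale (hpow I H) 1 x = x"
      using x by (auto simp: in_carrier_hpow hscale_hpow H.scale_one)
    show "hinner (hpow I H) x x \<in> \<real>\<^sub>\<ge>\<^sub>0"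
      using x unfolding in_carrier_hpow hinner_hpow
      by (simp add: H.inner_self sum_nonneg flip: of_real_sum of_real_power)
    assume y: "y \<in> carrier (hpow I H)"
    show "x + y \<in> carrier (hpow I H)"
      using x y by (simp add: in_carrier_hpow H.closed)
    show "hscale (hpow I H) c (x + y) = hscale (hpow I H) c x + hscale (hpow I H) c y"
      using x y by (auto simp: in_carrier_hpow hscale_hpow H.scale_add_right)
    show "hinner (hpow I H) y x = cnj (hinner (hpow I H) x y)"
      unfolding hinner_hpow cnj_sum
      by (rule sum.cong) (use x y in \<open>auto simp: in_carrier_hpow intro: H.inner_commute\<close>)
    show "hinner (hpow I H) (hscale (hpow I H) c x) y = c * hinner (hpow I H) x y"
      using x y by (simp add: in_carrier_hpow hinner_hpow hscale_hpow H.inner_scale_left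
          sum_distrib_left)
    assume z: "z \<in> carrier (hpow I H)"
    show "hinner (hpow I H) (x + y) z = hinner (hpow I H) x z + hinner (hpow I H) y z"
      using x y z by (simp add: in_carrier_hpow hinner_hpow H.inner_add_left sum.distrib)
  qed (auto simp: definite in_carrier_hpow H.zero_closed)
qed

lemma hnorm_hpow:
  assumes "inner_product_space H" "\<xi> \<in> carrier (hpow I H)"
  shows "hnorm (hpow I H) \<xi> = L2_set (\<lambda>i. hnorm H (\<xi> i)) I"
proof -
  interpret H: inner_product_space H by fact
  show ?thesis
    using assms(2) by (simp add: hnorm_def[of "hpow I H"] L2_set_def hinner_hpow in_carrier_hpow
        H.Re_inner_self)
qed

lemma hnorm_hpow_component:
  assumes "inner_product_space H" "finite I" "\<xi> \<in> carrier (hpow I H)" "i \<in> I"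
  shows "hnorm H (\<xi> i) \<le> hnorm (hpow I H) \<xi>"
  using assms(1,3) member_le_L2_set[OF assms(2,4), of "\<lambda>i. hnorm H (\<xi> i)"]
  by (simp add: hnorm_hpow)

lemma hnorm_hpow_le_sum:
  assumes "inner_product_space H" "\<xi> \<in> carrier (hpow I H)"
  shows "hnorm (hpow I H) \<xi> \<le> (\<Sum>i\<in>I. hnorm H (\<xi> i))"
proof -
  interpret H: inner_product_space H by fact
  show ?thesis
    using assms by (simp add: hnorm_hpow L2_set_le_sum in_carrier_hpow H.hnorm_nonneg)
qed

lemma hilbert_space_hpow:
  assumes "hilbert_space H" and I: "finite I"
  shows "hilbert_space (hpow I H)"
proof -
  interpret H: hilbert_space H by fact
  interpret P: inner_product_space "hpow I H"
    by (rule inner_product_space_hpow[OF H.inner_product_space_axioms I])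
  show ?thesis
  proof (rule P.hilbert_spaceI)
    fix x :: "nat \<Rightarrow> 'b \<Rightarrow> 'a"
    assume x: "\<And>n. x n \<in> carrier (hpow I H)"
      and Cau: "\<And>e. 0 < e \<Longrightarrow> \<exists>N. \<forall>m\<ge>N. \<forall>n\<ge>N. hnorm (hpow I H) (x m - x n) < e"
    have comp: "hnorm H (x m i - x n i) \<le> hnorm (hpow I H) (x m - x n)" if "i \<in> I" for i m n
      using hnorm_hpow_component[OF H.inner_product_space_axioms I P.diff_closed[OF x x] that]
      by simp
    have "\<exists>l. i \<in> I \<longrightarrow> l \<in> carrier H \<and> (\<lambda>n. hnorm H (x n i - l)) \<longlonglongrightarrow> 0" for i
    proof (cases "i \<in> I")
      case True
      have "x n i \<in> carrier H" for n
        using x[of n] True by (simp add: in_carrier_hpow)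
      moreover have "\<exists>N. \<forall>m\<ge>N. \<forall>n\<ge>N. hnorm H (x m i - x n i) < e" if "0 < e" for e
        using Cau[OF that] comp[OF True] by (meson le_less_trans)
      ultimately show ?thesis
        using H.Cauchy_has_limit[of "\<lambda>n. x n i"] by metis
    qed auto
    then obtain l where l: "\<And>i. i \<in> I \<Longrightarrow> l i \<in> carrier H"
      and lim: "\<And>i. i \<in> I \<Longrightarrow> (\<lambda>n. hnorm H (x n i - l i)) \<longlonglongrightarrow> 0"
      by metis
    define l' where "l' i = (if i \<in> I then l i else 0)" for i
    have l': "l' \<in> carrier (hpow I H)"
      using l by (simp add: in_carrier_hpow l'_def)
    have "(\<lambda>n. hnorm (hpow I H) (x n - l')) \<longlonglongrightarrow> 0"
    proof (rule P.hlim_cong_bound)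
      have "(\<lambda>n. \<Sum>i\<in>I. hnorm H (x n i - l i)) \<longlonglongrightarrow> (\<Sum>i\<in>I. 0)"
        by (intro tendsto_sum lim)
      then show "(\<lambda>n. \<Sum>i\<in>I. hnorm H (x n i - l i)) \<longlonglongrightarrow> 0"
        by simp
      show "hnorm (hpow I H) (x n - l') \<le> (\<Sum>i\<in>I. hnorm H (x n i - l i))" for n
        using hnorm_hpow_le_sum[OF H.inner_product_space_axioms P.diff_closed[OF x l'], of n]
        by (simp add: l'_def)
    qed (use x l' in \<open>simp add: P.closed\<close>)
    then show "\<exists>l\<in>carrier (hpow I H). (\<lambda>n. hnorm (hpow I H) (x n - l)) \<longlonglongrightarrow> 0"
      using l' by blast
  qed
qed

definition complex_hspace :: "complex hspace" where
  "complex_hspace = \<lparr>carrier = UNIV, hscale = (*), hinner = (\<lambda>x y. x * cnj y)\<rparr>"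

lemma complex_hspace_simps [simp]:
  "carrier complex_hspace = UNIV" "hscale complex_hspace c x = c * x"
  "hinner complex_hspace x y = x * cnj y" "hnorm complex_hspace x = cmod x"
  by (simp_all add: complex_hspace_def hnorm_def complex_mult_cnj cmod_def power2_eq_square)

lemma hilbert_space_complex: "hilbert_space complex_hspace"
proof -
  interpret inner_product_space complex_hspace
  proof
    fix x :: complex
    show "hinner complex_hspace x x \<in> \<real>\<^sub>\<ge>\<^sub>0"
      by (simp add: complex_mult_cnj complex_nonneg_Reals_iff)
  qed (simp_all add: algebra_simps)
  show ?thesis
  proof (rule hilbert_spaceI)
    fix x :: "nat \<Rightarrow> complex"
    assume "\<And>e. 0 < e \<Longrightarrow> \<exists>N. \<forall>m\<ge>N. \<forall>n\<ge>N. hnorm complex_hspace (x m - x n) < e"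
    then have "Cauchy x"
      by (simp add: Cauchy_def dist_norm)
    then obtain l where "x \<longlonglongrightarrow> l"
      using Cauchy_convergent convergent_def by blast
    then have "(\<lambda>n. cmod (x n - l)) \<longlonglongrightarrow> 0"
      using LIM_zero tendsto_norm_zero by blast
    then show "\<exists>l\<in>carrier complex_hspace. (\<lambda>n. hnorm complex_hspace (x n - l)) \<longlonglongrightarrow> 0"
      by auto
  qed
qed

abbreviation complex_tuples :: "nat \<Rightarrow> (nat \<Rightarrow> complex) hspace" where
  "complex_tuples N \<equiv> hpow {..<N} complex_hspace"

lemma hilbert_space_complex_tuples: "hilbert_space (complex_tuples N)"
  by (intro hilbert_space_hpow hilbert_space_complex) simp

lemma separable_complex_tuples: "separable_space (htopology (complex_tuples N))"
proof -
  interpret X: hilbert_space "complex_tuples N" by (rule hilbert_space_complex_tuples)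
  interpret C: hilbert_space complex_hspace by (rule hilbert_space_complex)
  obtain Q :: "complex set" where Q: "countable Q" "\<And>S. \<lbrakk>open S; S \<noteq> {}\<rbrakk> \<Longrightarrow> \<exists>d\<in>Q. d \<in> S"
    by (rule countable_dense_setE) blast
  define D where "D = (\<lambda>f k. if k < N then f k else 0) ` (PiE {..<N} (\<lambda>_. Q))"
  have "countable D"
    unfolding D_def using Q(1) by (intro countable_image countable_PiE) simp_all
  moreover have "D \<subseteq> carrier (complex_tuples N)"
    by (simp add: D_def in_carrier_hpow image_subset_iff)
  moreover have "\<exists>z\<in>D. z \<in> X.mball y r" if y: "y \<in> carrier (complex_tuples N)" and "0 < r" for y r
  proof -
    have "0 < r / real (Suc N)"
      using \<open>0 < r\<close> by simp
    then have "\<exists>q\<in>Q. cmod (y k - q) < r / real (Suc N)" for k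
      using Q(2)[OF open_ball, of "y k" "r / real (Suc N)"] by (simp add: dist_norm)
    then obtain q where q: "\<And>k. q k \<in> Q" "\<And>k. cmod (y k - q k) < r / real (Suc N)"
      by metis
    define z where "z k = (if k < N then q k else 0)" for k
    have "z = (\<lambda>k. if k < N then restrict q {..<N} k else 0)"
      by (auto simp: z_def)
    then have "z \<in> D"
      unfolding D_def
      by (intro image_eqI[of _ _ "restrict q {..<N}"]) (simp_all add: restrict_PiE_iff q(1))
    then have z: "z \<in> carrier (complex_tuples N)"
      using \<open>D \<subseteq> _\<close> by auto
    have "hnorm (complex_tuples N) (y - z) \<le> (\<Sum>k<N. cmod (y k - z k))"
      using hnorm_hpow_le_sum[OF C.inner_product_space_axioms X.diff_closed[OF y z]] by simp
    also have "\<dots> \<le> (\<Sum>k<N. r / real (Suc N))"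
      using q(2) by (intro sum_mono less_imp_le) (auto simp: z_def)
    also have "\<dots> < r"
      using \<open>0 < r\<close> by (simp add: field_simps)
    finally show ?thesis
      using \<open>z \<in> D\<close> y z by (intro bexI[of _ z]) (auto simp: X.in_mball hdist_def)
  qed
  ultimately show ?thesis
    unfolding separable_space_def X.metric_closure_of
    by (intro exI[of _ D]) auto
qed

text \<open>
  Spaces are wanted in prescribed types.  As addition is that of the type, only additive injections can
  carry a structure over.
\<close>

definition himage :: "('a \<Rightarrow> 'b) \<Rightarrow> 'a::ab_group_add hspace \<Rightarrow> 'b::ab_group_add hspace" where
  "himage j H =
     \<lparr>carrier = j ` carrier H,
      hscale = (\<lambda>c x. j (hscale H c (inv_into (carrier H) j x))),
      hinner = (\<lambda>x y. hinner H (inv_into (carrier H) j x) (inv_into (carrier H) j y))\<rparr>"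

locale hilbert_embedding = hilbert_space H
  for H :: "'a::ab_group_add hspace" +
  fixes j :: "'a \<Rightarrow> 'b::ab_group_add"
  assumes inj: "inj_on j (carrier H)"
    and j_add: "\<lbrakk>x \<in> carrier H; y \<in> carrier H\<rbrakk> \<Longrightarrow> j (x + y) = j x + j y"
begin

lemma carrier_himage: "carrier (himage j H) = j ` carrier H"
  by (simp add: himage_def)

lemma j_zero: "j 0 = 0"
  using j_add[of 0 0] by (simp add: zero_closed)

lemma j_diff: "\<lbrakk>x \<in> carrier H; y \<in> carrier H\<rbrakk> \<Longrightarrow> j (x - y) = j x - j y"
  using j_add[of "x - y" y] by (simp add: closed)

lemma j_sum: "(\<And>i. i \<in> I \<Longrightarrow> f i \<in> carrier H) \<Longrightarrow> j (sum f I) = (\<Sum>i\<in>I. j (f i))"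
  by (induction I rule: infinite_finite_induct) (auto simp: j_add j_zero sum_closed)

lemma hscale_himage: "x \<in> carrier H \<Longrightarrow> hscale (himage j H) c (j x) = j (hscale H c x)"
  by (simp add: himage_def inj)

lemma hinner_himage:
  "\<lbrakk>x \<in> carrier H; y \<in> carrier H\<rbrakk> \<Longrightarrow> hinner (himage j H) (j x) (j y) = hinner H x y"
  by (simp add: himage_def inj)

lemma hnorm_himage: "x \<in> carrier H \<Longrightarrow> hnorm (himage j H) (j x) = hnorm H x"
  by (simp add: hnorm_def hinner_himage)

lemma inner_product_space_himage: "inner_product_space (himage j H)"
proof
  show "0 \<in> carrier (himage j H)"
    using zero_closed j_zero by (force simp: carrier_himage)
  fix x y c d assume "x \<in> carrier (himage j H)"
  then obtain u where u: "u \<in> carrier H" "x = j u"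
    by (auto simp: carrier_himage)
  show "hscale (himage j H) c x \<in> carrier (himage j H)"
    using u by (simp add: hscale_himage closed carrier_himage)
  show "hscale (himage j H) (c + d) x = hscale (himage j H) c x + hscale (himage j H) d x"
    using u by (simp add: hscale_himage scale_add_left j_add closed)
  show "hscale (himage j H) c (hscale (himage j H) d x) = hscale (himage j H) (c * d) x"
    using u by (simp add: hscale_himage scale_scale closed)
  show "hscale (himage j H) 1 x = x"
    using u by (simp add: hscale_himage scale_one)
  show "hinner (himage j H) x x \<in> \<real>\<^sub>\<ge>\<^sub>0"
    using u by (simp add: hinner_himage inner_nonneg)
  show "x = 0" if "hinner (himage j H) x x = 0"
    using u that inner_definite[of u] by (simp add: hinner_himage j_zero)
  assume "y \<in> carrier (himage j H)"
  then obtain v where v: "v \<in> carrier H" "y = j v"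
    by (auto simp: carrier_himage)
  show "x + y \<in> carrier (himage j H)"
    using u v j_add[of u v] by (auto simp: carrier_himage closed intro!: image_eqI[of _ j "u + v"])
  show "hscale (himage j H) c (x + y) = hscale (himage j H) c x + hscale (himage j H) c y"
    using u v by (simp add: hscale_himage scale_add_right closed flip: j_add)
  show "hinner (himage j H) (hscale (himage j H) c x) y = c * hinner (himage j H) x y"
    using u v by (simp add: hscale_himage hinner_himage closed inner_scale_left)
  show "hinner (himage j H) y x = cnj (hinner (himage j H) x y)"
    using u v by (simp add: hinner_himage inner_commute[of u v])
  fix z assume "z \<in> carrier (himage j H)"
  then obtain w where w: "w \<in> carrier H" "z = j w"
    by (auto simp: carrier_himage)
  show "hinner (himage j H) (x + y) z = hinner (himage j H) x z + hinner (himage j H) y z"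
    using u v w by (simp add: hinner_himage closed inner_add_left flip: j_add)
qed

lemma hilbert_space_himage: "hilbert_space (himage j H)"
proof -
  interpret I: inner_product_space "himage j H"
    by (rule inner_product_space_himage)
  show ?thesis
  proof (rule I.hilbert_spaceI)
    fix y :: "nat \<Rightarrow> 'b"
    assume "\<And>n. y n \<in> carrier (himage j H)"
    then have "\<forall>n. \<exists>x. x \<in> carrier H \<and> y n = j x"
      by (auto simp: carrier_himage)
    then obtain x where x: "\<And>n. x n \<in> carrier H" and y: "\<And>n. y n = j (x n)"
      by metis
    have dist: "hnorm (himage j H) (y m - j u) = hnorm H (x m - u)" if "u \<in> carrier H" for m u
      using that x by (simp add: y closed hnorm_himage flip: j_diff)
    assume "\<And>e. 0 < e \<Longrightarrow> \<exists>N. \<forall>m\<ge>N. \<forall>n\<ge>N. hnorm (himage j H) (y m - y n) < e"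
    then have "\<exists>N. \<forall>m\<ge>N. \<forall>n\<ge>N. hnorm H (x m - x n) < e" if "0 < e" for e
      using that by (simp add: y[of n for n] x flip: dist)
    then obtain l where "l \<in> carrier H" "(\<lambda>n. hnorm H (x n - l)) \<longlonglongrightarrow> 0"
      using Cauchy_has_limit[of x] x by blast
    then show "\<exists>l\<in>carrier (himage j H). (\<lambda>n. hnorm (himage j H) (y n - l)) \<longlonglongrightarrow> 0"
      by (intro bexI[of _ "j l"]) (auto simp: dist carrier_himage)
  qed
qed

lemma embedding_bounded: "restrict j (carrier H) \<in> bounded_ops H (himage j H)"
  by (rule bounded_opsI[where M = 1])
    (auto simp: carrier_himage j_add hscale_himage hnorm_himage inner_product_space_axioms)

lemma embedding_inverse_bounded:
  "restrict (inv_into (carrier H) j) (j ` carrier H) \<in> bounded_ops (himage j H) H"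
proof -
  have "restrict (inv_into (carrier H) j) (carrier (himage j H)) \<in> bounded_ops (himage j H) H"
  proof (rule bounded_opsI[where M = 1])
    fix x y assume "x \<in> carrier (himage j H)" "y \<in> carrier (himage j H)"
    then obtain u v where uv: "u \<in> carrier H" "v \<in> carrier H" "x = j u" "y = j v"
      by (auto simp: carrier_himage)
    have "inv_into (carrier H) j (j (u + v)) = u + v"
      using uv inj by (simp add: closed)
    then show "inv_into (carrier H) j (x + y) = inv_into (carrier H) j x + inv_into (carrier H) j y"
      using uv inj by (simp add: j_add)
  qed (auto simp: carrier_himage hscale_himage hnorm_himage inner_product_space_himage inj closed)
  then show ?thesis
    by (simp add: carrier_himage)
qed

end

text \<open>
  A concrete tensor product of \<open>C\<close> and \<open>\<complex>\<^sup>N\<close>: \<open>C\<^sup>N\<close>, where \<open>x \<otimes> y\<close> is the tuple of the \<open>y k \<cdot> x\<close>,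
  embedded by \<open>\<xi> \<mapsto> (\<lambda>(x, y). \<Sum>\<^sub>k \<langle>\<xi> k, x\<rangle> y k)\<close> in the type where tensor products are sought.
\<close>

definition tuple_fun :: "'c::ab_group_add hspace \<Rightarrow> nat \<Rightarrow> (nat \<Rightarrow> 'c) \<Rightarrow> 'c \<times> (nat \<Rightarrow> complex) \<Rightarrow> complex" where
  "tuple_fun C N \<xi> = (\<lambda>(x, y). if x \<in> carrier C then \<Sum>k<N. y k * hinner C (\<xi> k) x else 0)"

definition tuple_tensor :: "'c::ab_group_add hspace \<Rightarrow> nat \<Rightarrow> 'c \<Rightarrow> (nat \<Rightarrow> complex) \<Rightarrow> nat \<Rightarrow> 'c" where
  "tuple_tensor C N x y = (\<lambda>k. if k < N then hscale C (y k) x else 0)"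

lemma hilbert_embedding_tuple_fun:
  assumes "hilbert_space C"
  shows "hilbert_embedding (hpow {..<N} C) (tuple_fun C N)"
proof -
  interpret C: hilbert_space C by fact
  interpret P: hilbert_space "hpow {..<N} C"
    by (intro hilbert_space_hpow assms) simp
  show ?thesis
  proof
    show "inj_on (tuple_fun C N) (carrier (hpow {..<N} C))"
    proof (rule inj_onI)
      fix \<xi> \<eta> assume \<xi>: "\<xi> \<in> carrier (hpow {..<N} C)" and \<eta>: "\<eta> \<in> carrier (hpow {..<N} C)"
        and eq: "tuple_fun C N \<xi> = tuple_fun C N \<eta>"
      show "\<xi> = \<eta>"
      proof
        fix k
        show "\<xi> k = \<eta> k"
        proof (cases "k < N")
          case True
          show ?thesis
          proof (rule C.eqI_Re_inner)
            fix x assume "x \<in> carrier C"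
            then show "Re (hinner C (\<xi> k) x) = Re (hinner C (\<eta> k) x)"
              using fun_cong[OF eq, of "(x, single k 1)"] True
              by (simp add: tuple_fun_def if_distrib[of "\<lambda>z. z * _"] cong: if_cong)
          qed (use True \<xi> \<eta> in \<open>auto simp: in_carrier_hpow\<close>)
        qed (use \<xi> \<eta> in \<open>auto simp: in_carrier_hpow\<close>)
      qed
    qed
    show "tuple_fun C N (\<xi> + \<eta>) = tuple_fun C N \<xi> + tuple_fun C N \<eta>"
      if "\<xi> \<in> carrier (hpow {..<N} C)" "\<eta> \<in> carrier (hpow {..<N} C)" for \<xi> \<eta>
      using that by (auto simp: fun_eq_iff tuple_fun_def in_carrier_hpow C.inner_add_left
          distrib_left sum.distrib)
  qed
qed

lemma sum_fun_apply: "sum f I x = (\<Sum>i\<in>I. f i x)"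
  by (induction I rule: infinite_finite_induct) auto

lemma complex_tuples_matrix:
  assumes W: "W \<in> bounded_ops (complex_tuples N) (complex_tuples N)"
    and y: "y \<in> carrier (complex_tuples N)" and "k < N"
  shows "W y k = (\<Sum>l<N. y l * W (single l 1) k)"
proof -
  let ?X = "complex_tuples N"
  interpret X: hilbert_space ?X by (rule hilbert_space_complex_tuples)
  interpret W: bounded_op ?X ?X W
    using W by unfold_locales
  have unit: "single l 1 \<in> carrier ?X" if "l < N" for l
    using that by (simp add: in_carrier_hpow)
  have "y = (\<Sum>l<N. hscale ?X (y l) (single l 1))"
  proof
    fix k
    have "(\<Sum>l<N. hscale ?X (y l) (single l 1)) k = (\<Sum>l<N. hscale ?X (y l) (single l 1) k)"
      by (rule sum_fun_apply)
    also have "\<dots> = (\<Sum>l<N. if l = k then y l else 0)"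
      by (intro sum.cong) (auto simp: hscale_hpow)
    also have "\<dots> = y k"
      using y by (simp add: in_carrier_hpow)
    finally show "y k = (\<Sum>l<N. hscale ?X (y l) (single l 1)) k" ..
  qed
  then have "W y = W (\<Sum>l<N. hscale ?X (y l) (single l 1))"
    by (rule arg_cong)
  also have "\<dots> = (\<Sum>l<N. W (hscale ?X (y l) (single l 1)))"
    by (intro W.sum X.scale_closed unit) simp
  also have "\<dots> = (\<Sum>l<N. hscale ?X (y l) (W (single l 1)))"
    by (intro sum.cong refl W.scale unit) simp
  finally have "W y k = (\<Sum>l<N. hscale ?X (y l) (W (single l 1)) k)"
    by (simp add: sum_fun_apply)
  then show ?thesis
    using \<open>k < N\<close> by (simp add: hscale_hpow)
qed

locale tuple_tensor_product = C: hilbert_space C for C :: "'c::ab_group_add hspace" +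
  fixes N :: nat
begin

abbreviation tup where "tup \<equiv> hpow {..<N} C"
abbreviation X where "X \<equiv> complex_tuples N"
abbreviation T where "T \<equiv> himage (tuple_fun C N) tup"
abbreviation \<tau> where "\<tau> \<equiv> \<lambda>x y. tuple_fun C N (tuple_tensor C N x y)"

sublocale tup: hilbert_embedding tup "tuple_fun C N"
  by (rule hilbert_embedding_tuple_fun) unfold_locales

sublocale X: hilbert_space X
  by (rule hilbert_space_complex_tuples)

sublocale T: hilbert_space T
  by (rule tup.hilbert_space_himage)

lemma tuple_tensor_closed: "x \<in> carrier C \<Longrightarrow> tuple_tensor C N x y \<in> carrier tup"
  by (simp add: in_carrier_hpow tuple_tensor_def C.closed)

lemma unit_closed: "k < N \<Longrightarrow> single k 1 \<in> carrier X"
  by (simp add: in_carrier_hpow)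

lemma sum_tuple_tensor:
  assumes "\<xi> \<in> carrier tup"
  shows "(\<Sum>k<N. tuple_tensor C N (\<xi> k) (single k 1)) = \<xi>"
proof
  fix l
  have *: "tuple_tensor C N (\<xi> k) (single k 1) l = (if k = l then \<xi> l else 0)" if "k < N" for k
    using that assms by (auto simp: tuple_tensor_def C.scale_zero C.scale_one in_carrier_hpow)
  have "(\<Sum>k<N. tuple_tensor C N (\<xi> k) (single k 1)) l
      = (\<Sum>k<N. tuple_tensor C N (\<xi> k) (single k 1) l)"
    by (rule sum_fun_apply)
  also have "\<dots> = (\<Sum>k<N. if k = l then \<xi> l else 0)"
    using * by (intro sum.cong) auto
  also have "\<dots> = \<xi> l"
    using assms by (simp add: in_carrier_hpow)
  finally show "(\<Sum>k<N. tuple_tensor C N (\<xi> k) (single k 1)) l = \<xi> l" .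
qed

text \<open>
  A tuple is the finite sum of the tensors of its components with the unit vectors, so elementary tensors span
  the whole space and density is immediate.
\<close>

lemma hilbert_tensor: "hilbert_tensor C X T \<tau>"
proof -
  have \<tau>_closed: "\<tau> x y \<in> carrier T" if "x \<in> carrier C" for x y
    using that by (simp add: tup.carrier_himage tuple_tensor_closed)
  have 1: "tuple_tensor C N (x + x') y = tuple_tensor C N x y + tuple_tensor C N x' y"
    if "x \<in> carrier C" "x' \<in> carrier C" for x x' y
    using that by (auto simp: tuple_tensor_def C.scale_add_right)
  have 2: "tuple_tensor C N x (y + y') = tuple_tensor C N x y + tuple_tensor C N x y'"
    if "x \<in> carrier C" for x y y'
    using that by (auto simp: tuple_tensor_def C.scale_add_left)
  have 3: "tuple_tensor C N (hscale C c x) y = hscale tup c (tuple_tensor C N x y)"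
    "tuple_tensor C N x (hscale X c y) = hscale tup c (tuple_tensor C N x y)"
    if "x \<in> carrier C" for c x y
    using that by (auto simp: tuple_tensor_def hscale_hpow C.scale_scale mult.commute)
  have 4: "hinner tup (tuple_tensor C N x y) (tuple_tensor C N x' y') = hinner C x x' * hinner X y y'"
    if "x \<in> carrier C" "x' \<in> carrier C" for x x' y y'
    using that by (simp add: tuple_tensor_def hinner_hpow C.inner_simps C.closed sum_distrib_left
        mult_ac)
  let ?S = "{\<Sum>i<n. \<tau> (x i) (y i) |(n::nat) x y. \<forall>i<n. x i \<in> carrier C \<and> y i \<in> carrier X}"
  have "?S = carrier T"
  proof
    show "?S \<subseteq> carrier T"
      using \<tau>_closed by (auto intro!: T.sum_closed)
    show "carrier T \<subseteq> ?S"
    proof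
      fix t assume "t \<in> carrier T"
      then obtain \<xi> where \<xi>: "\<xi> \<in> carrier tup" and t: "t = tuple_fun C N \<xi>"
        by (auto simp: tup.carrier_himage)
      have "\<xi> k \<in> carrier C" if "k < N" for k
        using \<xi> that by (simp add: in_carrier_hpow)
      moreover from this have "t = (\<Sum>k<N. \<tau> (\<xi> k) (single k 1))"
        unfolding t by (subst sum_tuple_tensor[OF \<xi>, symmetric], subst tup.j_sum)
          (auto simp: tuple_tensor_closed)
      ultimately show "t \<in> ?S"
        using unit_closed
        by (intro CollectI exI[of _ N] exI[of _ \<xi>] exI[of _ "\<lambda>k. single k 1"]) simp
    qed
  qed
  then have "htopology T closure_of ?S = carrier T"
    using closure_of_topspace[of "htopology T"] by simp
  then show ?thesis
    unfolding hilbert_tensor_def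
    using T.hilbert_space_axioms \<tau>_closed 1 2 3 4
    by (simp add: tup.j_add tup.hscale_himage tup.hinner_himage tuple_tensor_closed)
qed

text \<open>
  The tensor product with \<open>W\<close> acts on tuples through the matrix of \<open>W\<close>.  It is the only operator with the
  prescribed values on elementary tensors, because these span.
\<close>

lemma tensor_op_tuple:
  assumes A: "A \<in> bounded_ops C C" and W: "W \<in> bounded_ops X X" and \<xi>: "\<xi> \<in> carrier tup"
  shows "tensor_op C X T \<tau> A W (tuple_fun C N \<xi>) =
    tuple_fun C N (\<lambda>k. if k < N then \<Sum>l<N. hscale C (W (single l 1) k) (A (\<xi> l)) else 0)"
proof -
  interpret A: bounded_op C C A
    using A by unfold_locales
  interpret W: bounded_op X X W
    using W by unfold_locales
  define F where "F \<xi> k = (if k < N then \<Sum>l<N. hscale C (W (single l 1) k) (A (\<xi> l)) else 0)" for \<xi> k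
  have comp: "\<xi> l \<in> carrier C" if "\<xi> \<in> carrier tup" "l < N" for \<xi> l
    using that by (simp add: in_carrier_hpow)
  have F_closed: "F \<xi> \<in> carrier tup" if "\<xi> \<in> carrier tup" for \<xi>
    using that by (auto simp: in_carrier_hpow F_def intro!: C.sum_closed C.scale_closed A.closed comp)
  obtain M where M: "0 \<le> M" "\<And>x. x \<in> carrier C \<Longrightarrow> hnorm C (A x) \<le> M * hnorm C x"
    using A.bound by blast
  define M' where "M' = (\<Sum>k<N. \<Sum>l<N. cmod (W (single l 1) k) * M)"
  have F_bound: "hnorm tup (F \<xi>) \<le> M' * hnorm tup \<xi>" if \<xi>: "\<xi> \<in> carrier tup" for \<xi>
  proof -
    have "hnorm tup (F \<xi>) \<le> (\<Sum>k<N. hnorm C (F \<xi> k))"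
      by (rule hnorm_hpow_le_sum[OF C.inner_product_space_axioms F_closed[OF \<xi>]])
    also have "\<dots> \<le> (\<Sum>k<N. \<Sum>l<N. cmod (W (single l 1) k) * M * hnorm tup \<xi>)"
    proof (rule sum_mono)
      fix k assume "k \<in> {..<N}"
      then have "hnorm C (F \<xi> k) = hnorm C (\<Sum>l<N. hscale C (W (single l 1) k) (A (\<xi> l)))"
        by (simp add: F_def)
      also have "\<dots> \<le> (\<Sum>l<N. hnorm C (hscale C (W (single l 1) k) (A (\<xi> l))))"
        using \<xi> by (intro C.hnorm_sum_le C.scale_closed A.closed comp) auto
      also have "\<dots> \<le> (\<Sum>l<N. cmod (W (single l 1) k) * M * hnorm tup \<xi>)"
      proof (rule sum_mono)
        fix l assume l: "l \<in> {..<N}"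
        have "hnorm C (A (\<xi> l)) \<le> M * hnorm C (\<xi> l)"
          using l \<xi> by (intro M comp) auto
        also have "\<dots> \<le> M * hnorm tup \<xi>"
          using l \<xi> hnorm_hpow_component[OF C.inner_product_space_axioms finite_lessThan \<xi> l] M(1)
          by (intro mult_left_mono) auto
        finally have "cmod (W (single l 1) k) * hnorm C (A (\<xi> l))
            \<le> cmod (W (single l 1) k) * (M * hnorm tup \<xi>)"
          by (intro mult_left_mono) auto
        then show "hnorm C (hscale C (W (single l 1) k) (A (\<xi> l)))
            \<le> cmod (W (single l 1) k) * M * hnorm tup \<xi>"
          using l \<xi> by (simp add: C.hnorm_scale A.closed comp mult.assoc)
      qed
      finally show "hnorm C (F \<xi> k) \<le> (\<Sum>l<N. cmod (W (single l 1) k) * M * hnorm tup \<xi>)" .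
    qed
    also have "\<dots> = M' * hnorm tup \<xi>"
      by (simp add: M'_def sum_distrib_right)
    finally show ?thesis .
  qed
  have F_add: "F (\<xi> + \<eta>) = F \<xi> + F \<eta>" if "\<xi> \<in> carrier tup" "\<eta> \<in> carrier tup" for \<xi> \<eta>
    using that comp[OF that(1)] comp[OF that(2)]
    by (auto simp: F_def A.add A.closed C.scale_add_right sum.distrib)
  have F_scale: "F (hscale tup c \<xi>) = hscale tup c (F \<xi>)" if "\<xi> \<in> carrier tup" for c \<xi>
  proof
    fix k
    have "hscale C c (\<Sum>l<N. hscale C (W (single l 1) k) (A (\<xi> l)))
        = (\<Sum>l<N. hscale C c (hscale C (W (single l 1) k) (A (\<xi> l))))"
      using comp[OF that] by (intro C.scale_sum C.scale_closed A.closed) simp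
    then show "F (hscale tup c \<xi>) k = hscale tup c (F \<xi>) k"
      using comp[OF that] by (simp add: F_def hscale_hpow A.scale A.closed C.scale_scale mult.commute)
  qed
  define R where "R = restrict (\<lambda>t. tuple_fun C N (F (inv_into (carrier tup) (tuple_fun C N) t))) (carrier T)"
  have R_eq: "R (tuple_fun C N \<xi>) = tuple_fun C N (F \<xi>)" if "\<xi> \<in> carrier tup" for \<xi>
    using that tup.inj by (simp add: R_def tup.carrier_himage)
  have R: "R \<in> bounded_ops T T"
  proof -
    have "restrict R (carrier T) \<in> bounded_ops T T"
    proof (rule bounded_opsI)
      fix s t c assume s: "s \<in> carrier T" then obtain \<xi> where \<xi>: "\<xi> \<in> carrier tup" "s = tuple_fun C N \<xi>"
        by (auto simp: tup.carrier_himage)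
      show "R s \<in> carrier T"
        using \<xi> by (simp add: R_eq F_closed tup.carrier_himage)
      show "R (hscale T c s) = hscale T c (R s)"
        using \<xi> by (simp add: tup.hscale_himage R_eq F_closed F_scale tup.closed)
      show "hnorm T (R s) \<le> M' * hnorm T s"
        using \<xi> by (simp add: tup.hnorm_himage R_eq F_closed F_bound)
      assume "t \<in> carrier T" then obtain \<eta> where \<eta>: "\<eta> \<in> carrier tup" "t = tuple_fun C N \<eta>"
        by (auto simp: tup.carrier_himage)
      have "R (s + t) = tuple_fun C N (F (\<xi> + \<eta>))"
        using \<xi> \<eta> R_eq[of "\<xi> + \<eta>"] by (simp add: tup.j_add tup.closed)
      then show "R (s + t) = R s + R t"
        using \<xi> \<eta> by (simp add: R_eq F_closed F_add tup.j_add)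
    qed (rule T.inner_product_space_axioms)
    then show ?thesis
      by (simp add: R_def)
  qed
  have R_tensor: "R (\<tau> x y) = \<tau> (A x) (W y)" if x: "x \<in> carrier C" and y: "y \<in> carrier X" for x y
  proof -
    have W_y: "W y k = (\<Sum>l<N. y l * W (single l 1) k)" if "k < N" for k
      using complex_tuples_matrix[OF W y that] .
    have "F (tuple_tensor C N x y) k = tuple_tensor C N (A x) (W y) k" for k
    proof (cases "k < N")
      case True
      have "F (tuple_tensor C N x y) k = (\<Sum>l<N. hscale C (y l * W (single l 1) k) (A x))"
        using True x
        by (simp add: F_def tuple_tensor_def A.scale A.closed C.scale_scale mult.commute)
      also have "\<dots> = hscale C (\<Sum>l<N. y l * W (single l 1) k) (A x)"
        by (induction N) (simp_all add: C.scale_zero C.scale_add_left A.closed x)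
      finally show ?thesis
        using True by (simp add: tuple_tensor_def W_y)
    qed (simp add: F_def tuple_tensor_def)
    then have "F (tuple_tensor C N x y) = tuple_tensor C N (A x) (W y)"
      by blast
    then show ?thesis
      using x by (simp add: R_eq tuple_tensor_closed)
  qed
  have "tensor_op C X T \<tau> A W = R"
    unfolding tensor_op_def
  proof (rule the_equality)
    show "R \<in> bounded_ops T T \<and> (\<forall>x\<in>carrier C. \<forall>y\<in>carrier X. R (\<tau> x y) = \<tau> (A x) (W y))"
      using R R_tensor by blast
    fix R' assume R': "R' \<in> bounded_ops T T \<and>
      (\<forall>x\<in>carrier C. \<forall>y\<in>carrier X. R' (\<tau> x y) = \<tau> (A x) (W y))"
    interpret R: bounded_op T T R
      using R by unfold_locales
    interpret R': bounded_op T T R'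
      using R' by unfold_locales blast
    show "R' = R"
    proof (rule bounded_ops_eqI[OF R'.mem R])
      fix t assume "t \<in> carrier T"
      then obtain \<xi> where \<xi>: "\<xi> \<in> carrier tup" and t: "t = tuple_fun C N \<xi>"
        by (auto simp: tup.carrier_himage)
      have t_sum: "t = (\<Sum>k<N. \<tau> (\<xi> k) (single k 1))"
        unfolding t by (subst sum_tuple_tensor[OF \<xi>, symmetric], subst tup.j_sum)
          (auto simp: tuple_tensor_closed comp[OF \<xi>])
      have \<tau>_closed: "\<tau> (\<xi> k) (single k 1) \<in> carrier T" if "k < N" for k
        using that by (simp add: tup.carrier_himage tuple_tensor_closed comp[OF \<xi>])
      have "R' t = (\<Sum>k<N. R' (\<tau> (\<xi> k) (single k 1)))"
        unfolding t_sum by (intro R'.sum \<tau>_closed) simp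
      also have "\<dots> = (\<Sum>k<N. R (\<tau> (\<xi> k) (single k 1)))"
        using R' by (intro sum.cong refl) (simp add: R_tensor comp[OF \<xi>] unit_closed)
      also have "\<dots> = R t"
        unfolding t_sum by (intro R.sum[symmetric] \<tau>_closed) simp
      finally show "R' t = R t" .
    qed
  qed
  moreover have "F \<xi> = (\<lambda>k. if k < N then \<Sum>l<N. hscale C (W (single l 1) k) (A (\<xi> l)) else 0)"
    by (rule ext) (simp add: F_def)
  ultimately show ?thesis
    using \<xi> by (simp add: R_eq)
qed

end

section \<open>Extension of positive functionals\<close>

text \<open>
  Partial functionals are treated through their graphs, which are subspaces of \<open>'w \<times> real\<close>, so that
  a maximal one is found by Zorn's lemma.  The values that a positive extension may take at \<open>v\<close> are those
  between the values at smaller and at larger vectors of its domain.  Such vectors exist for all \<open>v\<close> in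
  the span of \<open>P\<close>: the vectors \<open>v\<close> for which \<open>v\<close> and \<open>- v\<close> are dominated form a subspace, and \<open>P\<close> lies in
  it because \<open>0\<close> dominates \<open>- v\<close> for \<open>v\<close> in \<open>P\<close>.
\<close>

theorem positive_functional_extension:
  fixes P :: "'w::real_vector set" and \<Gamma>\<^sub>0 :: "('w \<times> real) set"
  assumes P_zero: "0 \<in> P"
    and P_add: "\<And>f g. \<lbrakk>f \<in> P; g \<in> P\<rbrakk> \<Longrightarrow> f + g \<in> P"
    and P_scale: "\<And>c f. \<lbrakk>0 \<le> c; f \<in> P\<rbrakk> \<Longrightarrow> c *\<^sub>R f \<in> P"
    and \<Gamma>\<^sub>0: "subspace \<Gamma>\<^sub>0"
    and pos: "\<And>f r. \<lbrakk>(f, r) \<in> \<Gamma>\<^sub>0; f \<in> P\<rbrakk> \<Longrightarrow> 0 \<le> r"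
    and dom\<^sub>0: "fst ` \<Gamma>\<^sub>0 \<subseteq> span P"
    and dominated_P: "\<And>v. v \<in> P \<Longrightarrow> \<exists>f r. (f, r) \<in> \<Gamma>\<^sub>0 \<and> f - v \<in> P"
  obtains L :: "'w \<Rightarrow> real"
  where "\<And>u v. \<lbrakk>u \<in> span P; v \<in> span P\<rbrakk> \<Longrightarrow> L (u + v) = L u + L v"
    and "\<And>c v. v \<in> span P \<Longrightarrow> L (c *\<^sub>R v) = c * L v"
    and "\<And>f r. (f, r) \<in> \<Gamma>\<^sub>0 \<Longrightarrow> L f = r"
    and "\<And>v. v \<in> P \<Longrightarrow> 0 \<le> L v"
proof -
  define V where "V = span P"
  have V: "subspace V" "fst ` \<Gamma>\<^sub>0 \<subseteq> V" "P \<subseteq> V"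
    using dom\<^sub>0 by (auto simp: V_def subspace_span intro: span_base)
  define dom where "dom v \<longleftrightarrow> (\<exists>f r. (f, r) \<in> \<Gamma>\<^sub>0 \<and> f - v \<in> P)" for v
  have dom_add: "dom (u + v)" if u: "dom u" and v: "dom v" for u v
  proof -
    obtain f r g s where "(f, r) \<in> \<Gamma>\<^sub>0" "f - u \<in> P" "(g, s) \<in> \<Gamma>\<^sub>0" "g - v \<in> P"
      using u v by (auto simp: dom_def)
    then show ?thesis
      using subspace_add[OF \<Gamma>\<^sub>0, of "(f, r)" "(g, s)"] P_add[of "f - u" "g - v"]
      unfolding dom_def by (intro exI[of _ "f + g"] exI[of _ "r + s"]) (simp add: add_diff_add)
  qed
  have dom_scale: "dom (c *\<^sub>R v)" if "dom v" "0 \<le> c" for c v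
  proof -
    obtain f r where "(f, r) \<in> \<Gamma>\<^sub>0" "f - v \<in> P"
      using \<open>dom v\<close> by (auto simp: dom_def)
    then show ?thesis
      using subspace_scale[OF \<Gamma>\<^sub>0, of "(f, r)" c] P_scale[OF \<open>0 \<le> c\<close>, of "f - v"]
      unfolding dom_def by (intro exI[of _ "c *\<^sub>R f"] exI[of _ "c * r"]) (simp add: scaleR_diff_right)
  qed
  have "subspace {v. dom v \<and> dom (- v)}"
    unfolding subspace_def
  proof (intro conjI ballI allI)
    show "0 \<in> {v. dom v \<and> dom (- v)}"
      using subspace_0[OF \<Gamma>\<^sub>0] P_zero unfolding dom_def zero_prod_def
      by (auto intro!: exI[of _ 0])
    fix u assume u: "u \<in> {v. dom v \<and> dom (- v)}"
    show "c *\<^sub>R u \<in> {v. dom v \<and> dom (- v)}" for c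
      using u dom_scale[of u c] dom_scale[of "- u" c] dom_scale[of u "- c"] dom_scale[of "- u" "- c"]
      by (cases "0 \<le> c") auto
    fix v assume "v \<in> {v. dom v \<and> dom (- v)}"
    then show "u + v \<in> {v. dom v \<and> dom (- v)}"
      using u dom_add[of u v] dom_add[of "- u" "- v"] by simp
  qed
  moreover have "dom v \<and> dom (- v)" if "v \<in> P" for v
    using that dominated_P[OF that] subspace_0[OF \<Gamma>\<^sub>0] unfolding dom_def zero_prod_def
    by (auto intro!: exI[of _ 0])
  ultimately have "V \<subseteq> {v. dom v \<and> dom (- v)}"
    unfolding V_def by (intro span_minimal) auto
  then have dominated: "\<exists>f r. (f, r) \<in> \<Gamma>\<^sub>0 \<and> f - v \<in> P" if "v \<in> V" for v
    using that by (auto simp: dom_def)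
  define \<A> where "\<A> = {\<Gamma>. subspace \<Gamma> \<and> \<Gamma>\<^sub>0 \<subseteq> \<Gamma> \<and> fst ` \<Gamma> \<subseteq> V \<and> (\<forall>f r. (f, r) \<in> \<Gamma> \<longrightarrow> f \<in> P \<longrightarrow> 0 \<le> r)}"
  have "\<exists>\<Gamma>\<in>\<A>. \<forall>\<Delta>\<in>\<A>. \<Gamma> \<subseteq> \<Delta> \<longrightarrow> \<Delta> = \<Gamma>"
  proof (rule subset_Zorn_nonempty)
    show "\<A> \<noteq> {}"
      using \<Gamma>\<^sub>0 pos V by (auto simp: \<A>_def)
    fix \<C> assume ne: "\<C> \<noteq> {}" and chain: "subset.chain \<A> \<C>"
    have mem: "subspace \<Gamma>" "\<Gamma>\<^sub>0 \<subseteq> \<Gamma>" "fst ` \<Gamma> \<subseteq> V"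
      "\<And>f r. \<lbrakk>(f, r) \<in> \<Gamma>; f \<in> P\<rbrakk> \<Longrightarrow> 0 \<le> r" if "\<Gamma> \<in> \<C>" for \<Gamma>
    proof -
      have "\<Gamma> \<in> \<A>"
        using chain that by (auto simp: subset.chain_def)
      then show "subspace \<Gamma>" "\<Gamma>\<^sub>0 \<subseteq> \<Gamma>" "fst ` \<Gamma> \<subseteq> V"
        "\<And>f r. \<lbrakk>(f, r) \<in> \<Gamma>; f \<in> P\<rbrakk> \<Longrightarrow> 0 \<le> r"
        by (simp_all add: \<A>_def)
    qed
    obtain \<Gamma>\<^sub>1 where \<Gamma>\<^sub>1: "\<Gamma>\<^sub>1 \<in> \<C>"
      using ne by blast
    have "subspace (\<Union>\<C>)"
      unfolding subspace_def
    proof (intro conjI ballI allI)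
      show "0 \<in> \<Union>\<C>"
        by (rule UnionI[OF \<Gamma>\<^sub>1 subspace_0[OF mem(1)[OF \<Gamma>\<^sub>1]]])
      fix x assume "x \<in> \<Union>\<C>"
      then obtain \<Gamma> where \<Gamma>: "\<Gamma> \<in> \<C>" "x \<in> \<Gamma>" by (rule UnionE)
      show "c *\<^sub>R x \<in> \<Union>\<C>" for c
        by (rule UnionI[OF \<Gamma>(1) subspace_scale[OF mem(1)[OF \<Gamma>(1)] \<Gamma>(2)]])
      fix y assume "y \<in> \<Union>\<C>"
      then obtain \<Delta> where \<Delta>: "\<Delta> \<in> \<C>" "y \<in> \<Delta>" by (rule UnionE)
      have "\<Gamma> \<subseteq> \<Delta> \<or> \<Delta> \<subseteq> \<Gamma>"
        using chain \<Gamma>(1) \<Delta>(1) by (auto simp: subset.chain_def)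
      then obtain \<Sigma> where \<Sigma>: "\<Sigma> \<in> \<C>" "x \<in> \<Sigma>" "y \<in> \<Sigma>"
        using \<Gamma> \<Delta> by blast
      show "x + y \<in> \<Union>\<C>"
        by (rule UnionI[OF \<Sigma>(1) subspace_add[OF mem(1)[OF \<Sigma>(1)] \<Sigma>(2,3)]])
    qed
    moreover have "\<Gamma>\<^sub>0 \<subseteq> \<Union>\<C>"
      using mem(2)[OF \<Gamma>\<^sub>1] \<Gamma>\<^sub>1 by blast
    moreover have "fst ` \<Union>\<C> \<subseteq> V"
      using mem(3) by blast
    moreover have "\<forall>f r. (f, r) \<in> \<Union>\<C> \<longrightarrow> f \<in> P \<longrightarrow> 0 \<le> r"
      using mem(4) by blast
    ultimately show "\<Union>\<C> \<in> \<A>"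
      by (simp add: \<A>_def)
  qed
  then obtain \<Gamma> where \<Gamma>: "\<Gamma> \<in> \<A>" and maximal: "\<And>\<Delta>. \<lbrakk>\<Delta> \<in> \<A>; \<Gamma> \<subseteq> \<Delta>\<rbrakk> \<Longrightarrow> \<Delta> = \<Gamma>"
    by blast
  have sub: "subspace \<Gamma>" and ext: "\<Gamma>\<^sub>0 \<subseteq> \<Gamma>" and dom\<Gamma>: "fst ` \<Gamma> \<subseteq> V"
    and \<Gamma>_pos: "\<And>f r. \<lbrakk>(f, r) \<in> \<Gamma>; f \<in> P\<rbrakk> \<Longrightarrow> 0 \<le> r"
    using \<Gamma> by (auto simp: \<A>_def)
  have \<Gamma>_add: "(f + g, r + s) \<in> \<Gamma>" if "(f, r) \<in> \<Gamma>" "(g, s) \<in> \<Gamma>" for f g r s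
    using subspace_add[OF sub that] by simp
  have \<Gamma>_scale: "(c *\<^sub>R f, c * r) \<in> \<Gamma>" if "(f, r) \<in> \<Gamma>" for c f r
    using subspace_scale[OF sub that, of c] by simp
  have \<Gamma>_diff: "(f - g, r - s) \<in> \<Gamma>" if "(f, r) \<in> \<Gamma>" "(g, s) \<in> \<Gamma>" for f g r s
    using subspace_diff[OF sub that] by simp
  have total: "\<exists>s. (v, s) \<in> \<Gamma>" if v: "v \<in> V" for v
  proof -
    \<comment> \<open>lower bounds for the value at \<open>v\<close>; their supremum is a possible value\<close>
    define A where "A = {r. \<exists>f. (f, r) \<in> \<Gamma> \<and> v - f \<in> P}"
    obtain g b where b: "(g, b) \<in> \<Gamma>" "g - v \<in> P"
      using dominated[OF v] ext by blast
    obtain h a where "(h, a) \<in> \<Gamma>\<^sub>0" "h - (- v) \<in> P"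
      using dominated[of "- v"] subspace_neg[OF V(1) v] by blast
    then have "- a \<in> A"
      using \<Gamma>_scale[of h a "-1"] ext by (auto simp: A_def add.commute intro!: exI[of _ "- h"])
    have le: "r \<le> s" if "r \<in> A" "(f, s) \<in> \<Gamma>" "f - v \<in> P" for r s f
    proof -
      obtain e where e: "(e, r) \<in> \<Gamma>" "v - e \<in> P"
        using \<open>r \<in> A\<close> by (auto simp: A_def)
      have "f - e \<in> P"
        using P_add[OF that(3) e(2)] by simp
      then show ?thesis
        using \<Gamma>_pos[OF \<Gamma>_diff[OF that(2) e(1)]] by simp
    qed
    define s where "s = Sup A"
    have upper: "r \<le> s" if "r \<in> A" for r
      unfolding s_def using that le[OF _ b] by (intro cSup_upper bdd_aboveI) auto
    have lower: "s \<le> r" if "(f, r) \<in> \<Gamma>" "f - v \<in> P" for f r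
      unfolding s_def using \<open>- a \<in> A\<close> le[OF _ that] by (intro cSup_least) auto
    define \<Delta> where "\<Delta> = span (insert (v, s) \<Gamma>)"
    have \<Delta>_elem: "\<exists>t f r. x = (f + t *\<^sub>R v, r + t * s) \<and> (f, r) \<in> \<Gamma>" if x: "x \<in> \<Delta>" for x
    proof -
      have "span \<Gamma> = \<Gamma>"
        using sub by (simp only: span_eq_iff)
      then obtain t where t: "x - t *\<^sub>R (v, s) \<in> \<Gamma>"
        using x unfolding \<Delta>_def span_insert by blast
      then show ?thesis
        by (intro exI[of _ t] exI[of _ "fst x - t *\<^sub>R v"] exI[of _ "snd x - t * s"])
          (auto simp: prod_eq_iff minus_prod_def)
    qed
    have "\<Delta> \<in> \<A>"
      unfolding \<A>_def
    proof (intro CollectI conjI allI impI)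
      show "subspace \<Delta>"
        by (simp add: \<Delta>_def subspace_span)
      show "\<Gamma>\<^sub>0 \<subseteq> \<Delta>"
        using ext span_superset[of "insert (v, s) \<Gamma>"] by (auto simp: \<Delta>_def)
      show "fst ` \<Delta> \<subseteq> V"
        using \<Delta>_elem dom\<Gamma> v V(1) by (fastforce intro: subspace_add subspace_scale)
      fix f' r' assume "(f', r') \<in> \<Delta>" and f'_P: "f' \<in> P"
      then obtain t f r where f': "f' = f + t *\<^sub>R v" and r': "r' = r + t * s" and f: "(f, r) \<in> \<Gamma>"
        using \<Delta>_elem by blast
      consider "t = 0" | "0 < t" | "t < 0"
        by linarith
      then show "0 \<le> r'"
      proof cases
        case 1
        then show ?thesis
          using \<Gamma>_pos[OF f] f'_P f' r' by simp
      next
        case 2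
        have "(1 / t) *\<^sub>R f' = v - (- 1 / t) *\<^sub>R f"
          using 2 by (simp add: f' scaleR_add_right)
        then have "v - (- 1 / t) *\<^sub>R f \<in> P"
          using P_scale[OF _ f'_P, of "1 / t"] 2 by simp
        then have "(- 1 / t) * r \<le> s"
          using \<Gamma>_scale[OF f, of "- 1 / t"] by (intro upper) (auto simp: A_def)
        then show ?thesis
          using 2 by (simp add: r' field_simps)
      next
        case 3
        have "(- 1 / t) *\<^sub>R f' = (- 1 / t) *\<^sub>R f - v"
          using 3 by (simp add: f' scaleR_add_right)
        then have "(- 1 / t) *\<^sub>R f - v \<in> P"
          using P_scale[OF _ f'_P, of "- 1 / t"] 3 by (simp add: divide_nonpos_neg)
        then have "s \<le> (- 1 / t) * r"
          using \<Gamma>_scale[OF f, of "- 1 / t"] by (intro lower)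
        then show ?thesis
          using 3 by (simp add: r' field_simps)
      qed
    qed
    moreover have "\<Gamma> \<subseteq> \<Delta>" "(v, s) \<in> \<Delta>"
      using span_superset[of "insert (v, s) \<Gamma>"] by (auto simp: \<Delta>_def)
    ultimately show ?thesis
      using maximal by blast
  qed
  have unique: "r = s" if "(f, r) \<in> \<Gamma>" "(f, s) \<in> \<Gamma>" for f r s
    using \<Gamma>_pos[OF \<Gamma>_diff[OF that]] \<Gamma>_pos[OF \<Gamma>_diff[OF that(2,1)]] P_zero by simp
  define L where "L v = (SOME r. (v, r) \<in> \<Gamma>)" for v
  have L: "(v, L v) \<in> \<Gamma>" if "v \<in> V" for v
    unfolding L_def using total[OF that] by (rule someI_ex)
  have L_eq: "L v = r" if "(v, r) \<in> \<Gamma>" for v r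
    using unique[OF L that] dom\<Gamma> that by force
  show ?thesis
  proof
    show "L (u + v) = L u + L v" if "u \<in> span P" "v \<in> span P" for u v
      using that unfolding V_def[symmetric] by (intro L_eq \<Gamma>_add L)
    show "L (c *\<^sub>R v) = c * L v" if "v \<in> span P" for c v
      using that unfolding V_def[symmetric] by (intro L_eq \<Gamma>_scale L)
    show "L f = r" if "(f, r) \<in> \<Gamma>\<^sub>0" for f r
      using that ext by (intro L_eq) auto
    show "0 \<le> L v" if "v \<in> P" for v
      using that V(3) \<Gamma>_pos[OF L] by blast
  qed
qed

instantiation "fun" :: (type, real_vector) real_vector
begin

definition "scaleR c f = (\<lambda>x. c *\<^sub>R f x)"

instance
  by standard (simp_all add: fun_eq_iff scaleR_fun_def scaleR_add_right scaleR_add_left)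

end

lemma scaleR_fun_apply [simp]: "(c *\<^sub>R f) x = c *\<^sub>R f x"
  by (simp add: scaleR_fun_def)

section \<open>Sesquilinear forms\<close>

text \<open>
  The finite rank operator \<open>\<Sum>\<^sub>k a\<^sub>k \<otimes> b\<^sub>k\<^sup>*\<close> determines \<open>\<Sum>\<^sub>k \<langle>A a\<^sub>k, b\<^sub>k\<rangle>\<close>, which is the trace of its
  product with \<open>A\<close>.  If the operator vanishes, evaluation at a nonzero \<open>b\<^sub>i\<close> expresses \<open>a\<^sub>i\<close> by the
  other \<open>a\<^sub>k\<close>, and both sums can be rewritten with one term less.
\<close>

lemma (in inner_product_space) finite_rank_trace_zero:
  assumes A: "A \<in> bounded_ops H H" and "finite K"
    and "\<And>k. k \<in> K \<Longrightarrow> a k \<in> carrier H" "\<And>k. k \<in> K \<Longrightarrow> b k \<in> carrier H"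
    and "\<And>x y. \<lbrakk>x \<in> carrier H; y \<in> carrier H\<rbrakk> \<Longrightarrow> (\<Sum>k\<in>K. hinner H (a k) x * hinner H y (b k)) = 0"
  shows "(\<Sum>k\<in>K. hinner H (A (a k)) (b k)) = 0"
  using assms(2-)
proof (induction K arbitrary: b rule: finite_induct)
  case (insert i K)
  interpret A: bounded_op H H A
    using A by unfold_locales
  have a: "a k \<in> carrier H" and b: "b k \<in> carrier H" if "k \<in> insert i K" for k
    using insert.prems that by auto
  have split: "hinner H (a i) x * hinner H y (b i) = - (\<Sum>k\<in>K. hinner H (a k) x * hinner H y (b k))"
    if "x \<in> carrier H" "y \<in> carrier H" for x y
    using insert.prems(3)[OF that] insert.hyps by (simp add: eq_neg_iff_add_eq_0)
  define N where "N = hinner H (b i) (b i)"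
  show ?case
  proof (cases "b i = 0")
    case True
    then have "(\<Sum>k\<in>K. hinner H (A (a k)) (b k)) = 0"
      using split a b by (intro insert.IH) auto
    then show ?thesis
      using insert.hyps True a[of i] by (simp add: A.closed)
  next
    case False
    then have N: "N \<noteq> 0"
      using inner_definite[of "b i"] b[of i] by (auto simp: N_def)
    define \<gamma> where "\<gamma> k = hinner H (b i) (b k) / N" for k
    have ai: "hinner H (a i) x = - (\<Sum>k\<in>K. \<gamma> k * hinner H (a k) x)" if "x \<in> carrier H" for x
    proof -
      have "N * hinner H (a i) x = - (\<Sum>k\<in>K. hinner H (a k) x * hinner H (b i) (b k))"
        using split[OF that b[of i]] by (simp add: N_def mult.commute)
      also have "\<dots> = N * - (\<Sum>k\<in>K. \<gamma> k * hinner H (a k) x)"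
        using N by (simp add: \<gamma>_def sum_distrib_left mult.commute)
      finally show ?thesis
        by (simp only: mult_left_cancel[OF N])
    qed
    have ai_eq: "a i = (\<Sum>k\<in>K. hscale H (- \<gamma> k) (a k))"
    proof (rule eqI_Re_inner)
      show sum: "(\<Sum>k\<in>K. hscale H (- \<gamma> k) (a k)) \<in> carrier H"
        using a by (intro sum_closed scale_closed) auto
      fix x assume x: "x \<in> carrier H"
      have "hinner H (\<Sum>k\<in>K. hscale H (- \<gamma> k) (a k)) x = (\<Sum>k\<in>K. hinner H (hscale H (- \<gamma> k) (a k)) x)"
        using a x by (intro inner_sum_left scale_closed) auto
      also have "\<dots> = hinner H (a i) x"
        using a x by (simp add: ai inner_scale_left sum_negf)
      finally show "Re (hinner H (a i) x) = Re (hinner H (\<Sum>k\<in>K. hscale H (- \<gamma> k) (a k)) x)"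
        by simp
    qed (use a in auto)
    define b' where "b' k = b k - hscale H (cnj (\<gamma> k)) (b i)" for k
    have b': "b' k \<in> carrier H" if "k \<in> K" for k
      using that b by (auto simp: b'_def closed)
    have "(\<Sum>k\<in>K. hinner H (A (a k)) (b' k)) = 0"
    proof (rule insert.IH)
      fix x y assume xy: "x \<in> carrier H" "y \<in> carrier H"
      have "(\<Sum>k\<in>K. hinner H (a k) x * hinner H y (b' k))
          = (\<Sum>k\<in>K. hinner H (a k) x * hinner H y (b k) - \<gamma> k * hinner H (a k) x * hinner H y (b i))"
        using xy b by (intro sum.cong refl) (simp add: b'_def inner_simps closed algebra_simps)
      also have "\<dots> = - (hinner H (a i) x * hinner H y (b i)) + hinner H (a i) x * hinner H y (b i)"
        using split[OF xy] by (simp add: sum_subtractf ai[OF xy(1)] flip: sum_distrib_right)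
      finally show "(\<Sum>k\<in>K. hinner H (a k) x * hinner H y (b' k)) = 0"
        by simp
    qed (use a b' in auto)
    moreover have "hinner H (A (a i)) (b i) = - (\<Sum>k\<in>K. \<gamma> k * hinner H (A (a k)) (b i))"
    proof -
      have "A (a i) = (\<Sum>k\<in>K. A (hscale H (- \<gamma> k) (a k)))"
        unfolding ai_eq by (intro A.sum scale_closed a) auto
      also have "\<dots> = (\<Sum>k\<in>K. hscale H (- \<gamma> k) (A (a k)))"
        using a by (intro sum.cong refl A.scale) auto
      finally have "hinner H (A (a i)) (b i) = (\<Sum>k\<in>K. hinner H (hscale H (- \<gamma> k) (A (a k))) (b i))"
        using a b by (simp only:) (intro inner_sum_left scale_closed A.closed; simp)
      then show ?thesis
        using a b by (simp add: inner_scale_left A.closed sum_negf)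
    qed
    moreover have "(\<Sum>k\<in>K. hinner H (A (a k)) (b' k))
        = (\<Sum>k\<in>K. hinner H (A (a k)) (b k)) - (\<Sum>k\<in>K. \<gamma> k * hinner H (A (a k)) (b i))"
      unfolding sum_subtractf[symmetric]
      using a b by (intro sum.cong refl) (simp add: b'_def inner_simps closed A.closed)
    ultimately show ?thesis
      using insert.hyps by simp
  qed
qed simp

text \<open>
  The diagonal of \<open>x + y\<close> gives \<open>h x y + h y x = 0\<close>, and replacing \<open>x\<close> by \<open>\<i> x\<close> gives \<open>h x y = h y x\<close>.
\<close>

lemma (in inner_product_space) sesquilinear_zero:
  fixes h :: "'a \<Rightarrow> 'a \<Rightarrow> complex"
  assumes add1: "\<And>x y z. \<lbrakk>x \<in> carrier H; y \<in> carrier H; z \<in> carrier H\<rbrakk> \<Longrightarrow> h (x + y) z = h x z + h y z"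
    and add2: "\<And>x y z. \<lbrakk>x \<in> carrier H; y \<in> carrier H; z \<in> carrier H\<rbrakk> \<Longrightarrow> h z (x + y) = h z x + h z y"
    and scale1: "\<And>x y. \<lbrakk>x \<in> carrier H; y \<in> carrier H\<rbrakk> \<Longrightarrow> h (hscale H \<i> x) y = - \<i> * h x y"
    and scale2: "\<And>x y. \<lbrakk>x \<in> carrier H; y \<in> carrier H\<rbrakk> \<Longrightarrow> h x (hscale H \<i> y) = \<i> * h x y"
    and diag: "\<And>x. x \<in> carrier H \<Longrightarrow> h x x = 0"
    and xy: "x \<in> carrier H" "y \<in> carrier H"
  shows "h x y = 0"
proof -
  have skew: "h u v + h v u = 0" if "u \<in> carrier H" "v \<in> carrier H" for u v
    using diag[of "u + v"] diag[of u] diag[of v] that by (simp add: add1 add2 closed add.commute)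
  have "- \<i> * h x y + \<i> * h y x = 0"
    using skew[of "hscale H \<i> x" y] xy by (simp add: scale1 scale2 closed)
  then have "\<i> * h y x = \<i> * h x y"
    by simp
  then have "h y x = h x y"
    by simp
  then show ?thesis
    using skew[OF xy] by simp
qed

text \<open>
  The real part of a bounded positive hermitian form.  A symmetric real bilinear form arises in this way if
  multiplication of both arguments by \<open>\<i>\<close> leaves it unchanged.
\<close>

locale bounded_positive_form = hilbert_space H for H :: "'a::ab_group_add hspace" +
  fixes b :: "'a \<Rightarrow> 'a \<Rightarrow> real" and M :: real
  assumes b_add: "\<And>x y z. \<lbrakk>x \<in> carrier H; y \<in> carrier H; z \<in> carrier H\<rbrakk> \<Longrightarrow> b (x + y) z = b x z + b y z"
    and b_scale: "\<And>c x y. \<lbrakk>x \<in> carrier H; y \<in> carrier H\<rbrakk> \<Longrightarrow> b (hscale H (complex_of_real c) x) y = c * b x y"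
    and b_sym: "\<And>x y. \<lbrakk>x \<in> carrier H; y \<in> carrier H\<rbrakk> \<Longrightarrow> b x y = b y x"
    and b_i: "\<And>x y. \<lbrakk>x \<in> carrier H; y \<in> carrier H\<rbrakk> \<Longrightarrow> b (hscale H \<i> x) (hscale H \<i> y) = b x y"
    and b_pos: "\<And>x. x \<in> carrier H \<Longrightarrow> 0 \<le> b x x"
    and b_bound: "\<And>x. x \<in> carrier H \<Longrightarrow> b x x \<le> M * (hnorm H x)\<^sup>2"

text \<open>
  A bounded positive hermitian form with the real part \<open>b\<close> is \<open>\<langle>R x, R y\<rangle>\<close> for the square root
  \<open>R\<close> of the operator that represents it.
\<close>

theorem (in bounded_positive_form) factorization:
  "\<exists>R. adjoint_pair H H R R \<and>
    (\<forall>x\<in>carrier H. \<forall>y\<in>carrier H. Re (hinner H (R x) (R y)) = b x y)"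
proof -
  have add2: "b z (x + y) = b z x + b z y" if "x \<in> carrier H" "y \<in> carrier H" "z \<in> carrier H" for x y z
    using b_add[OF that] b_sym[of z] that by (simp add: closed)
  have scale2: "b x (hscale H (complex_of_real c) y) = c * b x y"
    if "x \<in> carrier H" "y \<in> carrier H" for c x y
    using b_scale[of y x c] b_sym[of x] that by (simp add: closed)
  have zero: "b 0 y = 0" "b y 0 = 0" if "y \<in> carrier H" for y
    using b_add[of 0 0 y] add2[of 0 0 y] that by (simp_all add: closed)
  have le: "b x y \<le> M * (hnorm H x * hnorm H y)" if x: "x \<in> carrier H" and y: "y \<in> carrier H" for x y
  proof (cases "x = 0 \<or> y = 0")
    case True
    then show ?thesis
      using x y zero by auto
  next
    case False
    define \<alpha> \<beta> where "\<alpha> = hnorm H x" and "\<beta> = hnorm H y"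
    have pos: "0 < \<alpha>" "0 < \<beta>"
      using False x y hnorm_nonneg[of x] hnorm_nonneg[of y] hnorm_eq_0_iff[of x] hnorm_eq_0_iff[of y]
      by (auto simp: \<alpha>_def \<beta>_def less_le)
    \<comment> \<open>Cauchy-Schwarz, from positivity at \<open>\<beta> x - \<alpha> y\<close>\<close>
    define u v where "u = hscale H (complex_of_real \<beta>) x" and "v = hscale H (complex_of_real (- \<alpha>)) y"
    have uv: "u \<in> carrier H" "v \<in> carrier H"
      using x y by (simp_all only: u_def v_def closed)
    have "b (u + v) (u + v) = b u u + 2 * b u v + b v v"
      using uv b_sym[of v u] by (simp add: b_add add2 closed)
    then have "0 \<le> b u u + 2 * b u v + b v v"
      using b_pos[of "u + v"] uv by (simp add: closed)
    moreover have "b u u = \<beta>\<^sup>2 * b x x" "b v v = \<alpha>\<^sup>2 * b y y" "b u v = - (\<alpha> * \<beta> * b x y)"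
      unfolding u_def v_def using x y by (simp_all only: b_scale scale2 closed)
        (simp_all add: power2_eq_square)
    moreover have "\<beta>\<^sup>2 * b x x \<le> \<beta>\<^sup>2 * (M * \<alpha>\<^sup>2)" "\<alpha>\<^sup>2 * b y y \<le> \<alpha>\<^sup>2 * (M * \<beta>\<^sup>2)"
      using b_bound[OF x] b_bound[OF y] by (simp_all add: \<alpha>_def \<beta>_def mult_left_mono)
    ultimately have "(\<alpha> * \<beta>) * b x y \<le> (\<alpha> * \<beta>) * (M * (\<alpha> * \<beta>))"
      by (simp add: power2_eq_square mult_ac)
    then show ?thesis
      using pos by (simp add: \<alpha>_def \<beta>_def)
  qed
  have abs_le: "\<bar>b x y\<bar> \<le> M * hnorm H x * hnorm H y" if "x \<in> carrier H" "y \<in> carrier H" for x y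
    using le[OF that] le[of "hscale H (complex_of_real (-1)) x" y] b_scale[of x y "-1"] that
    by (simp add: closed hnorm_scale abs_le_iff mult.assoc)
  have "\<exists>g. g \<in> carrier H \<and> (\<forall>y\<in>carrier H. Re (hinner H g y) = b x y)" if x: "x \<in> carrier H" for x
    by (rule riesz_representation_Re[of "b x" "M * hnorm H x"])
      (use x in \<open>auto simp: add2 scale2 abs_le\<close>)
  then obtain G where G_closed: "\<And>x. x \<in> carrier H \<Longrightarrow> G x \<in> carrier H"
    and G: "\<And>x y. \<lbrakk>x \<in> carrier H; y \<in> carrier H\<rbrakk> \<Longrightarrow> Re (hinner H (G x) y) = b x y"
    by metis
  have G_add: "G (x + y) = G x + G y" if "x \<in> carrier H" "y \<in> carrier H" for x y
    using that by (intro eqI_Re_inner) (auto simp: closed G_closed G inner_add_left b_add)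
  have scale_i: "b (hscale H \<i> x) y = - b x (hscale H \<i> y)" if "x \<in> carrier H" "y \<in> carrier H" for x y
  proof -
    have "b (hscale H \<i> x) y = b (hscale H \<i> (hscale H \<i> x)) (hscale H \<i> y)"
      using that by (simp add: b_i closed)
    also have "hscale H \<i> (hscale H \<i> x) = hscale H (complex_of_real (-1)) x"
      using that by (simp add: scale_scale)
    finally show ?thesis
      using that b_scale[of x "hscale H \<i> y" "-1"] by (simp add: closed)
  qed
  have G_scale: "G (hscale H c x) = hscale H c (G x)" if x: "x \<in> carrier H" for c x
  proof (rule eqI_Re_inner)
    fix y assume y: "y \<in> carrier H"
    have "hscale H c x = hscale H (complex_of_real (Re c)) x
        + hscale H (complex_of_real (Im c)) (hscale H \<i> x)"
      using x by (simp add: scale_scale flip: scale_add_left) (metis complex_eq mult.commute)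
    then have "b (hscale H c x) y = Re c * b x y - Im c * b x (hscale H \<i> y)"
      using x y by (simp add: b_add b_scale scale_i closed)
    also have "b x (hscale H \<i> y) = Im (hinner H (G x) y)"
      using G[of x "hscale H \<i> y"] x y by (simp add: closed G_closed inner_scale_right)
    finally show "Re (hinner H (G (hscale H c x)) y) = Re (hinner H (hscale H c (G x)) y)"
      using x y by (simp add: G closed G_closed inner_scale_left)
  qed (use x in \<open>auto simp: closed G_closed\<close>)
  define G' where "G' = restrict G (carrier H)"
  have "G' \<in> bounded_ops H H"
    unfolding G'_def
  proof (rule bounded_opsI)
    fix x assume x: "x \<in> carrier H"
    have "(hnorm H (G x))\<^sup>2 \<le> M * hnorm H x * hnorm H (G x)"
      using abs_le[OF x G_closed[OF x]] G[OF x G_closed[OF x]] x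
      by (simp add: Re_inner_self G_closed)
    then have "hnorm H (G x) * hnorm H (G x) \<le> M * hnorm H x * hnorm H (G x)"
      by (simp add: power2_eq_square)
    moreover have "0 \<le> M * hnorm H x"
    proof (cases "hnorm H x = 0")
      case False
      then have "0 < (hnorm H x)\<^sup>2"
        by simp
      then have "0 \<le> M"
        using b_pos[OF x] b_bound[OF x] zero_le_mult_iff[of M "(hnorm H x)\<^sup>2"] by auto
      then show ?thesis
        using x by (simp add: hnorm_nonneg)
    qed simp
    ultimately show "hnorm H (G x) \<le> M * hnorm H x"
      using hnorm_nonneg[OF G_closed[OF x]] by (cases "hnorm H (G x) = 0") (auto simp: mult_le_cancel_right)
  qed (auto simp: G_closed G_add G_scale inner_product_space_axioms)
  moreover have "Re (hinner H (G' x) y) = Re (hinner H x (G' y))"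
    if "x \<in> carrier H" "y \<in> carrier H" for x y
    using that G[of y x] b_sym[of x y] Re_inner_commute[of x "G y"] by (simp add: G'_def G G_closed)
  ultimately obtain R where R: "adjoint_pair H H R R" and RR: "\<And>x. x \<in> carrier H \<Longrightarrow> R (R x) = G' x"
    using positive_op_square_root[of G'] b_pos by (auto simp: G'_def G)
  have "Re (hinner H (R x) (R y)) = b x y" if xy: "x \<in> carrier H" "y \<in> carrier H" for x y
  proof -
    have "R x \<in> carrier H"
      using R xy unfolding adjoint_pair_def bounded_ops_def by blast
    then have "hinner H (R (R x)) y = hinner H (R x) (R y)"
      using R xy by (simp add: adjoint_pair_def)
    then show ?thesis
      using G[OF xy] RR[OF xy(1)] xy by (simp add: G'_def)
  qed
  then show ?thesis
    using R by blast
qed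

section \<open>Toeplitz forms on a ball of the free group\<close>

locale operator_polynomial = C: hilbert_space C
  for C :: "'c::ab_group_add hspace" +
  fixes m :: nat and p :: "word \<Rightarrow> 'c \<Rightarrow> 'c"
  assumes p: "p \<in> polynomials m C C"
begin

abbreviation F where "F \<equiv> free_group m"

sublocale F: group F
  by (rule group_free_group)

text \<open>
  The words allowed in the factor \<open>q\<close>.  They contain the support of \<open>p\<close>, their own inverses and all their
  suffixes.
\<close>

definition S where "S = {s \<in> words m. length s \<le> poly_deg m C p}"

definition factor_pairs where
  "factor_pairs w = {(s, t). s \<in> S \<and> t \<in> S \<and> inv\<^bsub>F\<^esub> s \<otimes>\<^bsub>F\<^esub> t = w}"

abbreviation D where "D \<equiv> hpow S C"

lemma S_words: "s \<in> S \<Longrightarrow> s \<in> words m"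
  by (simp add: S_def)

lemma finite_S: "finite S"
proof (rule finite_subset)
  show "S \<subseteq> {w. set w \<subseteq> {..<m} \<times> UNIV \<and> length w \<le> poly_deg m C p}"
    by (force simp: S_def free_group_def)
qed (intro finite_lists_length_le finite_cartesian_product finite_lessThan finite)

lemma one_F: "\<one>\<^bsub>F\<^esub> = []"
  by (simp add: free_group_def)

lemma Nil_in_S: "[] \<in> S"
  by (simp add: S_def free_group_def)

lemma inv_in_S: "s \<in> S \<Longrightarrow> inv\<^bsub>F\<^esub> s \<in> S"
  by (simp add: S_def free_group_inv inv_word_closed)

lemma inv_in_S_iff: "s \<in> words m \<Longrightarrow> inv\<^bsub>F\<^esub> s \<in> S \<longleftrightarrow> s \<in> S"
  using inv_in_S[of s] inv_in_S[of "inv\<^bsub>F\<^esub> s"] by auto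

lemma p_bounded: "w \<in> words m \<Longrightarrow> p w \<in> bounded_ops C C"
  using p by (auto simp: polynomials_def)

lemma finite_supp: "finite (poly_supp m C p)"
  using p by (simp add: polynomials_def)

lemma supp_subset_S: "poly_supp m C p \<subseteq> S"
  using finite_supp by (auto simp: S_def poly_supp_def poly_deg_def intro!: Max_ge)

lemma p_outside: "\<lbrakk>w \<in> words m; w \<notin> poly_supp m C p; x \<in> carrier C\<rbrakk> \<Longrightarrow> p w x = 0"
  by (simp add: poly_supp_def zero_op_def)

lemma finite_factor_pairs: "finite (factor_pairs w)"
  by (rule finite_subset[of _ "S \<times> S"]) (auto simp: factor_pairs_def finite_S)

sublocale D: hilbert_space D
  by (intro hilbert_space_hpow finite_S C.hilbert_space_axioms)

lemma single_closed: "\<lbrakk>s \<in> S; x \<in> carrier C\<rbrakk> \<Longrightarrow> single s x \<in> carrier D"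
  by (simp add: in_carrier_hpow C.zero_closed)

lemma comp_closed: "\<lbrakk>\<xi> \<in> carrier D; s \<in> S\<rbrakk> \<Longrightarrow> \<xi> s \<in> carrier C"
  by (simp add: in_carrier_hpow)

lemma hinner_single_left:
  assumes "s \<in> S" "\<xi> \<in> carrier D"
  shows "hinner D (single s x) \<xi> = hinner C x (\<xi> s)"
proof -
  have "hinner D (single s x) \<xi> = (\<Sum>i\<in>S. if i = s then hinner C x (\<xi> s) else 0)"
    unfolding hinner_hpow using assms by (intro sum.cong refl) (auto simp: comp_closed)
  then show ?thesis
    using assms finite_S by simp
qed

lemma hinner_single_right:
  assumes "s \<in> S" "\<xi> \<in> carrier D"
  shows "hinner D \<xi> (single s x) = hinner C (\<xi> s) x"
proof -
  have "hinner D \<xi> (single s x) = (\<Sum>i\<in>S. if i = s then hinner C (\<xi> s) x else 0)"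
    unfolding hinner_hpow using assms by (intro sum.cong refl) (auto simp: comp_closed)
  then show ?thesis
    using assms finite_S by simp
qed

text \<open>
  A finite rank hermitian operator on \<open>D\<close> is represented by its quadratic form, and \<open>rank_one u v\<close> is the form of
  the real part of \<open>u \<otimes> v\<^sup>*\<close>.  The value \<open>0\<close> off the carrier makes equality of forms equality of functions.
\<close>

definition rank_one :: "(word \<Rightarrow> 'c) \<Rightarrow> (word \<Rightarrow> 'c) \<Rightarrow> (word \<Rightarrow> 'c) \<Rightarrow> real" where
  "rank_one u v \<xi> = (if \<xi> \<in> carrier D then Re (hinner D u \<xi> * cnj (hinner D v \<xi>)) else 0)"

text \<open>
  The form of the real part of the block matrix with the same rank one block at all positions with
  \<open>s\<^sup>-\<^sup>1 t = w\<close> and zero elsewhere.  Such matrices span the finite rank hermitian Toeplitz matrices.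
\<close>

definition toeplitz :: "word \<Rightarrow> 'c \<Rightarrow> 'c \<Rightarrow> (word \<Rightarrow> 'c) \<Rightarrow> real" where
  "toeplitz w x y = (\<Sum>(s, t)\<in>factor_pairs w. rank_one (single t x) (single s y))"

definition squares :: "((word \<Rightarrow> 'c) \<Rightarrow> real) set" where
  "squares = {sum_list (map (\<lambda>v. rank_one v v) vs) | vs. set vs \<subseteq> carrier D}"

lemma toeplitz_apply:
  assumes "\<xi> \<in> carrier D"
  shows "toeplitz w x y \<xi>
    = (\<Sum>(s, t)\<in>factor_pairs w. Re (hinner C x (\<xi> t) * cnj (hinner C y (\<xi> s))))"
  unfolding toeplitz_def sum_fun_apply using assms
  by (intro sum.cong refl) (auto simp: rank_one_def factor_pairs_def hinner_single_left)

subsection \<open>Evaluation of the polynomial at unitaries that realise a Toeplitz Gram matrix\<close>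

lemma cons_cancel_reduced: "reduced_word (a # w) \<Longrightarrow> cons_cancel a w = a # w"
  by (cases w) auto

text \<open>
  Let \<open>V t x = (\<langle>v k t, x\<rangle>)\<^sub>k\<close> in \<open>\<complex>\<^sup>N\<close>.  By hypothesis the inner product of \<open>V t x\<close> and \<open>V s y\<close> depends
  on \<open>s\<^sup>-\<^sup>1 t\<close> only, so \<open>V t x \<mapsto> V (a t) x\<close> preserves Gram matrices for each generator \<open>a\<close> and is
  induced by a unitary.  As the ball contains all suffixes of its words, the word operators take
  \<open>V [] x\<close> to \<open>V w x\<close>, and \<open>p\<close> evaluated at these unitaries has the given quadratic form at
  the vector \<open>\<Sum>\<^sub>k v k [] \<otimes> e\<^sub>k\<close>.
\<close>

lemma positive_at_toeplitz_family:
  fixes v :: "nat \<Rightarrow> word \<Rightarrow> 'c" and K :: "word \<Rightarrow> 'c \<Rightarrow> 'c \<Rightarrow> complex"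
  assumes pos: "positive_poly m C p"
    and v: "\<And>k. k < N \<Longrightarrow> v k \<in> carrier D"
    and gram: "\<And>s t x y. \<lbrakk>s \<in> S; t \<in> S; x \<in> carrier C; y \<in> carrier C\<rbrakk> \<Longrightarrow>
      (\<Sum>k<N. hinner C (v k t) x * cnj (hinner C (v k s) y)) = K (inv\<^bsub>F\<^esub> s \<otimes>\<^bsub>F\<^esub> t) x y"
  shows "(\<Sum>w\<in>poly_supp m C p. \<Sum>k<N. hinner C (p w (v k w)) (v k [])) \<in> \<real>\<^sub>\<ge>\<^sub>0"
proof -
  interpret T: tuple_tensor_product C N ..
  have v_closed: "v k s \<in> carrier C" if "k < N" "s \<in> S" for k s
    using comp_closed[OF v that(2)] that(1) .
  define V where "V t x = (\<lambda>k. if k < N then hinner C (v k t) x else 0)" for t x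
  have V: "V t x \<in> carrier T.X" for t x
    by (simp add: V_def in_carrier_hpow)
  have V_inner: "hinner T.X (V t x) (V s y) = K (inv\<^bsub>F\<^esub> s \<otimes>\<^bsub>F\<^esub> t) x y"
    if "s \<in> S" "t \<in> S" "x \<in> carrier C" "y \<in> carrier C" for s t x y
    using gram[OF that] by (simp add: hinner_hpow V_def)
  \<comment> \<open>finitely many \<open>x\<close> suffice to recognise the vectors \<open>v k w\<close>, which lie in the span of \<open>Y\<close>\<close>
  define Y where "Y = (\<lambda>(k, s). v k s) ` ({..<N} \<times> S)"
  have Y: "finite Y" "Y \<subseteq> carrier C"
    using finite_S v_closed by (auto simp: Y_def)
  have "\<exists>U U'. i < m \<longrightarrow> unitary_pair T.X U U' \<and> (\<forall>t\<in>S. \<forall>x\<in>Y.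
      cons_cancel (i, False) t \<in> S \<longrightarrow> U (V t x) = V (cons_cancel (i, False) t) x)" for i
  proof (cases "i < m")
    case True
    define g :: word where "g = [(i, False)]"
    have g: "g \<in> words m"
      using True by (simp add: g_def free_group_def)
    have g_mult: "cons_cancel (i, False) t = g \<otimes>\<^bsub>F\<^esub> t" for t
      by (simp add: g_def free_group_def)
    define I where "I = {(t, x). t \<in> S \<and> x \<in> Y \<and> cons_cancel (i, False) t \<in> S}"
    have fin: "finite I"
      using finite_S Y(1) by (intro finite_subset[of I "S \<times> Y"]) (auto simp: I_def)
    have I_gram: "hinner T.X (case a of (t, x) \<Rightarrow> V t x) (case b of (t, x) \<Rightarrow> V t x)
        = hinner T.X (case a of (t, x) \<Rightarrow> V (cons_cancel (i, False) t) x)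
            (case b of (t, x) \<Rightarrow> V (cons_cancel (i, False) t) x)"
      if "a \<in> I" "b \<in> I" for a b
    proof -
      obtain t x s y where ab: "a = (t, x)" "b = (s, y)"
        by (cases a, cases b) auto
      have mem: "t \<in> S" "s \<in> S" "x \<in> carrier C" "y \<in> carrier C"
        "cons_cancel (i, False) t \<in> S" "cons_cancel (i, False) s \<in> S"
        using that Y(2) by (auto simp: I_def ab)
      have "inv\<^bsub>F\<^esub> (g \<otimes>\<^bsub>F\<^esub> s) \<otimes>\<^bsub>F\<^esub> (g \<otimes>\<^bsub>F\<^esub> t)
          = inv\<^bsub>F\<^esub> s \<otimes>\<^bsub>F\<^esub> (inv\<^bsub>F\<^esub> g \<otimes>\<^bsub>F\<^esub> (g \<otimes>\<^bsub>F\<^esub> t))"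
        using g mem S_words by (simp add: F.inv_mult_group F.m_assoc)
      also have "\<dots> = inv\<^bsub>F\<^esub> s \<otimes>\<^bsub>F\<^esub> t"
        using g mem S_words by (simp add: F.inv_solve_left')
      finally show ?thesis
        using V_inner[OF mem(2,1,3,4)] V_inner[OF mem(6,5,3,4)] by (simp add: ab g_mult)
    qed
    obtain U U' where "unitary_pair T.X U U'" "\<And>a. a \<in> I \<Longrightarrow>
        U (case a of (t, x) \<Rightarrow> V t x) = (case a of (t, x) \<Rightarrow> V (cons_cancel (i, False) t) x)"
      by (rule T.X.unitary_extension[OF fin _ _ I_gram]) (auto simp: V split: prod.splits)
    moreover from this(2)[of "(_, _)"] have "\<forall>t\<in>S. \<forall>x\<in>Y. cons_cancel (i, False) t \<in> S \<longrightarrow>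
        U (V t x) = V (cons_cancel (i, False) t) x"
      by (simp add: I_def)
    ultimately show ?thesis
      by blast
  qed auto
  then obtain U U' where UU': "\<And>i. i < m \<Longrightarrow> unitary_pair T.X (U i) (U' i)"
    and U: "\<And>i t x. \<lbrakk>i < m; t \<in> S; x \<in> Y; cons_cancel (i, False) t \<in> S\<rbrakk>
      \<Longrightarrow> U i (V t x) = V (cons_cancel (i, False) t) x"
    by metis
  have letter_bounded: "letter_op T.X U a \<in> bounded_ops T.X T.X" if "fst a < m" for a
    using UU'[OF that] T.X.adj_op_unitary_pair[OF UU'[OF that]]
    by (cases a) (auto simp: unitary_pair_def adjoint_pair_def)
  have word_op_Cons: "word_op T.X U (a # w) = compose (carrier T.X) (letter_op T.X U a) (word_op T.X U w)"
    for a w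
    by (simp add: word_op_def)
  have word_bounded: "word_op T.X U w \<in> bounded_ops T.X T.X" if "fst ` set w \<subseteq> {..<m}" for w
    using that
  proof (induction w)
    case Nil
    then show ?case
      using id_op_bounded[OF T.X.inner_product_space_axioms] by (simp add: word_op_def)
  next
    case (Cons a w)
    then show ?case
      unfolding word_op_Cons
      by (intro bounded_ops_compose[of T.X T.X T.X] letter_bounded
          T.X.inner_product_space_axioms) simp_all
  qed
  have word_V: "word_op T.X U w (V [] x) = V w x" if "w \<in> S" "x \<in> Y" for w x
    using that(1)
  proof (induction w)
    case Nil
    then show ?case
      using V by (simp add: word_op_def id_op_def)
  next
    case (Cons a w)
    obtain i b where a: "a = (i, b)"
      by (cases a)
    have aw: "i < m" "reduced_word (a # w)"
      using Cons.prems by (auto simp: S_def free_group_def a)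
    have w: "w \<in> S"
      using Cons.prems by (auto simp: S_def free_group_def successively_Cons)
    have "letter_op T.X U a (V w x) = V (a # w) x"
    proof (cases b)
      case False
      then have "cons_cancel (i, False) w = a # w"
        using cons_cancel_reduced[OF aw(2)] by (simp add: a)
      then show ?thesis
        using U[OF aw(1) w \<open>x \<in> Y\<close>] Cons.prems False by (simp add: a)
    next
      case True
      then have "U i (V (a # w) x) = V w x"
        using U[OF aw(1) Cons.prems \<open>x \<in> Y\<close>] w by (simp add: a)
      moreover have "U' i (U i (V (a # w) x)) = V (a # w) x"
        using UU'[OF aw(1)] V by (simp add: unitary_pair_def)
      ultimately show ?thesis
        using True T.X.adj_op_unitary_pair[OF UU'[OF aw(1)]] by (simp add: a)
    qed
    then show ?case
      using Cons.IH[OF w] V by (simp add: word_op_Cons compose_eq)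
  qed
  have word_v: "(\<Sum>l<N. hscale C (word_op T.X U w (single l 1) k) (v l [])) = v k w"
    if w: "w \<in> S" and k: "k < N" for w k
  proof -
    define W where "W = word_op T.X U w"
    have W: "W \<in> bounded_ops T.X T.X"
      unfolding W_def using w by (intro word_bounded) (simp add: S_def free_group_def)
    define u where "u = (\<Sum>l<N. hscale C (W (single l 1) k) (v l []))"
    have terms: "hscale C (W (single l 1) k) (v l []) \<in> carrier C" if "l < N" for l
      using that by (intro C.scale_closed v_closed Nil_in_S)
    have u: "u \<in> carrier C"
      unfolding u_def using terms by (intro C.sum_closed) simp
    have u_inner: "hinner C u x = (\<Sum>l<N. W (single l 1) k * hinner C (v l []) x)"
      if x: "x \<in> carrier C" for x
    proof -
      have "hinner C u x = (\<Sum>l<N. hinner C (hscale C (W (single l 1) k) (v l [])) x)"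
        unfolding u_def using terms x by (intro C.inner_sum_left) auto
      then show ?thesis
        using x v_closed[OF _ Nil_in_S] by (simp add: C.inner_scale_left)
    qed
    have zero: "hinner C (u - v k w) x = 0" if x: "x \<in> Y" for x
    proof -
      have "hinner C u x = W (V [] x) k"
        using complex_tuples_matrix[OF W V k, of "[]" x] x Y(2) u_inner[of x]
        by (auto simp: V_def mult.commute)
      also have "\<dots> = hinner C (v k w) x"
        using word_V[OF w x] k by (simp add: W_def V_def)
      finally show ?thesis
        using x Y(2) u v_closed[OF k w] by (auto simp: C.inner_diff_left)
    qed
    define d where "d = u - v k w"
    have d: "d \<in> carrier C"
      using u v_closed[OF k w] by (simp add: d_def C.closed)
    have in_Y: "v l s \<in> Y" if "l < N" "s \<in> S" for l s
      using that by (auto simp: Y_def)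
    have "hinner C d u = (\<Sum>l<N. hinner C d (hscale C (W (single l 1) k) (v l [])))"
      unfolding u_def using terms d by (intro C.inner_sum_right) auto
    also have "\<dots> = 0"
    proof (rule sum.neutral, rule ballI)
      fix l assume "l \<in> {..<N}"
      then show "hinner C d (hscale C (W (single l 1) k) (v l [])) = 0"
        using d v_closed[OF _ Nil_in_S] zero[OF in_Y[OF _ Nil_in_S]]
        by (simp add: C.inner_scale_right d_def)
    qed
    finally have "hinner C d d = 0"
      using zero[OF in_Y[OF k w]] u v_closed[OF k w] d by (simp add: d_def C.inner_diff_right)
    then show ?thesis
      using C.inner_definite[OF d] by (simp add: d_def u_def W_def)
  qed
  define \<xi> where "\<xi> k = (if k < N then v k [] else 0)" for k
  have \<xi>: "\<xi> \<in> carrier T.tup"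
    using v_closed[OF _ Nil_in_S] by (simp add: in_carrier_hpow \<xi>_def)
  define \<eta> where "\<eta> w k = (if k < N then p w (v k w) else 0)" for w k
  have \<eta>: "\<eta> w \<in> carrier T.tup" if "w \<in> S" for w
  proof -
    interpret p: bounded_op C C "p w"
      using p_bounded[OF S_words[OF that]] by unfold_locales
    show ?thesis
      using v_closed[OF _ that] by (simp add: in_carrier_hpow \<eta>_def p.closed)
  qed
  have tensor: "tensor_op C T.X T.T T.\<tau> (p w) (word_op T.X U w) (tuple_fun C N \<xi>)
      = tuple_fun C N (\<eta> w)" if w: "w \<in> S" for w
  proof -
    interpret p: bounded_op C C "p w"
      using p_bounded[OF S_words[OF w]] by unfold_locales
    have W: "word_op T.X U w \<in> bounded_ops T.X T.X"
      using w by (intro word_bounded) (simp add: S_def free_group_def)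
    have "(\<Sum>l<N. hscale C (word_op T.X U w (single l 1) k) (p w (\<xi> l))) = \<eta> w k"
      if k: "k < N" for k
    proof -
      have "(\<Sum>l<N. hscale C (word_op T.X U w (single l 1) k) (p w (\<xi> l)))
          = (\<Sum>l<N. p w (hscale C (word_op T.X U w (single l 1) k) (v l [])))"
        using v_closed[OF _ Nil_in_S] by (intro sum.cong refl) (simp add: p.scale \<xi>_def)
      also have "\<dots> = p w (\<Sum>l<N. hscale C (word_op T.X U w (single l 1) k) (v l []))"
        using v_closed[OF _ Nil_in_S] by (intro p.sum[symmetric] C.scale_closed) simp
      finally show ?thesis
        using word_v[OF w k] k by (simp add: \<eta>_def)
    qed
    then have "(\<lambda>k. if k < N then \<Sum>l<N. hscale C (word_op T.X U w (single l 1) k) (p w (\<xi> l)) else 0)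
        = \<eta> w"
      by (auto simp: \<eta>_def)
    then show ?thesis
      using T.tensor_op_tuple[OF p.mem W \<xi>] by simp
  qed
  define t where "t = tuple_fun C N \<xi>"
  have t: "t \<in> carrier T.T"
    using \<xi> by (simp add: t_def T.tup.carrier_himage)
  have "positive_op T.T (poly_eval m C T.X T.T T.\<tau> U p)"
    using pos T.X.hilbert_space_axioms separable_complex_tuples[of N] T.hilbert_tensor
      T.X.unitary_op_pair[OF UU']
    unfolding positive_poly_def by blast
  then have "hinner T.T (poly_eval m C T.X T.T T.\<tau> U p t) t \<in> \<real>\<^sub>\<ge>\<^sub>0"
    using t by (simp add: positive_op_def)
  also have "poly_eval m C T.X T.T T.\<tau> U p t = (\<Sum>w\<in>poly_supp m C p. tuple_fun C N (\<eta> w))"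
    unfolding poly_eval_def restrict_apply'[OF t] using supp_subset_S tensor
    by (intro sum.cong refl) (auto simp: t_def)
  also have "hinner T.T \<dots> t = (\<Sum>w\<in>poly_supp m C p. hinner T.T (tuple_fun C N (\<eta> w)) t)"
    using t \<eta> supp_subset_S by (intro T.T.inner_sum_left) (auto simp: T.tup.carrier_himage)
  also have "\<dots> = (\<Sum>w\<in>poly_supp m C p. \<Sum>k<N. hinner C (p w (v k w)) (v k []))"
    using \<eta> \<xi> supp_subset_S
    by (intro sum.cong refl) (auto simp: t_def T.tup.hinner_himage hinner_hpow \<xi>_def \<eta>_def)
  finally show ?thesis .
qed

end

lemma double_sum_average:
  fixes f g :: "'a \<Rightarrow> real"
  shows "(\<Sum>s\<in>A. \<Sum>t\<in>A. (1 / 2) * (f t + g s)) = real (card A) / 2 * (sum f A + sum g A)"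
proof -
  have "(\<Sum>t\<in>A. (1 / 2) * (f t + g s)) = (1 / 2) * (sum f A + real (card A) * g s)" for s
    unfolding sum_distrib_left[symmetric] by (simp add: sum.distrib)
  then have "(\<Sum>s\<in>A. \<Sum>t\<in>A. (1 / 2) * (f t + g s))
      = (1 / 2) * (\<Sum>s\<in>A. sum f A + real (card A) * g s)"
    by (simp only: sum_distrib_left[symmetric])
  also have "\<dots> = (1 / 2) * (real (card A) * sum f A + real (card A) * sum g A)"
    by (simp add: sum.distrib sum_distrib_left)
  finally show ?thesis
    by (simp add: distrib_left)
qed

context operator_polynomial
begin

subsection \<open>Sums of squares\<close>

lemma rank_one_closed_apply:
  "\<xi> \<in> carrier D \<Longrightarrow> rank_one u v \<xi> = Re (hinner D u \<xi> * cnj (hinner D v \<xi>))"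
  by (simp add: rank_one_def)

lemma rank_one_add_left:
  "\<lbrakk>u \<in> carrier D; u' \<in> carrier D\<rbrakk> \<Longrightarrow> rank_one (u + u') v = rank_one u v + rank_one u' v"
  by (auto simp: fun_eq_iff rank_one_def D.inner_add_left algebra_simps)

lemma rank_one_sym: "rank_one u v = rank_one v u"
  by (auto simp: fun_eq_iff rank_one_def mult.commute)

lemma rank_one_add_right:
  "\<lbrakk>v \<in> carrier D; v' \<in> carrier D\<rbrakk> \<Longrightarrow> rank_one u (v + v') = rank_one u v + rank_one u v'"
  using rank_one_add_left[of v v' u] by (simp add: rank_one_sym)

lemma rank_one_scale_left:
  "u \<in> carrier D \<Longrightarrow> rank_one (hscale D (complex_of_real c) u) v = c *\<^sub>R rank_one u v"
  by (auto simp: fun_eq_iff rank_one_def D.inner_scale_left algebra_simps)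

lemma rank_one_imaginary:
  "\<lbrakk>u \<in> carrier D; v \<in> carrier D\<rbrakk> \<Longrightarrow> rank_one (hscale D \<i> u) (hscale D \<i> v) = rank_one u v"
  by (auto simp: fun_eq_iff rank_one_def D.inner_scale_left)

lemma rank_one_add_square:
  assumes "u \<in> carrier D" "v \<in> carrier D"
  shows "rank_one (u + v) (u + v) = rank_one u u + 2 *\<^sub>R rank_one u v + rank_one v v"
  using assms rank_one_sym[of v u]
  by (simp add: rank_one_add_left rank_one_add_right D.closed scaleR_2 add.assoc)

lemma rank_one_squares: "v \<in> carrier D \<Longrightarrow> rank_one v v \<in> squares"
  unfolding squares_def by (intro CollectI exI[of _ "[v]"]) simp

lemma squares_zero: "0 \<in> squares"
  unfolding squares_def by (intro CollectI exI[of _ "[]"]) simp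

lemma squares_add:
  assumes "f \<in> squares" "g \<in> squares"
  shows "f + g \<in> squares"
proof -
  obtain us vs where "f = sum_list (map (\<lambda>v. rank_one v v) us)" "set us \<subseteq> carrier D"
    "g = sum_list (map (\<lambda>v. rank_one v v) vs)" "set vs \<subseteq> carrier D"
    using assms by (auto simp: squares_def)
  then show ?thesis
    unfolding squares_def by (intro CollectI exI[of _ "us @ vs"]) simp
qed

lemma squares_sum: "(\<And>i. i \<in> I \<Longrightarrow> f i \<in> squares) \<Longrightarrow> sum f I \<in> squares"
  by (induction I rule: infinite_finite_induct) (auto simp: squares_zero squares_add)

lemma squares_scale:
  assumes "0 \<le> c" "f \<in> squares"
  shows "c *\<^sub>R f \<in> squares"
proof -
  obtain vs where vs: "f = sum_list (map (\<lambda>v. rank_one v v) vs)" "set vs \<subseteq> carrier D"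
    using assms(2) by (auto simp: squares_def)
  have "c *\<^sub>R rank_one v v \<in> squares" if v: "v \<in> carrier D" for v
  proof -
    let ?u = "hscale D (complex_of_real (sqrt c)) v"
    have "rank_one ?u ?u = c *\<^sub>R rank_one v v"
      using v \<open>0 \<le> c\<close> rank_one_sym[of v ?u]
      by (simp add: rank_one_scale_left D.closed)
    then show ?thesis
      using rank_one_squares[of ?u] v by (simp add: D.closed)
  qed
  then show ?thesis
    using vs(2) unfolding vs(1)
    by (induction vs) (auto simp: squares_zero squares_add scaleR_add_right)
qed

lemma rank_one_in_span_squares:
  assumes "u \<in> carrier D" "v \<in> carrier D"
  shows "rank_one u v \<in> span squares"
proof -
  have "rank_one u v = (1 / 2) *\<^sub>R (rank_one (u + v) (u + v) - rank_one u u - rank_one v v)"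
    using assms by (simp add: rank_one_add_square)
  then show ?thesis
    using assms by (simp add: span_scale span_diff span_base rank_one_squares D.closed)
qed

lemma toeplitz_in_span_squares:
  assumes "x \<in> carrier C" "y \<in> carrier C"
  shows "toeplitz w x y \<in> span squares"
  unfolding toeplitz_def
  by (intro span_sum) (use assms in \<open>auto simp: factor_pairs_def intro!: rank_one_in_span_squares single_closed\<close>)

lemma factor_pairs_Nil: "factor_pairs [] = (\<lambda>s. (s, s)) ` S"
proof -
  have "inv\<^bsub>F\<^esub> s \<otimes>\<^bsub>F\<^esub> t = [] \<longleftrightarrow> t = s" if "s \<in> S" "t \<in> S" for s t
    using F.inv_solve_left'[of "[]" s t] that S_words Nil_in_S F.r_one[of s]
    by (auto simp: one_F)
  then show ?thesis
    by (auto simp: factor_pairs_def)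
qed

lemma toeplitz_Nil: "toeplitz [] x y = (\<Sum>s\<in>S. rank_one (single s x) (single s y))"
  unfolding toeplitz_def factor_pairs_Nil by (subst sum.reindex) (auto simp: inj_on_def)

lemma toeplitz_Nil_squares: "x \<in> carrier C \<Longrightarrow> toeplitz [] x x \<in> squares"
  unfolding toeplitz_Nil by (intro squares_sum rank_one_squares single_closed)

subsection \<open>Positivity on sums of squares\<close>

text \<open>
  The Gram kernel that polarization extracts from a real combination of Toeplitz forms: \<open>u\<close> stands for
  \<open>s\<^sup>-\<^sup>1 t\<close>, and the two summands with the factor \<open>1/2\<close> come from taking real parts.
\<close>

definition toeplitz_kernel ::
    "'i set \<Rightarrow> ('i \<Rightarrow> real) \<Rightarrow> ('i \<Rightarrow> word) \<Rightarrow> ('i \<Rightarrow> 'c) \<Rightarrow> ('i \<Rightarrow> 'c) \<Rightarrow> word \<Rightarrow> 'c \<Rightarrow> 'c \<Rightarrow> complex" where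
  "toeplitz_kernel J c w x y u a b =
    (\<Sum>i\<in>J. complex_of_real (c i / 2) *
      ((if w i = u then hinner C (x i) a * cnj (hinner C (y i) b) else 0) +
       (if w i = inv\<^bsub>F\<^esub> u then hinner C (y i) a * cnj (hinner C (x i) b) else 0)))"

lemma toeplitz_gram:
  assumes x: "\<And>i. i \<in> J \<Longrightarrow> x i \<in> carrier C" and y: "\<And>i. i \<in> J \<Longrightarrow> y i \<in> carrier C"
    and v: "\<And>k. k < N \<Longrightarrow> v k \<in> carrier D"
    and eq: "(\<Sum>i\<in>J. c i *\<^sub>R toeplitz (w i) (x i) (y i)) = (\<Sum>k<N. rank_one (v k) (v k))"
    and s: "s \<in> S" and t: "t \<in> S" and a: "a \<in> carrier C" and b: "b \<in> carrier C"
  shows "(\<Sum>k<N. hinner C (v k t) a * cnj (hinner C (v k s) b))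
    = toeplitz_kernel J c w x y (inv\<^bsub>F\<^esub> s \<otimes>\<^bsub>F\<^esub> t) a b"
proof -
  define g where "g i \<xi> \<eta> = (\<Sum>(s, t)\<in>factor_pairs (w i).
      hinner C (x i) (\<xi> t) * cnj (hinner C (y i) (\<eta> s)) +
      hinner C (y i) (\<xi> s) * cnj (hinner C (x i) (\<eta> t)))" for i and \<xi> \<eta> :: "word \<Rightarrow> 'c"
  define h where "h \<xi> \<eta> = (\<Sum>k<N. hinner D (v k) \<xi> * cnj (hinner D (v k) \<eta>))
      - (\<Sum>i\<in>J. complex_of_real (c i / 2) * g i \<xi> \<eta>)" for \<xi> \<eta>
  have h_zero: "h \<xi> \<eta> = 0" if "\<xi> \<in> carrier D" "\<eta> \<in> carrier D" for \<xi> \<eta>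
  proof (rule D.sesquilinear_zero[of h])
    fix \<xi> \<xi>' \<eta> assume mem: "\<xi> \<in> carrier D" "\<xi>' \<in> carrier D" "\<eta> \<in> carrier D"
    have "g i (\<xi> + \<xi>') \<eta> = g i \<xi> \<eta> + g i \<xi>' \<eta>" if "i \<in> J" for i
      unfolding g_def sum.distrib[symmetric] using mem that
      by (intro sum.cong refl)
        (auto simp: factor_pairs_def comp_closed x y C.inner_add_right algebra_simps)
    then show "h (\<xi> + \<xi>') \<eta> = h \<xi> \<eta> + h \<xi>' \<eta>"
      using mem v by (simp add: h_def D.inner_add_right distrib_left distrib_right sum.distrib)
    have "g i \<eta> (\<xi> + \<xi>') = g i \<eta> \<xi> + g i \<eta> \<xi>'" if "i \<in> J" for i
      unfolding g_def sum.distrib[symmetric] using mem that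
      by (intro sum.cong refl)
        (auto simp: factor_pairs_def comp_closed x y C.inner_add_right algebra_simps)
    then show "h \<eta> (\<xi> + \<xi>') = h \<eta> \<xi> + h \<eta> \<xi>'"
      using mem v by (simp add: h_def D.inner_add_right distrib_left distrib_right sum.distrib)
  next
    fix \<xi> \<eta> assume mem: "\<xi> \<in> carrier D" "\<eta> \<in> carrier D"
    have "g i (hscale D \<i> \<xi>) \<eta> = - \<i> * g i \<xi> \<eta>" if "i \<in> J" for i
      unfolding g_def sum_distrib_left using mem that
      by (intro sum.cong refl)
        (auto simp: factor_pairs_def comp_closed x y C.inner_scale_right hscale_hpow algebra_simps)
    then show "h (hscale D \<i> \<xi>) \<eta> = - \<i> * h \<xi> \<eta>"
      using mem v by (simp add: h_def D.inner_scale_right right_diff_distrib sum_distrib_left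
          sum_negf mult_ac)
    have "g i \<xi> (hscale D \<i> \<eta>) = \<i> * g i \<xi> \<eta>" if "i \<in> J" for i
      unfolding g_def sum_distrib_left using mem that
      by (intro sum.cong refl)
        (auto simp: factor_pairs_def comp_closed x y C.inner_scale_right hscale_hpow algebra_simps)
    then show "h \<xi> (hscale D \<i> \<eta>) = \<i> * h \<xi> \<eta>"
      using mem v by (simp add: h_def D.inner_scale_right right_diff_distrib sum_distrib_left mult_ac)
  next
    fix \<xi> assume \<xi>: "\<xi> \<in> carrier D"
    have "g i \<xi> \<xi> = complex_of_real (2 * toeplitz (w i) (x i) (y i) \<xi>)" for i
    proof -
      have *: "z + cnj z = complex_of_real (2 * Re z)" for z
        by (rule complex_add_cnj)
      have "g i \<xi> \<xi> = (\<Sum>(s, t)\<in>factor_pairs (w i).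
          complex_of_real (2 * Re (hinner C (x i) (\<xi> t) * cnj (hinner C (y i) (\<xi> s)))))"
        unfolding g_def *[symmetric] by (intro sum.cong refl) (auto simp: mult.commute)
      then show ?thesis
        by (simp add: toeplitz_apply[OF \<xi>] sum_distrib_left split_def)
    qed
    moreover have "(\<Sum>k<N. hinner D (v k) \<xi> * cnj (hinner D (v k) \<xi>))
        = complex_of_real (\<Sum>k<N. rank_one (v k) (v k) \<xi>)"
      using \<xi> by (simp add: rank_one_closed_apply complex_mult_cnj power2_eq_square)
    moreover have "(\<Sum>k<N. rank_one (v k) (v k) \<xi>) = (\<Sum>i\<in>J. c i * toeplitz (w i) (x i) (y i) \<xi>)"
      using fun_cong[OF eq, of \<xi>] by (simp add: sum_fun_apply)
    ultimately show "h \<xi> \<xi> = 0"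
      by (simp add: h_def)
  qed (use that in auto)
  have g_single: "g i (single t a) (single s b) =
      (if w i = inv\<^bsub>F\<^esub> s \<otimes>\<^bsub>F\<^esub> t then hinner C (x i) a * cnj (hinner C (y i) b) else 0) +
      (if w i = inv\<^bsub>F\<^esub> (inv\<^bsub>F\<^esub> s \<otimes>\<^bsub>F\<^esub> t) then hinner C (y i) a * cnj (hinner C (x i) b) else 0)"
    if i: "i \<in> J" for i
  proof -
    have inner_if: "hinner C z (if Q then d else 0) = (if Q then hinner C z d else 0)"
      if "z \<in> carrier C" for z d Q
      using that by simp
    have "g i (single t a) (single s b) = (\<Sum>q\<in>factor_pairs (w i).
          (if q = (s, t) then hinner C (x i) a * cnj (hinner C (y i) b) else 0) +
          (if q = (t, s) then hinner C (y i) a * cnj (hinner C (x i) b) else 0))"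
      unfolding g_def
    proof (rule sum.cong[OF refl])
      fix q :: "word \<times> word"
      obtain s' t' where q: "q = (s', t')"
        by (cases q)
      show "(case q of (s', t') \<Rightarrow>
            hinner C (x i) (if t' = t then a else 0) * cnj (hinner C (y i) (if s' = s then b else 0)) +
            hinner C (y i) (if s' = t then a else 0) * cnj (hinner C (x i) (if t' = s then b else 0)))
          = (if q = (s, t) then hinner C (x i) a * cnj (hinner C (y i) b) else 0) +
            (if q = (t, s) then hinner C (y i) a * cnj (hinner C (x i) b) else 0)"
        unfolding q prod.case inner_if[OF x[OF i]] inner_if[OF y[OF i]] prod.inject
        by (cases "t' = t"; cases "s' = s"; cases "s' = t"; cases "t' = s") simp_all
    qed
    also have "\<dots>
        = (\<Sum>q\<in>factor_pairs (w i). if q = (s, t) then hinner C (x i) a * cnj (hinner C (y i) b) else 0)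
        + (\<Sum>q\<in>factor_pairs (w i). if q = (t, s) then hinner C (y i) a * cnj (hinner C (x i) b) else 0)"
      by (rule sum.distrib)
    also have "\<dots> = (if (s, t) \<in> factor_pairs (w i) then hinner C (x i) a * cnj (hinner C (y i) b) else 0)
        + (if (t, s) \<in> factor_pairs (w i) then hinner C (y i) a * cnj (hinner C (x i) b) else 0)"
      by (simp add: finite_factor_pairs)
    moreover have "inv\<^bsub>F\<^esub> (inv\<^bsub>F\<^esub> s \<otimes>\<^bsub>F\<^esub> t) = inv\<^bsub>F\<^esub> t \<otimes>\<^bsub>F\<^esub> s"
      using s t S_words by (simp add: F.inv_mult_group)
    ultimately show ?thesis
      using s t by (auto simp: factor_pairs_def)
  qed
  have "(\<Sum>k<N. hinner C (v k t) a * cnj (hinner C (v k s) b))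
      = (\<Sum>k<N. hinner D (v k) (single t a) * cnj (hinner D (v k) (single s b)))"
    using v s t by (simp add: hinner_single_right)
  also have "\<dots> = (\<Sum>i\<in>J. complex_of_real (c i / 2) * g i (single t a) (single s b))"
    using h_zero[OF single_closed[OF t a] single_closed[OF s b]] by (simp add: h_def)
  also have "\<dots> = toeplitz_kernel J c w x y (inv\<^bsub>F\<^esub> s \<otimes>\<^bsub>F\<^esub> t) a b"
    unfolding toeplitz_kernel_def by (intro sum.cong refl) (simp only: g_single)
  finally show ?thesis .
qed

text \<open>
  The value of \<open>p\<close> at a sum of squares, computed in \<open>positive_at_toeplitz_family\<close>, is a sum of traces
  of finite rank operators with coefficients of \<open>p\<close>.  If the sum of squares is a combination of Toeplitz forms,
  these operators are known from the Gram kernel, and so are the traces, by \<open>finite_rank_trace_zero\<close>.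
\<close>

lemma positive_at_toeplitz:
  fixes J :: "'i set"
  assumes pos: "positive_poly m C p" and J: "finite J"
    and w: "\<And>i. i \<in> J \<Longrightarrow> w i \<in> words m"
    and x: "\<And>i. i \<in> J \<Longrightarrow> x i \<in> carrier C" and y: "\<And>i. i \<in> J \<Longrightarrow> y i \<in> carrier C"
    and squares: "(\<Sum>i\<in>J. c i *\<^sub>R toeplitz (w i) (x i) (y i)) \<in> squares"
  shows "(\<Sum>i\<in>J. complex_of_real (c i / 2) *
      (hinner C (p (w i) (x i)) (y i) + hinner C (p (inv\<^bsub>F\<^esub> (w i)) (y i)) (x i))) \<in> \<real>\<^sub>\<ge>\<^sub>0"
proof -
  let ?A = "\<lambda>u i. if w i = u then hinner C (p u (x i)) (y i) else 0"
  let ?B = "\<lambda>u i. if w i = inv\<^bsub>F\<^esub> u then hinner C (p u (y i)) (x i) else 0"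
  let ?supp = "poly_supp m C p"
  obtain vs where vs: "(\<Sum>i\<in>J. c i *\<^sub>R toeplitz (w i) (x i) (y i)) = sum_list (map (\<lambda>v. rank_one v v) vs)"
    "set vs \<subseteq> carrier D"
    using squares by (auto simp: squares_def)
  define N where "N = length vs"
  define v where "v k = vs ! k" for k
  have v: "v k \<in> carrier D" if "k < N" for k
    using that vs(2) by (auto simp: v_def N_def)
  have v_closed: "v k s \<in> carrier C" if "k < N" "s \<in> S" for k s
    using comp_closed[OF v that(2)] that(1) .
  have "(\<Sum>i\<in>J. c i *\<^sub>R toeplitz (w i) (x i) (y i)) = (\<Sum>k<N. rank_one (v k) (v k))"
    unfolding vs(1) by (simp add: sum_list_sum_nth N_def v_def atLeast0LessThan)
  then have gram: "(\<Sum>k<N. hinner C (v k t) a * cnj (hinner C (v k s) b))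
      = toeplitz_kernel J c w x y (inv\<^bsub>F\<^esub> s \<otimes>\<^bsub>F\<^esub> t) a b"
    if "s \<in> S" "t \<in> S" "a \<in> carrier C" "b \<in> carrier C" for s t a b
    using that by (intro toeplitz_gram x y v)
  have trace: "(\<Sum>k<N. hinner C (p u (v k u)) (v k [])) = (\<Sum>i\<in>J. complex_of_real (c i / 2) *
      (?A u i + ?B u i))" if u: "u \<in> S" for u
  proof -
    interpret p: bounded_op C C "p u"
      using p_bounded[OF S_words[OF u]] by unfold_locales
    define \<alpha> \<beta> where "\<alpha> i = complex_of_real (if w i = u then c i / 2 else 0)"
      and "\<beta> i = complex_of_real (if w i = inv\<^bsub>F\<^esub> u then c i / 2 else 0)" for i
    \<comment> \<open>the two expressions for the operator, with opposite signs, as one family of rank one operators\<close>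
    define K where "K = {..<N} <+> (J <+> J)"
    define a where "a = case_sum (\<lambda>k. v k u)
        (case_sum (\<lambda>i. hscale C (- \<alpha> i) (x i)) (\<lambda>i. hscale C (- \<beta> i) (y i)))"
    define b where "b = case_sum (\<lambda>k. v k []) (case_sum y x)"
    have sum_K: "sum f K = (\<Sum>k<N. f (Inl k)) + ((\<Sum>i\<in>J. f (Inr (Inl i))) + (\<Sum>i\<in>J. f (Inr (Inr i))))"
      for f :: "nat + 'i + 'i \<Rightarrow> complex"
      using J by (simp add: K_def sum.Plus)
    have "(\<Sum>k\<in>K. hinner C (p u (a k)) (b k)) = 0"
    proof (rule C.finite_rank_trace_zero[OF p.mem])
      show "finite K"
        using J by (simp add: K_def)
      show "a k \<in> carrier C" "b k \<in> carrier C" if "k \<in> K" for k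
        using that x y v_closed[OF _ u] v_closed[OF _ Nil_in_S]
        by (auto simp: K_def a_def b_def C.closed)
      fix x' y' assume x': "x' \<in> carrier C" and y': "y' \<in> carrier C"
      have "(\<Sum>k<N. hinner C (v k u) x' * hinner C y' (v k []))
          = (\<Sum>k<N. hinner C (v k u) x' * cnj (hinner C (v k []) y'))"
        using v_closed[OF _ Nil_in_S] y' by (intro sum.cong refl) (simp add: C.inner_commute[of _ y'])
      also have "\<dots> = toeplitz_kernel J c w x y u x' y'"
        using gram[OF Nil_in_S u x' y'] S_words[OF u] by (simp flip: one_F)
      also have "\<dots> = (\<Sum>i\<in>J. \<alpha> i * hinner C (x i) x' * hinner C y' (y i))
          + (\<Sum>i\<in>J. \<beta> i * hinner C (y i) x' * hinner C y' (x i))"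
        unfolding toeplitz_kernel_def sum.distrib[symmetric]
      proof (rule sum.cong[OF refl])
        fix i assume "i \<in> J"
        then have "hinner C y' (y i) = cnj (hinner C (y i) y')" "hinner C y' (x i) = cnj (hinner C (x i) y')"
          using x y y' by (auto intro: C.inner_commute)
        then show "complex_of_real (c i / 2) *
            ((if w i = u then hinner C (x i) x' * cnj (hinner C (y i) y') else 0) +
             (if w i = inv\<^bsub>F\<^esub> u then hinner C (y i) x' * cnj (hinner C (x i) y') else 0))
            = \<alpha> i * hinner C (x i) x' * hinner C y' (y i) + \<beta> i * hinner C (y i) x' * hinner C y' (x i)"
          by (cases "w i = u"; cases "w i = inv\<^bsub>F\<^esub> u")
            (simp_all add: \<alpha>_def \<beta>_def distrib_left mult.assoc)
      qed
      finally show "(\<Sum>k\<in>K. hinner C (a k) x' * hinner C y' (b k)) = 0"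
        using x y x' by (simp add: sum_K a_def b_def C.inner_scale_left sum_negf)
    qed
    then have "(\<Sum>k<N. hinner C (p u (v k u)) (v k []))
        = (\<Sum>i\<in>J. \<alpha> i * hinner C (p u (x i)) (y i)) + (\<Sum>i\<in>J. \<beta> i * hinner C (p u (y i)) (x i))"
      using x y by (simp add: sum_K a_def b_def p.scale p.closed C.inner_scale_left sum_negf
          add_eq_0_iff eq_neg_iff_add_eq_0)
    also have "\<dots> = (\<Sum>i\<in>J. complex_of_real (c i / 2) *
        (?A u i + ?B u i))"
      unfolding sum.distrib[symmetric] by (intro sum.cong refl) (auto simp: \<alpha>_def \<beta>_def distrib_left)
    finally show ?thesis .
  qed
  have "(\<Sum>u\<in>?supp. \<Sum>k<N. hinner C (p u (v k u)) (v k [])) \<in> \<real>\<^sub>\<ge>\<^sub>0"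
    by (rule positive_at_toeplitz_family[OF pos v gram])
  also have "(\<Sum>u\<in>?supp. \<Sum>k<N. hinner C (p u (v k u)) (v k []))
      = (\<Sum>u\<in>?supp. \<Sum>i\<in>J. complex_of_real (c i / 2) *
          (?A u i + ?B u i))"
    using supp_subset_S by (intro sum.cong refl trace) auto
  also have "\<dots> = (\<Sum>i\<in>J. \<Sum>u\<in>?supp. complex_of_real (c i / 2) *
          (?A u i + ?B u i))"
    by (rule sum.swap)
  also have "\<dots> = (\<Sum>i\<in>J. complex_of_real (c i / 2) *
      (hinner C (p (w i) (x i)) (y i) + hinner C (p (inv\<^bsub>F\<^esub> (w i)) (y i)) (x i)))"
  proof (rule sum.cong[OF refl])
    fix i assume i: "i \<in> J"
    have supp_words: "u \<in> words m" if "u \<in> ?supp" for u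
      using that by (simp add: poly_supp_def)
    have "w i = inv\<^bsub>F\<^esub> u \<longleftrightarrow> u = inv\<^bsub>F\<^esub> (w i)" if "u \<in> words m" for u
      using that w[OF i] by auto
    then have "(\<Sum>u\<in>?supp. ?B u i)
        = (\<Sum>u\<in>?supp. if u = inv\<^bsub>F\<^esub> (w i) then hinner C (p u (y i)) (x i) else 0)"
      using supp_words by (intro sum.cong refl) simp
    also have "\<dots> = hinner C (p (inv\<^bsub>F\<^esub> (w i)) (y i)) (x i)"
      using finite_supp p_outside[of "inv\<^bsub>F\<^esub> (w i)" "y i"] w[OF i] x[OF i] y[OF i] by auto
    finally have second: "(\<Sum>u\<in>?supp. ?B u i)
        = hinner C (p (inv\<^bsub>F\<^esub> (w i)) (y i)) (x i)" .
    have first: "(\<Sum>u\<in>?supp. ?A u i)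
        = hinner C (p (w i) (x i)) (y i)"
      using finite_supp p_outside[of "w i" "x i"] w[OF i] x[OF i] y[OF i] by auto
    show "(\<Sum>u\<in>?supp. complex_of_real (c i / 2) *
          (?A u i + ?B u i))
      = complex_of_real (c i / 2) *
      (hinner C (p (w i) (x i)) (y i) + hinner C (p (inv\<^bsub>F\<^esub> (w i)) (y i)) (x i))"
      by (subst sum_distrib_left[symmetric], subst sum.distrib, subst first, subst second, rule refl)
  qed
  finally show ?thesis .
qed

text \<open>
  Adding a suitable diagonal Toeplitz form makes any Toeplitz form a sum of squares, because
  \<open>2 Re (a \<cdot> cnj b) + \<bar>a\<bar>\<^sup>2 + \<bar>b\<bar>\<^sup>2 = \<bar>a + b\<bar>\<^sup>2\<close>.  The value that \<open>p\<close> assigns to the result is therefore real, and so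
  is the sum of \<open>\<langle>p w x, y\<rangle>\<close> and \<open>\<langle>p w\<^sup>-\<^sup>1 y, x\<rangle>\<close>.  Applied to \<open>\<i> x\<close> for \<open>x\<close>, this says that the two have the
  same real part.
\<close>

lemma positive_imp_hermitian:
  assumes pos: "positive_poly m C p" and w: "w \<in> words m" and x: "x \<in> carrier C" and y: "y \<in> carrier C"
  shows "Re (hinner C (p (inv\<^bsub>F\<^esub> w) y) x) = Re (hinner C (p w x) y)"
proof -
  have diag: "hinner C (p [] x) x \<in> \<real>\<^sub>\<ge>\<^sub>0" if x: "x \<in> carrier C" for x
    using positive_at_toeplitz[OF pos, of "{()}" "\<lambda>_. []" "\<lambda>_. x" "\<lambda>_. x" "\<lambda>_. 1"] x
      S_words[OF Nil_in_S] toeplitz_Nil_squares[OF x] F.inv_one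
    by (simp add: one_F)
  have real: "Im (hinner C (p w x) y + hinner C (p (inv\<^bsub>F\<^esub> w) y) x) = 0"
    if x: "x \<in> carrier C" and y: "y \<in> carrier C" for x y
  proof -
    let ?q = "\<lambda>s x. rank_one (single s x) (single s x)"
    let ?n = "real (card S) / 2"
    have sub: "factor_pairs w \<subseteq> S \<times> S"
      by (auto simp: factor_pairs_def)
    have "(\<Sum>(s, t)\<in>S \<times> S. (1 / 2) *\<^sub>R (?q t x + ?q s y)) = ?n *\<^sub>R (toeplitz [] x x + toeplitz [] y y)"
      unfolding sum.cartesian_product[symmetric] toeplitz_Nil
      by (rule ext) (simp only: sum_fun_apply scaleR_fun_apply plus_fun_apply real_scaleR_def
          double_sum_average)
    then have "toeplitz w x y + ?n *\<^sub>R (toeplitz [] x x + toeplitz [] y y)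
        = toeplitz w x y + (\<Sum>(s, t)\<in>factor_pairs w. (1 / 2) *\<^sub>R (?q t x + ?q s y))
          + (\<Sum>(s, t)\<in>S \<times> S - factor_pairs w. (1 / 2) *\<^sub>R (?q t x + ?q s y))"
      using sum.subset_diff[OF sub, of "\<lambda>(s, t). (1 / 2) *\<^sub>R (?q t x + ?q s y)"] finite_S
      by (simp add: add_ac)
    also have "toeplitz w x y + (\<Sum>(s, t)\<in>factor_pairs w. (1 / 2) *\<^sub>R (?q t x + ?q s y))
        = (\<Sum>(s, t)\<in>factor_pairs w. (1 / 2) *\<^sub>R rank_one (single t x + single s y) (single t x + single s y))"
      unfolding toeplitz_def sum.distrib[symmetric]
      by (intro sum.cong refl)
        (auto simp: factor_pairs_def rank_one_add_square single_closed x y scaleR_add_right)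
    also have "\<dots> + (\<Sum>(s, t)\<in>S \<times> S - factor_pairs w. (1 / 2) *\<^sub>R (?q t x + ?q s y)) \<in> squares"
      by (intro squares_add squares_sum)
        (auto simp: factor_pairs_def x y
          intro!: squares_scale squares_add rank_one_squares D.add_closed single_closed)
    finally have sq: "toeplitz w x y + ?n *\<^sub>R (toeplitz [] x x + toeplitz [] y y) \<in> squares" .
    \<comment> \<open>the three Toeplitz forms of \<open>sq\<close>, indexed by \<open>0\<close>, \<open>1\<close>, \<open>2\<close>\<close>
    define c where "c i = (if i = (0::nat) then 1 else ?n)" for i
    define ws where "ws i = (if i = (0::nat) then w else [])" for i
    define xs ys where "xs i = (if i \<le> (1::nat) then x else y)"
      and "ys i = (if i = (1::nat) then x else y)" for i
    have "(\<Sum>i\<in>{0, 1, 2}. c i *\<^sub>R toeplitz (ws i) (xs i) (ys i)) \<in> squares"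
      using sq by (simp add: c_def ws_def xs_def ys_def scaleR_add_right add.assoc)
    then have "(\<Sum>i\<in>{0, 1, 2}. complex_of_real (c i / 2) * (hinner C (p (ws i) (xs i)) (ys i)
        + hinner C (p (inv\<^bsub>F\<^esub> (ws i)) (ys i)) (xs i))) \<in> \<real>\<^sub>\<ge>\<^sub>0"
      using w x y S_words[OF Nil_in_S]
      by (intro positive_at_toeplitz[OF pos]) (auto simp: ws_def xs_def ys_def)
    moreover have "inv\<^bsub>F\<^esub> [] = []"
      using F.inv_one by (simp add: one_F)
    ultimately show ?thesis
      using diag[OF x] diag[OF y]
      by (auto simp: c_def ws_def xs_def ys_def complex_nonneg_Reals_iff)
  qed
  interpret p: bounded_op C C "p w"
    using p_bounded[OF w] by unfold_locales
  interpret p': bounded_op C C "p (inv\<^bsub>F\<^esub> w)"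
    using p_bounded[of "inv\<^bsub>F\<^esub> w"] w by unfold_locales simp
  show ?thesis
    using real[of "hscale C \<i> x" y] x y
    by (simp add: C.closed p.scale p.closed p'.closed C.inner_scale_left C.inner_scale_right)
qed

text \<open>
  The values prescribed on Toeplitz forms are nonnegative on sums of squares.  Applied to the form \<open>0\<close>, this
  also shows that they do not depend on the representation of the form.
\<close>

lemma toeplitz_pairing_nonneg:
  assumes pos: "positive_poly m C p"
    and mem: "(f, r) \<in> span {(toeplitz w x y, Re (hinner C (p w x) y)) | w x y.
      w \<in> words m \<and> x \<in> carrier C \<and> y \<in> carrier C}" (is "_ \<in> span ?G")
    and sq: "f \<in> squares"
  shows "0 \<le> r"
proof -
  obtain t c where t: "finite t" "t \<subseteq> ?G" and fr: "(f, r) = (\<Sum>a\<in>t. c a *\<^sub>R a)"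
    using mem unfolding span_explicit by blast
  have "\<forall>a\<in>t. \<exists>w x y. a = (toeplitz w x y, Re (hinner C (p w x) y))
      \<and> w \<in> words m \<and> x \<in> carrier C \<and> y \<in> carrier C"
    using t(2) by blast
  then obtain w x y where wxy: "\<And>a. a \<in> t \<Longrightarrow> a = (toeplitz (w a) (x a) (y a), Re (hinner C (p (w a) (x a)) (y a)))"
    and w: "\<And>a. a \<in> t \<Longrightarrow> w a \<in> words m" and x: "\<And>a. a \<in> t \<Longrightarrow> x a \<in> carrier C"
    and y: "\<And>a. a \<in> t \<Longrightarrow> y a \<in> carrier C"
    by metis
  have "f = (\<Sum>a\<in>t. c a *\<^sub>R fst a)" "r = (\<Sum>a\<in>t. c a * snd a)"
    using fr by (simp_all add: prod_eq_iff fst_sum snd_sum)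
  moreover have "fst a = toeplitz (w a) (x a) (y a)" "snd a = Re (hinner C (p (w a) (x a)) (y a))"
    if "a \<in> t" for a
    using arg_cong[OF wxy[OF that], of fst] arg_cong[OF wxy[OF that], of snd] by simp_all
  ultimately have f: "f = (\<Sum>a\<in>t. c a *\<^sub>R toeplitz (w a) (x a) (y a))"
    and r: "r = (\<Sum>a\<in>t. c a * Re (hinner C (p (w a) (x a)) (y a)))"
    by (auto intro!: sum.cong)
  have "(\<Sum>a\<in>t. complex_of_real (c a / 2) * (hinner C (p (w a) (x a)) (y a)
      + hinner C (p (inv\<^bsub>F\<^esub> (w a)) (y a)) (x a))) \<in> \<real>\<^sub>\<ge>\<^sub>0" (is "?Z \<in> _")
    using sq unfolding f by (intro positive_at_toeplitz[OF pos t(1)] w x y)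
  then have "0 \<le> Re ?Z"
    by (simp add: complex_nonneg_Reals_iff)
  also have "Re ?Z = r"
    unfolding r Re_sum
    by (intro sum.cong refl) (simp add: positive_imp_hermitian[OF pos w x y])
  finally show ?thesis .
qed

text \<open>
  Lagrange's identity \<open>n \<Sum>\<^sub>s \<bar>a\<^sub>s\<bar>\<^sup>2 - \<bar>\<Sum>\<^sub>s a\<^sub>s\<bar>\<^sup>2 = 1/2 \<Sum>\<^sub>s\<^sub>,\<^sub>t \<bar>a\<^sub>s - a\<^sub>t\<bar>\<^sup>2\<close>, with \<open>n\<close> the size of the ball, bounds a
  square by its diagonal part, and the diagonal part is bounded by a Toeplitz form for the empty word.
\<close>

lemma square_dominated:
  assumes u: "u \<in> carrier D"
  shows "real (card S) *\<^sub>R (\<Sum>s\<in>S. toeplitz [] (u s) (u s)) - rank_one u u \<in> squares"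
proof -
  let ?n = "real (card S)"
  let ?q = "\<lambda>v. rank_one v v"
  define \<iota> where "\<iota> s = single s (u s)" for s
  have us: "u s \<in> carrier C" if "s \<in> S" for s
    using comp_closed[OF u that] .
  have \<iota>: "\<iota> s \<in> carrier D" if "s \<in> S" for s
    using that us by (simp add: \<iota>_def single_closed)
  have lagrange: "?n *\<^sub>R (\<Sum>s\<in>S. ?q (\<iota> s)) - ?q u = (\<Sum>s\<in>S. \<Sum>t\<in>S. (1 / 2) *\<^sub>R ?q (\<iota> s - \<iota> t))"
  proof
    fix \<xi>
    show "(?n *\<^sub>R (\<Sum>s\<in>S. ?q (\<iota> s)) - ?q u) \<xi> = (\<Sum>s\<in>S. \<Sum>t\<in>S. (1 / 2) *\<^sub>R ?q (\<iota> s - \<iota> t)) \<xi>"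
    proof (cases "\<xi> \<in> carrier D")
      case True
      define a where "a s = hinner D (\<iota> s) \<xi>" for s
      define A where "A = (\<Sum>s\<in>S. Re (a s * cnj (a s)))"
      have "hinner D u \<xi> = (\<Sum>s\<in>S. hinner C (u s) (\<xi> s))"
        by (rule hinner_hpow)
      also have "\<dots> = (\<Sum>s\<in>S. a s)"
        using True by (simp add: a_def \<iota>_def hinner_single_left)
      finally have "hinner D u \<xi> = (\<Sum>s\<in>S. a s)" .
      then have "hinner D u \<xi> * cnj (hinner D u \<xi>) = (\<Sum>s\<in>S. \<Sum>t\<in>S. a s * cnj (a t))"
        by (simp only: cnj_sum sum_product)
      then have sum_a: "(\<Sum>s\<in>S. \<Sum>t\<in>S. Re (a s * cnj (a t))) = ?q u \<xi>"
        using True by (simp only: rank_one_closed_apply Re_sum)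
      have "(\<Sum>s\<in>S. \<Sum>t\<in>S. ?q (\<iota> s - \<iota> t) \<xi>)
          = (\<Sum>s\<in>S. \<Sum>t\<in>S. Re (a s * cnj (a s)) + Re (a t * cnj (a t)) - 2 * Re (a s * cnj (a t)))"
        using True \<iota>
        by (intro sum.cong refl) (simp add: rank_one_closed_apply D.inner_diff_left a_def algebra_simps)
      also have "\<dots> = 2 * ?n * A - 2 * ?q u \<xi>"
        by (simp add: sum.distrib sum_subtractf A_def flip: sum_distrib_left sum_a)
      finally show ?thesis
        using True by (simp add: sum_fun_apply rank_one_closed_apply A_def a_def flip: sum_divide_distrib)
    qed (simp add: rank_one_def sum_fun_apply)
  qed
  have split: "toeplitz [] (u s) (u s) = ?q (\<iota> s) + (\<Sum>r\<in>S - {s}. ?q (single r (u s)))" if "s \<in> S" for s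
    unfolding toeplitz_Nil \<iota>_def by (rule sum.remove[OF finite_S that])
  have "?n *\<^sub>R (\<Sum>s\<in>S. toeplitz [] (u s) (u s)) - ?q u
      = (?n *\<^sub>R (\<Sum>s\<in>S. ?q (\<iota> s)) - ?q u) + ?n *\<^sub>R (\<Sum>s\<in>S. \<Sum>r\<in>S - {s}. ?q (single r (u s)))"
    using split by (simp add: sum.distrib scaleR_add_right)
  also have "\<dots> \<in> squares"
    unfolding lagrange using \<iota> us
    by (auto intro!: squares_add squares_sum squares_scale rank_one_squares D.diff_closed single_closed)
  finally show ?thesis .
qed

subsection \<open>The Gram form of a positive polynomial\<close>

text \<open>
  A positive functional \<open>L\<close> that extends the prescribed values on Toeplitz forms yields \<open>b u v\<close> as its value at
  \<open>rank_one u v\<close>.  The form is bounded because the Toeplitz form that dominates \<open>rank_one u u\<close> has the value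
  \<open>card S\<close> times the sum of the \<open>\<langle>p [] (u s), u s\<rangle>\<close>.
\<close>

theorem exists_positive_gram_form:
  assumes pos: "positive_poly m C p"
  obtains b :: "(word \<Rightarrow> 'c) \<Rightarrow> (word \<Rightarrow> 'c) \<Rightarrow> real" and M :: real
  where "bounded_positive_form D b M"
    and "\<And>w x y. \<lbrakk>w \<in> words m; x \<in> carrier C; y \<in> carrier C\<rbrakk> \<Longrightarrow>
      (\<Sum>(s, t)\<in>factor_pairs w. b (single t x) (single s y)) = Re (hinner C (p w x) y)"
proof -
  define G where "G = {(toeplitz w x y, Re (hinner C (p w x) y)) | w x y.
      w \<in> words m \<and> x \<in> carrier C \<and> y \<in> carrier C}"
  have G: "(toeplitz w x y, Re (hinner C (p w x) y)) \<in> span G"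
    if "w \<in> words m" "x \<in> carrier C" "y \<in> carrier C" for w x y
    using that by (intro span_base) (auto simp: G_def)
  define bound where "bound u = real (card S) *\<^sub>R (\<Sum>s\<in>S. toeplitz [] (u s) (u s))" for u
  define bound_val where "bound_val u = real (card S) * (\<Sum>s\<in>S. Re (hinner C (p [] (u s)) (u s)))" for u
  have bound: "(bound u, bound_val u) \<in> span G" if u: "u \<in> carrier D" for u
  proof -
    have "real (card S) *\<^sub>R (\<Sum>s\<in>S. (toeplitz [] (u s) (u s), Re (hinner C (p [] (u s)) (u s)))) \<in> span G"
      using comp_closed[OF u] S_words[OF Nil_in_S] by (intro span_scale span_sum G)
    then show ?thesis
      by (simp add: bound_def bound_val_def sum_prod)
  qed
  have bound_dominates: "bound u - rank_one u u \<in> squares" if "u \<in> carrier D" for u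
    unfolding bound_def by (rule square_dominated[OF that])
  have fst_G: "fst ` span G \<subseteq> span squares"
  proof -
    have "linear (fst :: ((word \<Rightarrow> 'c) \<Rightarrow> real) \<times> real \<Rightarrow> _)"
      by (rule linear_fst)
    then have "fst ` span G = span (fst ` G)"
      by (rule linear_span_image[symmetric])
    also have "\<dots> \<subseteq> span squares"
      by (intro span_minimal subspace_span) (auto simp: G_def toeplitz_in_span_squares)
    finally show ?thesis .
  qed
  have dominated: "\<exists>f r. (f, r) \<in> span G \<and> f - v \<in> squares" if "v \<in> squares" for v
  proof -
    obtain vs where "set vs \<subseteq> carrier D" and v: "v = sum_list (map (\<lambda>v. rank_one v v) vs)"
      using \<open>v \<in> squares\<close> unfolding squares_def by blast
    then show ?thesis
      unfolding v
    proof (induction vs)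
      case Nil
      show ?case
      proof (intro exI conjI)
        show "(0, 0) \<in> span G"
          using span_zero[of G] by (simp only: zero_prod_def)
        show "0 - sum_list (map (\<lambda>v. rank_one v v) []) \<in> squares"
          by (simp only: list.map sum_list.Nil diff_zero squares_zero)
      qed
    next
      case (Cons u vs)
      have "set vs \<subseteq> carrier D"
        using Cons.prems by simp
      then obtain f r where f: "(f, r) \<in> span G" "f - sum_list (map (\<lambda>v. rank_one v v) vs) \<in> squares"
        using Cons.IH by blast
      have u: "u \<in> carrier D"
        using Cons.prems by simp
      show ?case
      proof (intro exI conjI)
        show "(bound u + f, bound_val u + r) \<in> span G"
          using span_add[OF bound[OF u] f(1)] by simp
        show "bound u + f - sum_list (map (\<lambda>v. rank_one v v) (u # vs)) \<in> squares"
          unfolding list.map sum_list.Cons add_diff_add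
          by (rule squares_add[OF bound_dominates[OF u] f(2)])
      qed
    qed
  qed
  obtain L where L_add: "\<And>f g. \<lbrakk>f \<in> span squares; g \<in> span squares\<rbrakk> \<Longrightarrow> L (f + g) = L f + L g"
    and L_scale: "\<And>c f. f \<in> span squares \<Longrightarrow> L (c *\<^sub>R f) = c * L f"
    and L_G: "\<And>f r. (f, r) \<in> span G \<Longrightarrow> L f = r"
    and L_pos: "\<And>f. f \<in> squares \<Longrightarrow> 0 \<le> L f"
  proof (rule positive_functional_extension[of squares "span G"])
    show "f + g \<in> squares" if "f \<in> squares" "g \<in> squares" for f g
      using that by (rule squares_add)
    show "c *\<^sub>R f \<in> squares" if "0 \<le> c" "f \<in> squares" for c f
      using that by (rule squares_scale)
    show "0 \<le> r" if "(f, r) \<in> span G" "f \<in> squares" for f r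
      using that unfolding G_def by (rule toeplitz_pairing_nonneg[OF pos])
    show "\<exists>f r. (f, r) \<in> span G \<and> f - v \<in> squares" if "v \<in> squares" for v
      using that by (rule dominated)
  qed (rule squares_zero subspace_span fst_G that; assumption?)+
  have L_sum: "L (sum f I) = (\<Sum>i\<in>I. L (f i))" if "\<And>i. i \<in> I \<Longrightarrow> f i \<in> span squares"
    for I :: "(word \<times> word) set" and f
    using that L_scale[of 0 0] span_zero[of squares]
    by (induction I rule: infinite_finite_induct) (auto simp: L_add span_sum)
  interpret p1: bounded_op C C "p []"
    using p_bounded[OF S_words[OF Nil_in_S]] by unfold_locales
  obtain M where M: "0 \<le> M" "\<And>x. x \<in> carrier C \<Longrightarrow> hnorm C (p [] x) \<le> M * hnorm C x"
    using p1.bound by blast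
  have "bounded_positive_form D (\<lambda>u v. L (rank_one u v)) (real (card S) * M)"
  proof
    fix u v v' assume u: "u \<in> carrier D" and v: "v \<in> carrier D"
    show "L (rank_one (hscale D (complex_of_real c) u) v) = c * L (rank_one u v)" for c
      using u v by (simp add: rank_one_scale_left L_scale rank_one_in_span_squares)
    show "L (rank_one u v) = L (rank_one v u)"
      by (simp add: rank_one_sym)
    show "L (rank_one (hscale D \<i> u) (hscale D \<i> v)) = L (rank_one u v)"
      using u v by (simp add: rank_one_imaginary)
    assume v': "v' \<in> carrier D"
    show "L (rank_one (u + v) v') = L (rank_one u v') + L (rank_one v v')"
      using u v v' by (simp add: rank_one_add_left L_add rank_one_in_span_squares)
  next
    fix u assume u: "u \<in> carrier D"
    show "0 \<le> L (rank_one u u)"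
      using u by (intro L_pos rank_one_squares)
    have mem: "rank_one u u \<in> span squares" "bound u - rank_one u u \<in> span squares"
      using u bound_dominates[OF u] by (auto intro: span_base rank_one_squares)
    have "L (rank_one u u) \<le> L (rank_one u u) + L (bound u - rank_one u u)"
      using L_pos[OF bound_dominates[OF u]] by simp
    also have "\<dots> = L (bound u)"
      using L_add[OF mem] by simp
    also have "\<dots> = bound_val u"
      by (rule L_G[OF bound[OF u]])
    also have "\<dots> \<le> real (card S) * (\<Sum>s\<in>S. M * (hnorm C (u s))\<^sup>2)"
      unfolding bound_val_def
    proof (intro mult_left_mono sum_mono)
      fix s assume "s \<in> S"
      then have us: "u s \<in> carrier C"
        by (rule comp_closed[OF u])
      have "Re (hinner C (p [] (u s)) (u s)) \<le> hnorm C (p [] (u s)) * hnorm C (u s)"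
        using us by (intro C.Cauchy_Schwarz_Re p1.closed)
      also have "\<dots> \<le> (M * hnorm C (u s)) * hnorm C (u s)"
        using us by (intro mult_right_mono M C.hnorm_nonneg)
      finally show "Re (hinner C (p [] (u s)) (u s)) \<le> M * (hnorm C (u s))\<^sup>2"
        by (simp add: power2_eq_square)
    qed simp
    also have "\<dots> = real (card S) * M * (\<Sum>s\<in>S. (hnorm C (u s))\<^sup>2)"
      by (simp add: sum_distrib_left mult.assoc)
    also have "(\<Sum>s\<in>S. (hnorm C (u s))\<^sup>2) = (hnorm D u)\<^sup>2"
      using hnorm_hpow[OF C.inner_product_space_axioms u] by (simp add: L2_set_def sum_nonneg)
    finally show "L (rank_one u u) \<le> real (card S) * M * (hnorm D u)\<^sup>2" .
  qed
  moreover have "(\<Sum>(s, t)\<in>factor_pairs w. L (rank_one (single t x) (single s y))) = Re (hinner C (p w x) y)"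
    if wxy: "w \<in> words m" "x \<in> carrier C" "y \<in> carrier C" for w x y
  proof -
    have "L (toeplitz w x y) = (\<Sum>a\<in>factor_pairs w. L (case a of (s, t) \<Rightarrow> rank_one (single t x) (single s y)))"
      unfolding toeplitz_def using wxy
      by (intro L_sum) (auto simp: factor_pairs_def intro!: rank_one_in_span_squares single_closed)
    then show ?thesis
      using L_G[OF G[OF wxy]] by (simp add: split_def)
  qed
  ultimately show ?thesis
    by (rule that)
qed

end

section \<open>The factorization\<close>

lemma (in hilbert_embedding) embedding_adjoint:
  "adjoint_pair H (himage j H) (restrict j (carrier H)) (restrict (inv_into (carrier H) j) (j ` carrier H))"
  unfolding adjoint_pair_def
  using embedding_bounded embedding_inverse_bounded
  by (auto simp: carrier_himage hinner_himage inj)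

lemma adj_op_zero:
  assumes "inner_product_space H" "inner_product_space K"
  shows "adj_op H K (zero_op H) = zero_op K"
proof -
  interpret H: inner_product_space H by fact
  interpret K: inner_product_space K by fact
  show ?thesis
  proof (rule adj_op_eq[OF assms])
    show "adjoint_pair H K (zero_op H) (zero_op K)"
      unfolding adjoint_pair_def
      by (intro conjI ballI zero_op_bounded assms) (simp add: zero_op_def)
  qed
qed

context operator_polynomial
begin

text \<open>The embedding of \<open>D\<close> in the type in which the auxiliary space is sought.\<close>

definition ball_fun :: "(word \<Rightarrow> 'c) \<Rightarrow> 'c aux" where
  "ball_fun \<xi> = (\<lambda>(s, x). if s \<in> S \<and> x \<in> carrier C then hinner C (\<xi> s) x else 0)"

sublocale ball: hilbert_embedding D ball_fun
proof
  show "inj_on ball_fun (carrier D)"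
  proof (rule inj_onI)
    fix \<xi> \<eta> assume \<xi>: "\<xi> \<in> carrier D" and \<eta>: "\<eta> \<in> carrier D" and eq: "ball_fun \<xi> = ball_fun \<eta>"
    show "\<xi> = \<eta>"
    proof
      fix s
      show "\<xi> s = \<eta> s"
      proof (cases "s \<in> S")
        case True
        show ?thesis
        proof (rule C.eqI_Re_inner)
          fix x assume "x \<in> carrier C"
          then show "Re (hinner C (\<xi> s) x) = Re (hinner C (\<eta> s) x)"
            using fun_cong[OF eq, of "(s, x)"] True by (simp add: ball_fun_def)
        qed (use True \<xi> \<eta> in \<open>auto simp: comp_closed\<close>)
      qed (use \<xi> \<eta> in \<open>auto simp: in_carrier_hpow\<close>)
    qed
  qed
  show "ball_fun (\<xi> + \<eta>) = ball_fun \<xi> + ball_fun \<eta>" if "\<xi> \<in> carrier D" "\<eta> \<in> carrier D" for \<xi> \<eta>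
    using that by (auto simp: fun_eq_iff ball_fun_def comp_closed C.inner_add_left)
qed

lemma single_adjoint:
  assumes s: "s \<in> S"
  shows "adjoint_pair C D (restrict (single s) (carrier C)) (restrict (\<lambda>\<xi>. \<xi> s) (carrier D))"
  unfolding adjoint_pair_def
proof (intro conjI ballI)
  show "restrict (single s) (carrier C) \<in> bounded_ops C D"
  proof (rule bounded_opsI[where M = 1])
    fix x assume x: "x \<in> carrier C"
    have "hinner D (single s x) (single s x) = hinner C x x"
      using hinner_single_left[OF s single_closed[OF s x]] by simp
    then show "hnorm D (single s x) \<le> 1 * hnorm C x"
      by (simp add: hnorm_def)
  qed (use s in \<open>auto simp: single_closed hscale_hpow C.scale_zero_right C.inner_product_space_axioms\<close>)
  show "restrict (\<lambda>\<xi>. \<xi> s) (carrier D) \<in> bounded_ops D C"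
  proof (rule bounded_opsI[where M = 1])
    show "hnorm C (\<xi> s) \<le> 1 * hnorm D \<xi>" if "\<xi> \<in> carrier D" for \<xi>
      using hnorm_hpow_component[OF C.inner_product_space_axioms finite_S that s] by simp
  qed (use s in \<open>auto simp: comp_closed hscale_hpow D.inner_product_space_axioms\<close>)
qed (use s in \<open>simp add: hinner_single_left\<close>)

text \<open>
  If \<open>R\<close> is the square root of the operator of the Gram form, then \<open>B s\<close> is the restriction of \<open>R\<close> to the
  summand with index \<open>s\<close>, with values in a copy of \<open>D\<close>, and \<open>B' s\<close> is component \<open>s\<close> of \<open>R\<close>.
\<close>

theorem factorization:
  assumes pos: "positive_poly m C p"
  obtains E :: "'c aux hspace" and B B' where "hilbert_space E"
    and "\<And>s. s \<in> S \<Longrightarrow> adjoint_pair C E (B s) (B' s)"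
    and "\<And>w x y. \<lbrakk>w \<in> words m; x \<in> carrier C; y \<in> carrier C\<rbrakk> \<Longrightarrow>
      (\<Sum>(s, t)\<in>factor_pairs w. Re (hinner C (B' s (B t x)) y)) = Re (hinner C (p w x) y)"
proof -
  show thesis
  proof (rule exists_positive_gram_form[OF pos])
    fix b M assume b: "bounded_positive_form D b M"
      and b_gram: "\<And>w x y. \<lbrakk>w \<in> words m; x \<in> carrier C; y \<in> carrier C\<rbrakk> \<Longrightarrow>
        (\<Sum>(s, t)\<in>factor_pairs w. b (single t x) (single s y)) = Re (hinner C (p w x) y)"
    obtain R where R: "adjoint_pair D D R R"
      and RR: "\<forall>u\<in>carrier D. \<forall>v\<in>carrier D. Re (hinner D (R u) (R v)) = b u v"
      using bounded_positive_form.factorization[OF b] by blast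
    interpret R: bounded_op D D R
      using R by unfold_locales (simp add: adjoint_pair_def)
    define E where "E = himage ball_fun D"
    interpret E: hilbert_space E
      unfolding E_def by (rule ball.hilbert_space_himage)
    define j where "j = restrict ball_fun (carrier D)"
    define j' where "j' = restrict (inv_into (carrier D) ball_fun) (ball_fun ` carrier D)"
    define B where "B s = compose (carrier C) (compose (carrier D) j R) (restrict (single s) (carrier C))" for s
    define B' where "B' s = compose (carrier E) (restrict (\<lambda>\<xi>. \<xi> s) (carrier D)) (compose (carrier E) R j')" for s
    have jR: "adjoint_pair D E (compose (carrier D) j R) (compose (carrier E) R j')"
      unfolding E_def j_def j'_def
      by (intro adjoint_pair_compose[OF _ _ _ R ball.embedding_adjoint]
          D.inner_product_space_axioms ball.inner_product_space_himage)
    have adj: "adjoint_pair C E (B s) (B' s)" if "s \<in> S" for s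
      unfolding B_def B'_def
      by (intro adjoint_pair_compose[OF _ _ _ single_adjoint[OF that] jR]
          C.inner_product_space_axioms D.inner_product_space_axioms E.inner_product_space_axioms)
    have B_closed: "B s x \<in> carrier E" if "s \<in> S" "x \<in> carrier C" for s x
      using adj[OF that(1)] that(2) unfolding adjoint_pair_def bounded_ops_def by blast
    have B'_closed: "B' s e \<in> carrier C" if "s \<in> S" "e \<in> carrier E" for s e
      using adj[OF that(1)] that(2) unfolding adjoint_pair_def bounded_ops_def by blast
    have "Re (hinner C (B' s (B t x)) y) = b (single t x) (single s y)"
      if "s \<in> S" "t \<in> S" "x \<in> carrier C" "y \<in> carrier C" for s t x y
    proof -
      have "Re (hinner C (B' s (B t x)) y) = Re (hinner C y (B' s (B t x)))"
        using that by (intro C.Re_inner_commute B'_closed B_closed)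
      also have "\<dots> = Re (hinner E (B s y) (B t x))"
        using adj[OF that(1)] B_closed that by (simp add: adjoint_pair_def)
      also have "\<dots> = Re (hinner E (B t x) (B s y))"
        using that by (intro E.Re_inner_commute B_closed)
      also have "\<dots> = Re (hinner D (R (single t x)) (R (single s y)))"
        using that by (simp add: B_def E_def j_def compose_eq single_closed R.closed ball.hinner_himage)
      also have "\<dots> = b (single t x) (single s y)"
        using that RR by (simp add: single_closed)
      finally show ?thesis .
    qed
    then have gram: "(\<Sum>(s, t)\<in>factor_pairs w. Re (hinner C (B' s (B t x)) y)) = Re (hinner C (p w x) y)"
      if "w \<in> words m" "x \<in> carrier C" "y \<in> carrier C" for w x y
      unfolding b_gram[OF that, symmetric] using that
      by (intro sum.cong refl) (auto simp: factor_pairs_def)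
    show thesis
      by (rule that[of E B B']) (fact E.hilbert_space_axioms adj gram)+
  qed
qed

text \<open>
  The product of polynomials sums over the supports of its factors only; the other pairs of words in the ball
  contribute zero.
\<close>

lemma poly_mult_adj:
  assumes "hilbert_space E"
    and adj: "\<And>s. s \<in> S \<Longrightarrow> adjoint_pair C E (B s) (B' s)"
    and sum: "\<And>w x y. \<lbrakk>w \<in> words m; x \<in> carrier C; y \<in> carrier C\<rbrakk> \<Longrightarrow>
      (\<Sum>(s, t)\<in>factor_pairs w. Re (hinner C (B' s (B t x)) y)) = Re (hinner C (p w x) y)"
    and q: "q = (\<lambda>s\<in>words m. if s \<in> S then B s else zero_op C)"
  shows "p = poly_mult m C E (poly_adj m C E q) q"
proof
  fix w
  interpret E: hilbert_space E by fact
  define r where "r = poly_adj m C E q"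
  have B: "bounded_op C E (B s)" and B': "bounded_op E C (B' s)" if "s \<in> S" for s
    using adj[OF that] C.inner_product_space_axioms E.inner_product_space_axioms
    by (auto simp: adjoint_pair_def intro: bounded_opI)
  have r_eq: "r s = (if s \<in> S then B' (inv\<^bsub>F\<^esub> s) else zero_op E)" if s: "s \<in> words m" for s
  proof (cases "s \<in> S")
    case True
    have "r s = adj_op C E (B (inv\<^bsub>F\<^esub> s))"
      using s True by (simp add: r_def poly_adj_def q inv_in_S)
    also have "\<dots> = B' (inv\<^bsub>F\<^esub> s)"
      by (intro adj_op_eq C.inner_product_space_axioms E.inner_product_space_axioms adj inv_in_S True)
    finally show ?thesis
      using True by simp
  next
    case False
    then have "r s = adj_op C E (zero_op C)"
      using s by (simp add: r_def poly_adj_def q inv_in_S_iff)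
    then show ?thesis
      using False adj_op_zero[OF C.inner_product_space_axioms E.inner_product_space_axioms] by simp
  qed
  show "p w = poly_mult m C E (poly_adj m C E q) q w"
  proof (cases "w \<in> words m")
    case True
    let ?I = "{(s, t). s \<in> poly_supp m E r \<and> t \<in> poly_supp m C q \<and> s \<otimes>\<^bsub>F\<^esub> t = w}"
    let ?J = "{(s, t). s \<in> S \<and> t \<in> S \<and> s \<otimes>\<^bsub>F\<^esub> t = w}"
    have sub: "?I \<subseteq> ?J"
      by (auto simp: poly_supp_def r_eq q split: if_splits)
    have fin: "finite ?J"
      by (rule finite_subset[of _ "S \<times> S"]) (auto simp: finite_S)
    have vanish: "r s (q t x) = 0" if st: "(s, t) \<in> ?J - ?I" and x: "x \<in> carrier C" for s t x
    proof -
      have s: "s \<in> S" "s \<in> words m" and t: "t \<in> S" "t \<in> words m"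
        using st S_words by auto
      interpret Bt: bounded_op C E "B t" by (rule B[OF t(1)])
      interpret Bs: bounded_op E C "B' (inv\<^bsub>F\<^esub> s)" by (rule B'[OF inv_in_S[OF s(1)]])
      have "r s = zero_op E \<or> q t = zero_op C"
        using st s t by (auto simp: poly_supp_def)
      moreover have "q t x \<in> carrier E" "r s 0 = 0"
        using t s x by (simp_all add: q r_eq Bt.closed)
      ultimately show ?thesis
        using x by (auto simp: zero_op_def)
    qed
    have coeff: "p w x = (\<Sum>(s, t)\<in>?I. r s (q t x))" if x: "x \<in> carrier C" for x
    proof -
      have "(\<Sum>(s, t)\<in>?I. r s (q t x)) = (\<Sum>(s, t)\<in>?J. r s (q t x))"
        using vanish[OF _ x] by (intro sum.mono_neutral_left fin sub) auto
      also have "\<dots> = (\<Sum>(s, t)\<in>factor_pairs w. r (inv\<^bsub>F\<^esub> s) (q t x))"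
        by (rule sum.reindex_bij_witness[of _ "\<lambda>(s, t). (inv\<^bsub>F\<^esub> s, t)" "\<lambda>(s, t). (inv\<^bsub>F\<^esub> s, t)"])
          (auto simp: factor_pairs_def inv_in_S S_words)
      also have "\<dots> = (\<Sum>(s, t)\<in>factor_pairs w. B' s (B t x))"
        by (intro sum.cong refl) (auto simp: factor_pairs_def r_eq q S_words inv_in_S)
      finally have I_eq: "(\<Sum>(s, t)\<in>?I. r s (q t x)) = (\<Sum>(s, t)\<in>factor_pairs w. B' s (B t x))" .
      have terms: "(case a of (s, t) \<Rightarrow> B' s (B t x)) \<in> carrier C" if "a \<in> factor_pairs w" for a
        using that x by (auto simp: factor_pairs_def intro!: bounded_op.closed[OF B'] bounded_op.closed[OF B])
      have "p w x = (\<Sum>(s, t)\<in>factor_pairs w. B' s (B t x))"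
      proof (rule C.eqI_Re_inner)
        show "p w x \<in> carrier C"
          using p_bounded[OF True] x unfolding bounded_ops_def by blast
        show "(\<Sum>(s, t)\<in>factor_pairs w. B' s (B t x)) \<in> carrier C"
          by (intro C.sum_closed terms)
        fix y assume y: "y \<in> carrier C"
        have "hinner C (\<Sum>a\<in>factor_pairs w. case a of (s, t) \<Rightarrow> B' s (B t x)) y
            = (\<Sum>a\<in>factor_pairs w. hinner C (case a of (s, t) \<Rightarrow> B' s (B t x)) y)"
          by (intro C.inner_sum_left terms y)
        then show "Re (hinner C (p w x) y) = Re (hinner C (\<Sum>(s, t)\<in>factor_pairs w. B' s (B t x)) y)"
          by (simp add: sum[OF True x y, symmetric] split_def)
      qed
      then show ?thesis
        using I_eq by simp
    qed
    have "p w \<in> extensional (carrier C)"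
      using p_bounded[OF True] by (auto simp: bounded_ops_def PiE_def)
    then have "p w = restrict (p w) (carrier C)"
      by (simp add: extensional_restrict)
    also have "\<dots> = restrict (\<lambda>x. \<Sum>(s, t)\<in>?I. r s (q t x)) (carrier C)"
      by (rule restrict_ext) (rule coeff)
    finally show ?thesis
      using True by (simp add: poly_mult_def r_def)
  next
    case False
    then show ?thesis
      using p by (auto simp: poly_mult_def polynomials_def PiE_def extensional_def)
  qed
qed

end

theorem theorem7p1:
  fixes m :: nat
    and C :: "'c::ab_group_add hspace"
    and p :: "word \<Rightarrow> 'c \<Rightarrow> 'c"
  assumes "hilbert_space C"
    and "p \<in> polynomials m C C"
    and "positive_poly m C p"
  shows "\<exists>(E :: 'c aux hspace) (B :: word \<Rightarrow> 'c \<Rightarrow> 'c aux).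
           hilbert_space E \<and>
           (\<forall>s\<in>words m. length s \<le> poly_deg m C p \<longrightarrow> B s \<in> bounded_ops C E) \<and>
           (let q = (\<lambda>s\<in>words m. if length s \<le> poly_deg m C p then B s else zero_op C)
            in p = poly_mult m C E (poly_adj m C E q) q)"
proof -
  interpret operator_polynomial C m p
    using assms by (simp add: operator_polynomial_def operator_polynomial_axioms_def)
  show ?thesis
  proof (rule factorization[OF assms(3)])
    fix E :: "'c aux hspace" and B B' assume E: "hilbert_space E"
      and adj: "\<And>s. s \<in> S \<Longrightarrow> adjoint_pair C E (B s) (B' s)"
      and sum: "\<And>w x y. \<lbrakk>w \<in> words m; x \<in> carrier C; y \<in> carrier C\<rbrakk> \<Longrightarrow>
        (\<Sum>(s, t)\<in>factor_pairs w. Re (hinner C (B' s (B t x)) y)) = Re (hinner C (p w x) y)"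
    have q: "(\<lambda>s\<in>words m. if length s \<le> poly_deg m C p then B s else zero_op C)
        = (\<lambda>s\<in>words m. if s \<in> S then B s else zero_op C)"
      by (auto simp: S_def)
    have "p = poly_mult m C E (poly_adj m C E (\<lambda>s\<in>words m. if s \<in> S then B s else zero_op C))
        (\<lambda>s\<in>words m. if s \<in> S then B s else zero_op C)"
      by (rule poly_mult_adj[of E B B']) (fact E adj sum refl)+
    moreover have "\<forall>s\<in>words m. length s \<le> poly_deg m C p \<longrightarrow> B s \<in> bounded_ops C E"
      using adj by (simp add: S_def adjoint_pair_def)
    ultimately show ?thesis
      using E unfolding Let_def q[symmetric] by blast
  qed
qed

end
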